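(* Let $k\ge2$. Then the model checking problem of $\mathrm{LTL}_k(\sim,\mathsf F)$ is logspace-reducible to the satisfiability problem of $\mathrm{LTL}_k(\sim,\mathsf F)$.
   Context: Let $\mathrm{AP}$ be a countably infinite set of atomic propositions. A trace is an infinite sequence $t=t(0)t(1)\cdots\in(\wp\mathrm{AP})^\omega$, and $t^i=t(i)t(i+1)\cdots$. A team is a (possibly empty) set $T$ of traces, and $T^i=\{t^i: t\in T\}$. Formulas of $\mathrm{LTL}(\sim)$ are given by $\varphi::=p\mid\neg\varphi\mid\varphi\wedge\varphi\mid\varphi\vee\varphi\mid\mathsf X\varphi\mid\mathsf F\varphi\mid\mathsf G\varphi\mid\varphi\,\mathsf U\,\varphi\mid\varphi\,\mathsf R\,\varphi\mid{\sim}\varphi$ with $p\in\mathrm{AP}$. Synchronous team semantics: $T\models p$ iff $p\in t(0)$ for all $t\in T$; $T\models\neg\varphi$ iff $\{t\}\not\models\varphi$ for all $t\in T$; $T\models\varphi\wedge\psi$ iff $T\models\varphi$ and $T\models\psi$; $T\models\varphi\vee\psi$ iff $T=S\cup U$ for some $S,U$ with $S\models\varphi$ and $U\models\psi$; $T\models\mathsf X\varphi$ iff $T^1\models\varphi$; $T\models\mathsf F\varphi$ iff $T^k\models\varphi$ for some $k\ge0$; $T\models\mathsf G\varphi$ iff $T^k\models\varphi$ for all $k\ge0$; $T\models\varphi\,\mathsf U\,\psi$ iff there is $k\ge0$ with $T^k\models\psi$ and $T^j\models\varphi$ for all $j<k$; $T\models\varphi\,\mathsf R\,\psi$ iff for all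 $k\ge0$, $T^k\models\psi$ or $T^j\models\varphi$ for some $j<k$; $T\models{\sim}\varphi$ iff $T\not\models\varphi$. The temporal depth of a formula is the maximal nesting depth of the temporal operators $\mathsf X,\mathsf F,\mathsf G,\mathsf U,\mathsf R$; $\mathrm{LTL}_k(\sim,O_1,\dots,O_n)$ is the set of $\mathrm{LTL}(\sim)$-formulas of temporal depth at most $k$ whose only temporal operators are among $O_1,\dots,O_n$ (the connectives $\neg,\wedge,\vee,\sim$ are unrestricted). A finite Kripke structure is $K=(W,R,\eta,r)$ with $W$ finite nonempty, $R\subseteq W\times W$ serial, $\eta:W\to\wp\mathrm{AP}$ with finite labels, and root $r\in W$; a path is $\pi\in W^\omega$ with $\pi(0)=r$ and $(\pi(i),\pi(i+1))\in R$; it induces the trace $(\eta(\pi(i)))_{i\ge0}$; $T(K)$ is the team of all induced traces. Model checking of a fragment $L$: the set of pairs $(K,\varphi)$ with $\varphi\in L$, $K$ a finite Kripke structure and $T(K)\models\varphi$. Satisfiability of $L$: the set of $\varphi\in L$ satisfied by some team. *)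

theory Defs
  imports Complex_Main
begin

datatype fml =
    Atom nat
  | Neg fml
  | Conj fml fml
  | Disj fml fml
  | Next fml
  | Fut fml
  | Glob fml
  | Until fml fml
  | Rel fml fml
  | Tilde fml

type_synonym trace = "nat \<Rightarrow> nat set"
type_synonym team = "trace set"

definition tsuffix :: "trace \<Rightarrow> nat \<Rightarrow> trace" where
  "tsuffix t i = (\<lambda>j. t (i + j))"

definition team_suffix :: "team \<Rightarrow> nat \<Rightarrow> team" where
  "team_suffix T i = (\<lambda>t. tsuffix t i) ` T"

primrec tsat :: "team \<Rightarrow> fml \<Rightarrow> bool" where
  "tsat T (Atom p) = (\<forall>t\<in>T. p \<in> t 0)"
| "tsat T (Neg \<phi>) = (\<forall>t\<in>T. \<not> tsat {t} \<phi>)"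
| "tsat T (Conj \<phi> \<psi>) = (tsat T \<phi> \<and> tsat T \<psi>)"
| "tsat T (Disj \<phi> \<psi>) = (\<exists>S U. T = S \<union> U \<and> tsat S \<phi> \<and> tsat U \<psi>)"
| "tsat T (Next \<phi>) = tsat (team_suffix T 1) \<phi>"
| "tsat T (Fut \<phi>) = (\<exists>k. tsat (team_suffix T k) \<phi>)"
| "tsat T (Glob \<phi>) = (\<forall>k. tsat (team_suffix T k) \<phi>)"
| "tsat T (Until \<phi> \<psi>) =
     (\<exists>k. tsat (team_suffix T k) \<psi> \<and> (\<forall>j<k. tsat (team_suffix T j) \<phi>))"
| "tsat T (Rel \<phi> \<psi>) =
     (\<forall>k. tsat (team_suffix T k) \<psi> \<or> (\<exists>j<k. tsat (team_suffix T j) \<phi>))"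
| "tsat T (Tilde \<phi>) = (\<not> tsat T \<phi>)"

primrec tdepth :: "fml \<Rightarrow> nat" where
  "tdepth (Atom p) = 0"
| "tdepth (Neg \<phi>) = tdepth \<phi>"
| "tdepth (Conj \<phi> \<psi>) = max (tdepth \<phi>) (tdepth \<psi>)"
| "tdepth (Disj \<phi> \<psi>) = max (tdepth \<phi>) (tdepth \<psi>)"
| "tdepth (Next \<phi>) = Suc (tdepth \<phi>)"
| "tdepth (Fut \<phi>) = Suc (tdepth \<phi>)"
| "tdepth (Glob \<phi>) = Suc (tdepth \<phi>)"
| "tdepth (Until \<phi> \<psi>) = Suc (max (tdepth \<phi>) (tdepth \<psi>))"
| "tdepth (Rel \<phi> \<psi>) = Suc (max (tdepth \<phi>) (tdepth \<psi>))"
| "tdepth (Tilde \<phi>) = tdepth \<phi>"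

primrec onlyF :: "fml \<Rightarrow> bool" where
  "onlyF (Atom p) = True"
| "onlyF (Neg \<phi>) = onlyF \<phi>"
| "onlyF (Conj \<phi> \<psi>) = (onlyF \<phi> \<and> onlyF \<psi>)"
| "onlyF (Disj \<phi> \<psi>) = (onlyF \<phi> \<and> onlyF \<psi>)"
| "onlyF (Next \<phi>) = False"
| "onlyF (Fut \<phi>) = onlyF \<phi>"
| "onlyF (Glob \<phi>) = False"
| "onlyF (Until \<phi> \<psi>) = False"
| "onlyF (Rel \<phi> \<psi>) = False"
| "onlyF (Tilde \<phi>) = onlyF \<phi>"

definition LTL_F :: "nat \<Rightarrow> fml set" where
  "LTL_F k = {\<phi>. tdepth \<phi> \<le> k \<and> onlyF \<phi>}"

text \<open>Worlds are 0,...,kn-1; edges are given as a list; the label of world w is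
  the finite set of atoms in the list klab ! w; kroot is the root.\<close>
record kripke =
  kn :: nat
  kedges :: "(nat \<times> nat) list"
  klab :: "nat list list"
  kroot :: nat

definition wf_kripke :: "kripke \<Rightarrow> bool" where
  "wf_kripke K \<longleftrightarrow> 0 < kn K
     \<and> (\<forall>(u, v) \<in> set (kedges K). u < kn K \<and> v < kn K)
     \<and> (\<forall>u < kn K. \<exists>v. (u, v) \<in> set (kedges K))
     \<and> length (klab K) = kn K
     \<and> kroot K < kn K"

definition is_path :: "kripke \<Rightarrow> (nat \<Rightarrow> nat) \<Rightarrow> bool" where
  "is_path K \<pi> \<longleftrightarrow> \<pi> 0 = kroot K \<and> (\<forall>i. (\<pi> i, \<pi> (Suc i)) \<in> set (kedges K))"

definition path_trace :: "kripke \<Rightarrow> (nat \<Rightarrow> nat) \<Rightarrow> trace" where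
  "path_trace K \<pi> = (\<lambda>i. set (klab K ! \<pi> i))"

definition kteam :: "kripke \<Rightarrow> team" where
  "kteam K = {path_trace K \<pi> | \<pi>. is_path K \<pi>}"

datatype sym = D0 | D1 | Hash | CAtom | CNeg | CConj | CDisj | CX | CF | CG | CU | CR | CTilde

fun bin :: "nat \<Rightarrow> sym list" where
  "bin n = (if n = 0 then [] else bin (n div 2) @ [if odd n then D1 else D0])"

definition enc_nat :: "nat \<Rightarrow> sym list" where
  "enc_nat n = bin n @ [Hash]"

primrec enc_fml :: "fml \<Rightarrow> sym list" where
  "enc_fml (Atom p) = CAtom # enc_nat p"
| "enc_fml (Neg \<phi>) = CNeg # enc_fml \<phi>"
| "enc_fml (Conj \<phi> \<psi>) = CConj # enc_fml \<phi> @ enc_fml \<psi>"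
| "enc_fml (Disj \<phi> \<psi>) = CDisj # enc_fml \<phi> @ enc_fml \<psi>"
| "enc_fml (Next \<phi>) = CX # enc_fml \<phi>"
| "enc_fml (Fut \<phi>) = CF # enc_fml \<phi>"
| "enc_fml (Glob \<phi>) = CG # enc_fml \<phi>"
| "enc_fml (Until \<phi> \<psi>) = CU # enc_fml \<phi> @ enc_fml \<psi>"
| "enc_fml (Rel \<phi> \<psi>) = CR # enc_fml \<phi> @ enc_fml \<psi>"
| "enc_fml (Tilde \<phi>) = CTilde # enc_fml \<phi>"

definition enc_list :: "('a \<Rightarrow> sym list) \<Rightarrow> 'a list \<Rightarrow> sym list" where
  "enc_list e xs = enc_nat (length xs) @ concat (map e xs)"

definition enc_kripke :: "kripke \<Rightarrow> sym list" where
  "enc_kripke K = enc_nat (kn K)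
     @ enc_list (\<lambda>(u, v). enc_nat u @ enc_nat v) (kedges K)
     @ enc_list (enc_list enc_nat) (klab K)
     @ enc_nat (kroot K)"

definition MC_lang :: "nat \<Rightarrow> sym list set" where
  "MC_lang k = {enc_kripke K @ enc_fml \<phi> | K \<phi>.
      wf_kripke K \<and> \<phi> \<in> LTL_F k \<and> tsat (kteam K) \<phi>}"

definition SAT_lang :: "nat \<Rightarrow> sym list set" where
  "SAT_lang k = {enc_fml \<phi> | \<phi>. \<phi> \<in> LTL_F k \<and> (\<exists>T. tsat T \<phi>)}"

text \<open>A deterministic Turing transducer with a two-way read-only input tape
  (with end markers at positions 0 and length+1), one two-way read/write work tape
  (one-sided infinite, blank symbol 0) and a one-way write-only output tape.
  States are 0..<tm_Q (start state 0, halting state 1), work symbols 0..<tm_G.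
  A transition yields (new state, input head move, written work symbol,
  work head move, optional output symbol).\<close>

type_synonym action = "nat \<times> int \<times> nat \<times> int \<times> sym option"

record tm =
  tm_Q :: nat
  tm_G :: nat
  tm_delta :: "nat \<Rightarrow> sym option \<Rightarrow> nat \<Rightarrow> action"

definition valid_tm :: "tm \<Rightarrow> bool" where
  "valid_tm M \<longleftrightarrow> 2 \<le> tm_Q M \<and> 1 \<le> tm_G M \<and>
     (\<forall>q a g q' di g' dw out. q < tm_Q M \<longrightarrow> g < tm_G M \<longrightarrow>
        tm_delta M q a g = (q', di, g', dw, out) \<longrightarrow>
        q' < tm_Q M \<and> g' < tm_G M \<and> di \<in> {-1, 0, 1} \<and> dw \<in> {-1, 0, 1})"

record config =
  cst :: nat
  ipos :: nat
  wtape :: "nat \<Rightarrow> nat"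
  wpos :: nat
  outp :: "sym list"

definition read_in :: "sym list \<Rightarrow> nat \<Rightarrow> sym option" where
  "read_in x i = (if 1 \<le> i \<and> i \<le> length x then Some (x ! (i - 1)) else None)"

definition init_config :: config where
  "init_config = \<lparr>cst = 0, ipos = 0, wtape = (\<lambda>_. 0), wpos = 0, outp = []\<rparr>"

definition tm_step :: "tm \<Rightarrow> sym list \<Rightarrow> config \<Rightarrow> config" where
  "tm_step M x c =
    (if cst c = 1 then c else
     (case tm_delta M (cst c) (read_in x (ipos c)) (wtape c (wpos c)) of
        (q', di, g', dw, out) \<Rightarrow>
          \<lparr>cst = q',
           ipos = nat (min (int (length x + 1)) (int (ipos c) + di)),
           wtape = (wtape c)(wpos c := g'),
           wpos = nat (int (wpos c) + dw),
           outp = outp c @ (case out of None \<Rightarrow> [] | Some s \<Rightarrow> [s])\<rparr>))"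

definition tm_run :: "tm \<Rightarrow> sym list \<Rightarrow> nat \<Rightarrow> config" where
  "tm_run M x n = (tm_step M x ^^ n) init_config"

definition log_len :: "sym list \<Rightarrow> nat" where
  "log_len x = nat \<lceil>log 2 (real (length x + 2))\<rceil>"

definition logspace_computable :: "(sym list \<Rightarrow> sym list) \<Rightarrow> bool" where
  "logspace_computable f \<longleftrightarrow> (\<exists>M c. valid_tm M \<and>
     (\<forall>x. \<exists>t. cst (tm_run M x t) = 1 \<and> outp (tm_run M x t) = f x \<and>
            (\<forall>m \<le> t. wpos (tm_run M x m) \<le> c * log_len x)))"

definition logspace_reducible :: "sym list set \<Rightarrow> sym list set \<Rightarrow> bool" where
  "logspace_reducible A B \<longleftrightarrow>
     (\<exists>f. logspace_computable f \<and> (\<forall>x. x \<in> A \<longleftrightarrow> f x \<in> B))"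

end

theory Submission
  imports Defs "HOL-Library.Countable" "HOL-Library.Sublist"
begin

text \<open>
  Given a Kripke structure \<open>K\<close> and a formula \<open>\<phi>\<close>, the reduction produces a formula whose models
  consist of path traces (atom 0 holds throughout) and marker traces. A marker has two consecutive
  intervals \<open>E\<close> and \<open>N\<close> and carries a world. As every formula with \<open>F\<close> only is invariant under uniform
  stuttering of the team, single steps cannot be expressed; instead the formula forces the
  \<open>E\<close>-intervals of the markers to partition the time line into finite blocks, with \<open>N\<close> inside the block
  following \<open>E\<close>. Relative to the markers one can say at depth 1 that a path trace is constant on blocks
  and moves along an edge from block to block. Conversely, a set of markers, that is, a subteam
  selected by splitting, describes a sequence of worlds, so that quantification over subteams
  expresses that every path of \<open>K\<close> occurs. Depth 2 is needed only for monotonicity over time, hence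
  \<open>k \<ge> 2\<close>. Finally \<open>\<phi>\<close> is evaluated on the path traces, with each atom replaced by the disjunction of the
  worlds carrying it.

  The machine never checks whether \<open>\<phi>\<close> is well formed: it is copied symbol by symbol, the replacement
  of an atom keeping a copy of the atom, so that the output codes a formula of the fragment iff
  the input does. Logarithmic space is obtained from a while language whose registers are tracks of
  binary digits on the work tape; each register operation is one sweep over the tape.
\<close>

section \<open>Logarithmic space transducers\<close>

text \<open>Which edge is taken differs from path to path, whereas \<open>Fut\<close> moves the
  whole team to one common instant. A subteam chosen before the \<open>Fut\<close> therefore has to
  fix block and edge together: markers of the block are kept in it as its memory of the instant, and
  since the two halves of a split may overlap, all parts can share them. In the other direction an
  infinite path has to be named by a subteam, which a choice of one marker per block does.

  The checks are divided. The machine verifies ranges and list lengths; seriality is left to the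
  formula, which is unsatisfiable if some world lacks a successor. An input without a valid
  structure is sent to the empty word, which codes no formula.

  The numeral of an atom can be almost as long as the input, so its value need not fit into
  logarithmic space; such numerals are compared in place on the input tape. Registers hold only
  worlds, counters and head positions. The bound \<open>2 * length x + 4\<close> leaves room for
  these and for doubling a value below \<open>Suc (length x)\<close>.\<close>

declare bin.simps [simp del]

type_synonym 'r cell = "'r \<Rightarrow> bool"

datatype 'r test = TLess 'r 'r | TSym "sym option set"
datatype 'r basic = OutS sym | OutCur | MovL | MovR
  | Inc 'r | Dec 'r | Dbl bool 'r | Cpy 'r 'r | OutBin 'r
datatype 'r instr = Bas "'r basic" | JNot "'r test" nat | Hlt

type_synonym 'r state = "('r \<Rightarrow> nat) \<times> nat \<times> sym list"

fun test_holds :: "sym list \<Rightarrow> 'r test \<Rightarrow> 'r state \<Rightarrow> bool" where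
  "test_holds x (TLess u v) (\<sigma>, h, out) = (\<sigma> u < \<sigma> v)"
| "test_holds x (TSym A) (\<sigma>, h, out) = (read_in x h \<in> A)"

fun basic_ok :: "nat \<Rightarrow> 'r basic \<Rightarrow> 'r state \<Rightarrow> bool" where
  "basic_ok B (Inc v) (\<sigma>, h, out) = (Suc (\<sigma> v) \<le> B)"
| "basic_ok B (Dec v) (\<sigma>, h, out) = (0 < \<sigma> v)"
| "basic_ok B (Dbl b v) (\<sigma>, h, out) = (2 * \<sigma> v + of_bool b \<le> B)"
| "basic_ok B _ s = True"

fun basic_eff :: "sym list \<Rightarrow> 'r basic \<Rightarrow> 'r state \<Rightarrow> 'r state" where
  "basic_eff x (OutS s) (\<sigma>, h, out) = (\<sigma>, h, out @ [s])"
| "basic_eff x OutCur (\<sigma>, h, out) =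
     (\<sigma>, h, out @ (case read_in x h of None \<Rightarrow> [] | Some s \<Rightarrow> [s]))"
| "basic_eff x MovL (\<sigma>, h, out) = (\<sigma>, h - 1, out)"
| "basic_eff x MovR (\<sigma>, h, out) = (\<sigma>, min (Suc (length x)) (Suc h), out)"
| "basic_eff x (Inc v) (\<sigma>, h, out) = (\<sigma>(v := Suc (\<sigma> v)), h, out)"
| "basic_eff x (Dec v) (\<sigma>, h, out) = (\<sigma>(v := \<sigma> v - 1), h, out)"
| "basic_eff x (Dbl b v) (\<sigma>, h, out) = (\<sigma>(v := 2 * \<sigma> v + of_bool b), h, out)"
| "basic_eff x (Cpy u v) (\<sigma>, h, out) = (\<sigma>(u := \<sigma> v), h, out)"
| "basic_eff x (OutBin v) (\<sigma>, h, out) = (\<sigma>, h, out @ bin (\<sigma> v))"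

text \<open>Without \<open>basic_ok\<close> there is no step: exceeding \<open>B\<close> or
  decrementing zero leaves the run stuck. A run that reaches a final program counter thus certifies
  the bound on the registers.\<close>

inductive mstep :: "sym list \<Rightarrow> nat \<Rightarrow> 'r instr list \<Rightarrow> nat \<times> 'r state \<Rightarrow> nat \<times> 'r state \<Rightarrow> bool"
  for x B P where
  "pc < length P \<Longrightarrow> P ! pc = Bas b \<Longrightarrow> basic_ok B b st \<Longrightarrow>
    mstep x B P (pc, st) (Suc pc, basic_eff x b st)"
| "pc < length P \<Longrightarrow> P ! pc = JNot t tgt \<Longrightarrow>
    mstep x B P (pc, st) (if test_holds x t st then Suc pc else tgt, st)"

definition final_pc :: "'r instr list \<Rightarrow> nat \<Rightarrow> bool" where
  "final_pc P pc \<longleftrightarrow> length P \<le> pc \<or> P ! pc = Hlt"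

subsection \<open>Sweeps over the work tape\<close>

text \<open>Each tape cell carries one binary digit of every register, the least significant digits
  leftmost, so that carries travel with a sweep to the right.\<close>

fun val :: "'r \<Rightarrow> 'r cell list \<Rightarrow> nat" where
  "val v [] = 0"
| "val v (c # cs) = of_bool (c v) + 2 * val v cs"

fun init_bit :: "'r instr \<Rightarrow> bool" where
  "init_bit (Bas (Inc v)) = True"
| "init_bit (Bas (Dec v)) = True"
| "init_bit (Bas (Dbl b v)) = b"
| "init_bit _ = False"

text \<open>The state bit of the rightward sweep is the carry for \<open>Inc\<close>, the borrow for
  \<open>Dec\<close> and the digit to be shifted in for \<open>Dbl\<close>. For \<open>TLess\<close>
  it is the outcome on the digits passed so far; each differing digit overwrites it, so the most
  significant difference decides.\<close>

fun fwd :: "'r instr \<Rightarrow> bool \<Rightarrow> 'r cell \<Rightarrow> bool \<times> 'r cell" where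
  "fwd (Bas (Inc v)) s c = (s \<and> c v, c(v := (c v \<noteq> s)))"
| "fwd (Bas (Dec v)) s c = (s \<and> \<not> c v, c(v := (c v \<noteq> s)))"
| "fwd (Bas (Dbl b v)) s c = (c v, c(v := s))"
| "fwd (Bas (Cpy u v)) s c = (s, c(u := c v))"
| "fwd (JNot (TLess u v) t) s c = ((if c u = c v then s else c v), c)"
| "fwd _ s c = (s, c)"

fun carry :: "'r instr \<Rightarrow> bool \<Rightarrow> 'r cell list" where
  "carry (Bas (Inc v)) s = (if s then [\<lambda>w. w = v] else [])"
| "carry (Bas (Dbl b v)) s = (if s then [\<lambda>w. w = v] else [])"
| "carry _ s = []"

text \<open>The leftward sweep meets the most significant digit first, which is the order of output.
  The bit records that a one has been seen and so suppresses leading zeros.\<close>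

fun bwd :: "'r instr \<Rightarrow> bool \<Rightarrow> 'r cell \<Rightarrow> bool \<times> sym option" where
  "bwd (Bas (OutBin v)) r c =
     (if c v then (True, Some D1) else if r then (True, Some D0) else (False, None))"
| "bwd _ r c = (r, None)"

fun next_pc :: "'r instr \<Rightarrow> nat \<Rightarrow> bool \<Rightarrow> nat" where
  "next_pc (JNot t tgt) pc r = (if r then Suc pc else tgt)"
| "next_pc _ pc r = Suc pc"

fun sweep :: "'r instr \<Rightarrow> bool \<Rightarrow> 'r cell list \<Rightarrow> bool \<times> 'r cell list" where
  "sweep i s [] = (s, [])"
| "sweep i s (c # cs) =
     (fst (sweep i (fst (fwd i s c)) cs), snd (fwd i s c) # snd (sweep i (fst (fwd i s c)) cs))"

definition oplist :: "'a option \<Rightarrow> 'a list" where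
  "oplist a = (case a of None \<Rightarrow> [] | Some s \<Rightarrow> [s])"

fun backs :: "'r instr \<Rightarrow> bool \<Rightarrow> 'r cell list \<Rightarrow> bool \<times> sym list" where
  "backs i r [] = (r, [])"
| "backs i r (c # cs) = (let (r1, o1) = backs i r cs in
     (fst (bwd i r1 c), o1 @ oplist (snd (bwd i r1 c))))"

section \<open>Arithmetical effect of a sweep\<close>

lemma backs_snoc:
  "backs i r (cs @ [c]) = (fst (backs i (fst (bwd i r c)) cs),
     oplist (snd (bwd i r c)) @ snd (backs i (fst (bwd i r c)) cs))"
  by (induction cs) (auto simp: case_prod_beta Let_def)

lemma length_sweep [simp]: "length (snd (sweep i s cs)) = length cs"
  by (induction cs arbitrary: s) auto

lemma val_append: "val v (cs @ ds) = val v cs + 2 ^ length cs * val v ds"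
  by (induction cs) (auto simp: algebra_simps)

lemma val_less: "val v cs < 2 ^ length cs"
  by (induction cs) (auto)

text \<open>The final state bit is the digit that did not fit and weighs
  \<open>2 ^ length cs\<close>. Counting it makes the equation exact for either incoming carry, as
  the induction over the cells requires.\<close>

lemma sweep_Inc:
  "val w (snd (sweep (Bas (Inc v)) s cs)) + (if w = v \<and> fst (sweep (Bas (Inc v)) s cs) then 2 ^ length cs else 0)
     = val w cs + (if w = v then of_bool s else 0)"
proof (induction cs arbitrary: s)
  case (Cons c cs)
  show ?case using Cons[of True] Cons[of False] by (cases s; cases "c v"; cases "w = v") (auto split: if_splits)
qed auto

lemma sweep_Dec:
  "val w (snd (sweep (Bas (Dec v)) s cs)) + (if w = v then of_bool s else 0)
     = val w cs + (if w = v \<and> fst (sweep (Bas (Dec v)) s cs) then 2 ^ length cs else 0)"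
proof (induction cs arbitrary: s)
  case (Cons c cs)
  show ?case using Cons[of True] Cons[of False] by (cases s; cases "c v"; cases "w = v") (auto split: if_splits)
qed auto

lemma sweep_Dbl:
  "val w (snd (sweep (Bas (Dbl b v)) s cs)) + (if w = v \<and> fst (sweep (Bas (Dbl b v)) s cs) then 2 ^ length cs else 0)
     = (if w = v then 2 * val w cs + of_bool s else val w cs)"
proof (induction cs arbitrary: s)
  case (Cons c cs)
  show ?case using Cons[of True] Cons[of False] by (cases s; cases "c v"; cases "w = v") (auto split: if_splits)
qed auto

lemma sweep_Cpy:
  "val w (snd (sweep (Bas (Cpy u v)) s cs)) = (if w = u then val v cs else val w cs)"
  by (induction cs arbitrary: s) auto

lemma sweep_Less:
  "snd (sweep (JNot (TLess u v) t) s cs) = cs"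
  "fst (sweep (JNot (TLess u v) t) s cs) \<longleftrightarrow> val u cs < val v cs \<or> val u cs = val v cs \<and> s"
proof -
  show "snd (sweep (JNot (TLess u v) t) s cs) = cs" by (induction cs arbitrary: s) auto
  show "fst (sweep (JNot (TLess u v) t) s cs) \<longleftrightarrow> val u cs < val v cs \<or> val u cs = val v cs \<and> s"
  proof (induction cs arbitrary: s)
    case (Cons c cs)
    have odd_even: "2 * a \<noteq> Suc (2 * b)" for a b :: nat by presburger
    have "(Suc (2 * a) < 2 * b \<or> Suc (2 * a) = 2 * b \<and> s) = (a < b)" for a b :: nat
      using odd_even[of b a] by auto
    moreover have "(2 * a < Suc (2 * b) \<or> 2 * a = Suc (2 * b) \<and> s) = (a < b \<or> a = b)" for a b :: nat
      using odd_even[of a b] by auto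
    ultimately show ?case using Cons by (cases "c u"; cases "c v") simp_all
  qed auto
qed

lemma bin_0 [simp]: "bin 0 = []" by (simp add: bin.simps)

lemma bin_double: "0 < m \<or> b \<Longrightarrow> bin (2 * m + of_bool b) = bin m @ [if b then D1 else D0]"
  by (subst bin.simps) auto

lemma bin_eq_Nil [simp]: "bin n = [] \<longleftrightarrow> n = 0"
  by (subst bin.simps) auto

lemma sweep_OutBin: "sweep (Bas (OutBin v)) s cs = (s, cs)"
  by (induction cs arbitrary: s) auto

lemma backs_OutBin: "backs (Bas (OutBin v)) False cs = (0 < val v cs, bin (val v cs))"
proof (induction cs)
  case (Cons c cs)
  show ?case using Cons bin_double[of "val v cs" "c v"]
    by (auto simp: oplist_def add.commute split: if_splits)
qed auto

lemma backs_other: "(\<And>v. i \<noteq> Bas (OutBin v)) \<Longrightarrow> backs i r cs = (r, [])"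
proof (induction cs)
  case (Cons c cs)
  have "bwd i r c = (r, None)" using Cons.prems by (cases "(i, r, c)" rule: bwd.cases) auto
  then show ?case using Cons by (auto simp: oplist_def)
qed auto

subsection \<open>Simulation by a transducer\<close>

fun one_step :: "'r instr \<Rightarrow> bool" where
  "one_step (Bas (OutS s)) = True"
| "one_step (Bas OutCur) = True"
| "one_step (Bas MovL) = True"
| "one_step (Bas MovR) = True"
| "one_step (JNot (TSym A) t) = True"
| "one_step _ = False"

fun head_move :: "'r instr \<Rightarrow> int" where
  "head_move (Bas MovL) = -1"
| "head_move (Bas MovR) = 1"
| "head_move _ = 0"

fun emitted :: "'r instr \<Rightarrow> sym option \<Rightarrow> sym option" where
  "emitted (Bas (OutS s)) a = Some s"
| "emitted (Bas OutCur) a = a"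
| "emitted _ a = None"

fun sym_jump :: "'r instr \<Rightarrow> nat \<Rightarrow> sym option \<Rightarrow> nat" where
  "sym_jump (JNot (TSym A) t) pc a = (if a \<in> A then Suc pc else t)"
| "sym_jump _ pc a = Suc pc"

text \<open>Work symbol 0 is the blank; the Boolean flag marks the leftmost cell.\<close>

definition cell_code :: "bool \<Rightarrow> 'r::finite cell \<Rightarrow> nat" where
  "cell_code b c = Suc (to_nat (b, c))"

definition cell_of :: "nat \<Rightarrow> bool \<times> ('r::finite cell)" where
  "cell_of g = from_nat (g - 1)"

lemma cell_of_code [simp]: "cell_of (cell_code b c) = (b, c)"
  by (simp add: cell_of_def cell_code_def)

lemma cell_code_pos [simp]: "0 < cell_code b c" "cell_code b c \<noteq> 0"
  by (simp_all add: cell_code_def)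

text \<open>A control state consists of the program counter, the direction of the current sweep
  (\<open>True\<close> = back to the left) and one bit.\<close>

definition state_code :: "'r instr list \<Rightarrow> nat \<Rightarrow> bool \<Rightarrow> bool \<Rightarrow> nat" where
  "state_code P pc d s = (if pc < length P \<and> P ! pc \<noteq> Hlt then Suc (Suc (to_nat (pc, d, s))) else 1)"

definition enter :: "'r instr list \<Rightarrow> nat \<Rightarrow> nat" where
  "enter P pc = state_code P pc False (init_bit (P ! pc))"

definition state_of :: "nat \<Rightarrow> nat \<times> bool \<times> bool" where
  "state_of q = from_nat (q - 2)"

text \<open>State 0 only writes the first cell with its left-end flag. The blank marks the right end
  of the data, where a sweep turns round and appends a cell if a carry is left; the flag marks the
  left end, where the next instruction is entered.\<close>

definition delta :: "'r::finite instr list \<Rightarrow> nat \<Rightarrow> sym option \<Rightarrow> nat \<Rightarrow> action" where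
  "delta P q a g =
    (if q = 0 then (enter P 0, 0, cell_code True (\<lambda>_::'r. False), 0, None)
     else case state_of q of (pc, d, s) \<Rightarrow> let i = P ! pc; (fl, c) = cell_of g in
       if one_step i then (enter P (sym_jump i pc a), head_move i, g, 0, emitted i a)
       else if \<not> d then
         (if g = 0
          then (state_code P pc True s, 0,
                (case carry i s of [] \<Rightarrow> 0 | e # _ \<Rightarrow> cell_code False e), -1, None)
          else (state_code P pc False (fst (fwd i s c)), 0,
                cell_code fl (snd (fwd i s c)), 1, None))
       else (let (r, out) = bwd i s c in
         if fl then (enter P (next_pc i pc r), 0, g, 0, out)
         else (state_code P pc True r, 0, g, -1, out)))"

definition the_tm :: "'r::finite instr list \<Rightarrow> tm" where
  "the_tm P = \<lparr>tm_Q = Suc (Suc (Suc (Max (to_nat ` ({..<length P} \<times> (UNIV :: (bool \<times> bool) set)))))),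
     tm_G = Suc (Suc (Max (range (to_nat :: bool \<times> ('r cell) \<Rightarrow> nat)))),
     tm_delta = delta P\<rparr>"

lemma state_code_less: "state_code P pc d s < tm_Q (the_tm P)"
proof (cases "pc < length P")
  case True
  then have "to_nat (pc, d, s) \<le> Max (to_nat ` ({..<length P} \<times> (UNIV :: (bool \<times> bool) set)))"
    by (intro Max_ge) auto
  then show ?thesis by (auto simp: state_code_def the_tm_def)
qed (auto simp: state_code_def the_tm_def)

lemma cell_code_less: "cell_code b (c :: 'r::finite cell) < tm_G (the_tm (P :: 'r instr list))"
proof -
  have "to_nat (b, c) \<le> Max (range (to_nat :: bool \<times> ('r cell) \<Rightarrow> nat))"
    by (intro Max_ge) auto
  then have "to_nat (b, c) < Suc (Max (range (to_nat :: bool \<times> ('r cell) \<Rightarrow> nat)))" by (rule le_imp_less_Suc)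
  then show ?thesis unfolding cell_code_def the_tm_def by simp
qed

lemma head_move_range: "head_move i \<in> {-1, 0, 1}"
  by (cases i rule: head_move.cases) auto

lemma valid_the_tm: "valid_tm (the_tm P)"
  unfolding valid_tm_def
proof (intro conjI allI impI)
  show "2 \<le> tm_Q (the_tm P)" "1 \<le> tm_G (the_tm P)" by (simp_all add: the_tm_def)
next
  fix q a g q' di g' dw out
  assume g: "g < tm_G (the_tm P)" and d: "tm_delta (the_tm P) q a g = (q', di, g', dw, out)"
  have 0: "0 < tm_G (the_tm P)" by (simp add: the_tm_def)
  note lt = state_code_less[of P] cell_code_less[of _ _ P] head_move_range g 0
  have d': "delta P q a g = (q', di, g', dw, out)" using d by (simp add: the_tm_def)
  show "q' < tm_Q (the_tm P)" 
    using d' lt by (auto simp: delta_def enter_def Let_def case_prod_beta split: if_splits)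
  show "g' < tm_G (the_tm P)" 
    using d' lt by (auto simp: delta_def enter_def Let_def case_prod_beta split: if_splits list.splits)
  show "di \<in> {-1, 0, 1}" 
    using d' head_move_range[of "P ! fst (state_of q)"] by (auto simp: delta_def enter_def Let_def case_prod_beta split: if_splits)
  show "dw \<in> {-1, 0, 1}" 
    using d' lt by (auto simp: delta_def enter_def Let_def case_prod_beta split: if_splits)
qed

definition tape :: "'r::finite cell list \<Rightarrow> nat \<Rightarrow> nat" where
  "tape cs i = (if i < length cs then cell_code (i = 0) (cs ! i) else 0)"

definition cfg :: "nat \<Rightarrow> nat \<Rightarrow> 'r::finite cell list \<Rightarrow> nat \<Rightarrow> sym list \<Rightarrow> config" where
  "cfg q h cs w out = \<lparr>cst = q, ipos = h, wtape = tape cs, wpos = w, outp = out\<rparr>"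

text \<open>Only the configuration before the step has to respect \<open>W\<close>; the last one of
  a run is covered separately, since its head is back on cell 0.\<close>

definition bstep :: "tm \<Rightarrow> sym list \<Rightarrow> nat \<Rightarrow> config \<Rightarrow> config \<Rightarrow> bool" where
  "bstep M x W c c' \<longleftrightarrow> wpos c \<le> W \<and> c' = tm_step M x c"

lemma bstep_run:
  assumes "(bstep M x W)\<^sup>*\<^sup>* c c'"
  shows "\<exists>t. c' = (tm_step M x ^^ t) c \<and> (\<forall>m<t. wpos ((tm_step M x ^^ m) c) \<le> W)"
  using assms
proof (induction rule: rtranclp_induct)
  case base
  show ?case by (rule exI[of _ 0]) auto
next
  case (step y z)
  then obtain t where "y = (tm_step M x ^^ t) c" "\<forall>m<t. wpos ((tm_step M x ^^ m) c) \<le> W" by auto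
  with step(2) show ?case by (intro exI[of _ "Suc t"]) (auto simp: bstep_def less_Suc_eq)
qed

lemma state_of_code:
  "pc < length P \<Longrightarrow> P ! pc \<noteq> Hlt \<Longrightarrow> state_of (state_code P pc d s) = (pc, d, s)"
  by (simp add: state_of_def state_code_def)

lemma state_code_live:
  "pc < length P \<Longrightarrow> P ! pc \<noteq> Hlt \<Longrightarrow> state_code P pc d s \<noteq> 0"
  "pc < length P \<Longrightarrow> P ! pc \<noteq> Hlt \<Longrightarrow> state_code P pc d s \<noteq> Suc 0"
  by (auto simp: state_code_def)

lemma tape_update:
  "w < length cs \<Longrightarrow> (tape cs)(w := cell_code (w = 0) c) = tape (cs[w := c])"
  by (auto simp: tape_def fun_eq_iff nth_list_update)

lemma tape_same: "(tape cs)(w := tape cs w) = tape cs" by auto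

lemma sim_fwd:
  assumes pc: "pc < length P" "P ! pc \<noteq> Hlt" "\<not> one_step (P ! pc)"
    and h: "h \<le> Suc (length x)" and W: "length ds + length cs \<le> W"
  shows "(bstep (the_tm P) x W)\<^sup>*\<^sup>* (cfg (state_code P pc False s) h (ds @ cs) (length ds) out)
     (cfg (state_code P pc False (fst (sweep (P ! pc) s cs))) h (ds @ snd (sweep (P ! pc) s cs))
        (length ds + length cs) out)"
  using W
proof (induction cs arbitrary: ds s)
  case (Cons c cs)
  let ?s = "fst (fwd (P ! pc) s c)" and ?c = "snd (fwd (P ! pc) s c)"
  have t: "tape (ds @ c # cs) (length ds) = cell_code (length ds = 0) c" by (simp add: tape_def)
  have "bstep (the_tm P) x W (cfg (state_code P pc False s) h (ds @ c # cs) (length ds) out)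
     (cfg (state_code P pc False ?s) h ((ds @ [?c]) @ cs) (length (ds @ [?c])) out)"
    using Cons.prems pc h tape_update[of "length ds" "ds @ c # cs" ?c]
    by (simp add: bstep_def cfg_def tm_step_def state_code_live the_tm_def delta_def state_of_code t
       Let_def case_prod_beta list_update_append nat_add_distrib)
  also have "(bstep (the_tm P) x W)\<^sup>*\<^sup>* \<dots>
     (cfg (state_code P pc False (fst (sweep (P ! pc) ?s cs))) h ((ds @ [?c]) @ snd (sweep (P ! pc) ?s cs))
        (length (ds @ [?c]) + length cs) out)"
    using Cons.IH[of "ds @ [?c]" ?s] Cons.prems by simp
  finally show ?case by simp
qed simp

text \<open>A remaining carry becomes a new top cell on the blank. The head is then to the left of
  this cell, so the leftward sweep sees the old cells only.\<close>

lemma sim_turn: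
  assumes pc: "pc < length P" "P ! pc \<noteq> Hlt" "\<not> one_step (P ! pc)"
    and h: "h \<le> Suc (length x)" and W: "length cs \<le> W" and "cs \<noteq> []"
  shows "bstep (the_tm P) x W (cfg (state_code P pc False s) h cs (length cs) out)
     (cfg (state_code P pc True s) h (cs @ carry (P ! pc) s) (length cs - 1) out)"
proof -
  have t: "tape cs (length cs) = 0" by (simp add: tape_def)
  have "(tape cs)(length cs := (case carry (P ! pc) s of [] \<Rightarrow> 0 | e # _ \<Rightarrow> cell_code False e)) = tape (cs @ carry (P ! pc) s)"
    using \<open>cs \<noteq> []\<close>
    by (cases "(P ! pc, s)" rule: carry.cases) (auto simp: tape_def fun_eq_iff nth_append)
  then show ?thesis using assms
    by (simp add: bstep_def cfg_def tm_step_def state_code_live the_tm_def delta_def state_of_code t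
       Let_def case_prod_beta nat_diff_distrib)
qed

lemma sim_bwd:
  assumes pc: "pc < length P" "P ! pc \<noteq> Hlt" "\<not> one_step (P ! pc)"
    and h: "h \<le> Suc (length x)" and "n < length cs" "n \<le> W"
  shows "(bstep (the_tm P) x W)\<^sup>*\<^sup>* (cfg (state_code P pc True s) h cs n out)
     (cfg (enter P (next_pc (P ! pc) pc (fst (backs (P ! pc) s (take (Suc n) cs))))) h cs 0
        (out @ snd (backs (P ! pc) s (take (Suc n) cs))))"
  using assms(5,6)
proof (induction n arbitrary: s out)
  case 0
  then obtain c cs' where cs: "cs = c # cs'" by (cases cs) auto
  have t: "tape cs 0 = cell_code True c" and tk: "take (Suc 0) cs = [c]" by (simp_all add: tape_def cs)
  have "bstep (the_tm P) x W (cfg (state_code P pc True s) h cs 0 out)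
     (cfg (enter P (next_pc (P ! pc) pc (fst (backs (P ! pc) s (take (Suc 0) cs))))) h cs 0
        (out @ snd (backs (P ! pc) s (take (Suc 0) cs))))"
    using pc h tape_same[of cs 0] unfolding t
    by (simp add: bstep_def cfg_def tm_step_def state_code_live the_tm_def delta_def state_of_code t
       Let_def case_prod_beta tk oplist_def)
  then show ?case by blast
next
  case (Suc n)
  let ?c = "cs ! Suc n"
  have t: "tape cs (Suc n) = cell_code False ?c" using Suc.prems by (simp add: tape_def)
  have "bstep (the_tm P) x W (cfg (state_code P pc True s) h cs (Suc n) out)
     (cfg (state_code P pc True (fst (bwd (P ! pc) s ?c))) h cs n (out @ oplist (snd (bwd (P ! pc) s ?c))))"
    using pc h Suc.prems tape_same[of cs "Suc n"] unfolding t
    by (simp add: bstep_def cfg_def tm_step_def state_code_live the_tm_def delta_def state_of_code t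
       Let_def case_prod_beta oplist_def)
  also note Suc.IH[of "fst (bwd (P ! pc) s ?c)" "out @ oplist (snd (bwd (P ! pc) s ?c))"]
  finally show ?case using Suc.prems
    unfolding take_Suc_conv_app_nth[OF Suc.prems(1)] backs_snoc by simp
qed

lemma sim_sweep:
  assumes pc: "pc < length P" "P ! pc \<noteq> Hlt" "\<not> one_step (P ! pc)"
    and h: "h \<le> Suc (length x)" and W: "length cs \<le> W" and "cs \<noteq> []"
    and sw: "sweep (P ! pc) (init_bit (P ! pc)) cs = (s, cs')"
    and ba: "backs (P ! pc) s cs' = (r, out')"
  shows "(bstep (the_tm P) x W)\<^sup>*\<^sup>* (cfg (enter P pc) h cs 0 out)
     (cfg (enter P (next_pc (P ! pc) pc r)) h (cs' @ carry (P ! pc) s) 0 (out @ out'))"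
proof -
  have len: "length cs' = length cs" using sw length_sweep by (metis snd_conv)
  have "(bstep (the_tm P) x W)\<^sup>*\<^sup>* (cfg (enter P pc) h cs 0 out)
     (cfg (state_code P pc False s) h cs' (length cs) out)"
    using sim_fwd[OF pc h, of "[]" cs W "init_bit (P ! pc)" out] W sw by (simp add: enter_def)
  also have "bstep (the_tm P) x W (cfg (state_code P pc False s) h cs' (length cs) out)
     (cfg (state_code P pc True s) h (cs' @ carry (P ! pc) s) (length cs - 1) out)"
    using sim_turn[OF pc h, of cs' W s out] len W \<open>cs \<noteq> []\<close>
    by (metis length_0_conv)
  also have "(bstep (the_tm P) x W)\<^sup>*\<^sup>* \<dots>
     (cfg (enter P (next_pc (P ! pc) pc r)) h (cs' @ carry (P ! pc) s) 0 (out @ out'))"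
    using sim_bwd[OF pc h, of "length cs - 1" "cs' @ carry (P ! pc) s" W s out] len W \<open>cs \<noteq> []\<close> ba
    by (cases "length cs") auto
  finally show ?thesis .
qed

text \<open>The tape is lengthened only when a register needs the new digit, and it is never
  shortened. Hence it is either the initial single cell, or the place value of its top cell has been
  reached by a register and is at most \<open>B\<close>; this bounds the space.\<close>

definition rep :: "nat \<Rightarrow> ('r \<Rightarrow> nat) \<Rightarrow> 'r cell list \<Rightarrow> bool" where
  "rep B \<sigma> cs \<longleftrightarrow> (\<forall>v. val v cs = \<sigma> v) \<and> cs \<noteq> [] \<and> (length cs = 1 \<or> 2 ^ (length cs - 1) \<le> B)"

lemma rep_len: "rep B \<sigma> cs \<Longrightarrow> B < 2 ^ W \<Longrightarrow> 0 < W \<Longrightarrow> length cs \<le> W"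
proof -
  assume "rep B \<sigma> cs" "B < 2 ^ W" "0 < W"
  show ?thesis
  proof (cases "length cs = 1")
    case False
    then have "2 ^ (length cs - 1) \<le> B" using \<open>rep B \<sigma> cs\<close> by (simp add: rep_def)
    then have "(2::nat) ^ (length cs - 1) < 2 ^ W" using \<open>B < 2 ^ W\<close> by (rule le_less_trans)
    then have "length cs - 1 < W" by (rule power_less_imp_less_exp[rotated]) simp
    then show ?thesis by linarith
  qed (use \<open>0 < W\<close> in auto)
qed

lemma rep_append:
  assumes "rep B \<sigma> cs" "length cs' = length cs" "\<And>w. val w cs' + (if w = v \<and> s then 2 ^ length cs else 0) = \<sigma>' w"
    and "\<sigma>' v \<le> B"
  shows "rep B \<sigma>' (cs' @ (if s then [\<lambda>w. w = v] else []))"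
proof -
  have "val w (cs' @ (if s then [\<lambda>w. w = v] else [])) = \<sigma>' w" for w
    using assms(2) assms(3)[of w] by (auto simp: val_append)
  moreover have "s \<Longrightarrow> 2 ^ length cs \<le> B" using assms(3)[of v] assms(4) by auto
  ultimately show ?thesis using assms(1,2) by (auto simp: rep_def)
qed

lemma sim_mstep:
  assumes "mstep x B P (pc, \<sigma>, h, out) (pc', \<sigma>', h', out')" and rep: "rep B \<sigma> cs"
    and h: "h \<le> Suc (length x)" and W: "B < 2 ^ W" "0 < W"
  shows "h' \<le> Suc (length x) \<and> (\<exists>cs'. rep B \<sigma>' cs' \<and>
    (bstep (the_tm P) x W)\<^sup>*\<^sup>* (cfg (enter P pc) h cs 0 out) (cfg (enter P pc') h' cs' 0 out'))"
proof -
  have L: "length cs \<le> W" and ne: "cs \<noteq> []" using rep rep_len W by (auto simp: rep_def)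
  have pc: "pc < length P" "P ! pc \<noteq> Hlt" using assms(1) by (auto elim: mstep.cases)
  have one: ?thesis if "one_step (P ! pc)" "\<sigma>' = \<sigma>" "pc' = sym_jump (P ! pc) pc (read_in x h)"
      "h' = nat (min (int (length x + 1)) (int h + head_move (P ! pc)))" "out' = out @ oplist (emitted (P ! pc) (read_in x h))"
  proof -
    have "bstep (the_tm P) x W (cfg (enter P pc) h cs 0 out) (cfg (enter P pc') h' cs 0 out')"
      using that pc tape_same[of cs 0]
      by (simp add: bstep_def cfg_def tm_step_def state_code_live the_tm_def delta_def state_of_code
         Let_def case_prod_beta oplist_def enter_def)
    then show ?thesis using rep that by auto
  qed
  have swp: ?thesis if "\<not> one_step (P ! pc)"
     "sweep (P ! pc) (init_bit (P ! pc)) cs = (s, cs')" "backs (P ! pc) s cs' = (r, o1)" 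
     "rep B \<sigma>' (cs' @ carry (P ! pc) s)" "pc' = next_pc (P ! pc) pc r" "out' = out @ o1" "h' = h" for s cs' r o1
    using sim_sweep[OF pc that(1) h L ne that(2,3), of out] that h by auto
  from assms(1) show ?thesis
  proof (cases rule: mstep.cases)
    case (1 b)
    show ?thesis
    proof (cases b)
      case (OutS s)
      then show ?thesis using 1 one h by (auto simp: oplist_def)
    next
      case OutCur
      then show ?thesis using 1 one h by (auto simp: oplist_def)
    next
      case MovL
      have "nat (min (1 + int (length x)) (int h - 1)) = h - 1" using h by auto
      then show ?thesis using MovL 1 one h by (auto simp: oplist_def)
    next
      case MovR
      have "nat (min (1 + int (length x)) (int h + 1)) = min (Suc (length x)) (Suc h)" using h by auto
      then show ?thesis using MovR 1 one h by (auto simp: oplist_def)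
    next
      case (Inc v)
      obtain s cs' where sw: "sweep (P ! pc) (init_bit (P ! pc)) cs = (s, cs')" by fastforce
      have "rep B \<sigma>' (cs' @ (if s then [\<lambda>w. w = v] else []))"
        by (rule rep_append[OF rep])
          (use sweep_Inc[of _ v True cs] sw 1 Inc rep length_sweep[of "P ! pc" True cs] in \<open>auto simp: rep_def\<close>)
      then show ?thesis using swp[OF _ sw, of s "[]"] 1 Inc by (auto simp: backs_other)
    next
      case (Dbl b' v)
      obtain s cs' where sw: "sweep (P ! pc) (init_bit (P ! pc)) cs = (s, cs')" by fastforce
      have "rep B \<sigma>' (cs' @ (if s then [\<lambda>w. w = v] else []))"
        by (rule rep_append[OF rep])
          (use sweep_Dbl[of _ b' v b' cs] sw 1 Dbl rep length_sweep[of "P ! pc" b' cs] in \<open>auto simp: rep_def\<close>)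
      then show ?thesis using swp[OF _ sw, of s "[]"] 1 Dbl by (auto simp: backs_other)
    next
      case (Dec v)
      obtain s cs' where sw: "sweep (P ! pc) (init_bit (P ! pc)) cs = (s, cs')" by fastforce
      have len: "length cs' = length cs" using length_sweep[of "P ! pc" _ cs] sw by (metis snd_conv)
      have v: "0 < val v cs" "\<sigma>' = \<sigma>(v := \<sigma> v - 1)" using 1 Dec rep by (auto simp: rep_def)
      have sd: "val w cs' + (if w = v then 1 else 0) = val w cs + (if w = v \<and> s then 2 ^ length cs else 0)" for w
        using sweep_Dec[of w v True cs] sw 1 Dec by (auto)
      \<comment> \<open>As the old value is positive, a borrow surviving the sweep would make the
        new value at least \<open>2 ^ length cs\<close>, which \<open>length cs\<close> digits
        cannot hold.\<close>
      have "\<not> s" using sd[of v] val_less[of v cs'] v len by auto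
      then have "val w cs' = \<sigma>' w" for w
        using sd[of w] v rep by (cases "w = v") (simp_all add: rep_def)
      then have "rep B \<sigma>' cs'" using rep len by (auto simp: rep_def)
      then show ?thesis using swp[OF _ sw, of s "[]"] 1 Dec by (auto simp: backs_other)
    next
      case (Cpy u v)
      obtain s cs' where sw: "sweep (P ! pc) (init_bit (P ! pc)) cs = (s, cs')" by fastforce
      have len: "length cs' = length cs" using length_sweep[of "P ! pc" _ cs] sw by (metis snd_conv)
      have "rep B \<sigma>' cs'" using sweep_Cpy[of _ u v False cs] sw 1 Cpy rep len by (auto simp: rep_def)
      then show ?thesis using swp[OF _ sw, of s "[]"] 1 Cpy by (auto simp: backs_other)
    next
      case (OutBin v)
      have sw: "sweep (P ! pc) (init_bit (P ! pc)) cs = (False, cs)" using 1 OutBin by (simp add: sweep_OutBin)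
      show ?thesis using swp[OF _ sw, of "0 < val v cs" "bin (val v cs)"] 1 OutBin rep 
        by (auto simp: backs_OutBin rep_def)
    qed
  next
    case (2 t tgt)
    show ?thesis
    proof (cases t)
      case (TSym A)
      have "nat (min (1 + int (length x)) (int h)) = h" using h by auto
      then show ?thesis using 2 TSym one h by (auto simp: oplist_def)
    next
      case (TLess u v)
      have sw: "sweep (P ! pc) (init_bit (P ! pc)) cs = (\<sigma> u < \<sigma> v, cs)" 
        using sweep_Less[of u v tgt False cs] rep 2 TLess by (auto simp: rep_def intro!: prod_eqI)
      show ?thesis using swp[OF _ sw, of "\<sigma> u < \<sigma> v" "[]"] 2 TLess rep by (auto simp: backs_other)
    qed
  qed
qed

lemma sim_msteps:
  assumes "(mstep x B P)\<^sup>*\<^sup>* (pc, \<sigma>, h, out) (pc', \<sigma>', h', out')" and rep: "rep B \<sigma> cs"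
    and h: "h \<le> Suc (length x)" and W: "B < 2 ^ W" "0 < W"
  shows "h' \<le> Suc (length x) \<and> (\<exists>cs'. rep B \<sigma>' cs' \<and>
    (bstep (the_tm P) x W)\<^sup>*\<^sup>* (cfg (enter P pc) h cs 0 out) (cfg (enter P pc') h' cs' 0 out'))"
  using assms(1)
proof (induction "(pc', \<sigma>', h', out')" arbitrary: pc' \<sigma>' h' out' rule: rtranclp_induct)
  case base
  then show ?case using rep h by auto
next
  case (step y)
  obtain pc1 \<sigma>1 h1 out1 where y: "y = (pc1, \<sigma>1, h1, out1)" by (metis prod_cases4)
  from step(3)[OF y] obtain cs1 where "h1 \<le> Suc (length x)" "rep B \<sigma>1 cs1"
    "(bstep (the_tm P) x W)\<^sup>*\<^sup>* (cfg (enter P pc) h cs 0 out) (cfg (enter P pc1) h1 cs1 0 out1)" by auto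
  with sim_mstep[OF step(2)[unfolded y], of cs1 W] W show ?case by (meson rtranclp_trans)
qed

theorem logspace_computable_machine:
  fixes P :: "'r::finite instr list"
  assumes "\<And>x. \<exists>pc \<sigma> h. (mstep x (2 * length x + 4) P)\<^sup>*\<^sup>* (0, (\<lambda>_. 0), 0, []) (pc, \<sigma>, h, f x) \<and> final_pc P pc"
  shows "logspace_computable f"
  unfolding logspace_computable_def
proof (rule exI[of _ "the_tm P"], rule exI[of _ 3], intro conjI allI)
  show "valid_tm (the_tm P)" by (rule valid_the_tm)
next
  fix x :: "sym list"
  let ?N = "length x" let ?B = "2 * ?N + 4" let ?W = "3 * log_len x"
  have "real (?N + 2) \<ge> 1" by simp
  then have "0 \<le> log 2 (real (?N + 2))" by simp
  have "log 2 (real (?N + 2)) \<le> real (log_len x)" unfolding log_len_def by linarith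
  then have "real (?N + 2) \<le> 2 powr real (log_len x)" by (subst (asm) log_le_iff) auto
  then have "real (?N + 2) \<le> real (2 ^ log_len x)" by (simp add: powr_realpow)
  then have N: "?N + 2 \<le> 2 ^ log_len x" by linarith
  have L: "0 < log_len x" using N by (cases "log_len x") auto
  \<comment> \<open>The register bound is \<open>2 * (length x + 2)\<close>, at most
    \<open>2 ^ (log_len x + 1)\<close>; the factor 3 is chosen because
    \<open>log_len x + 1 < 3 * log_len x\<close> for positive \<open>log_len x\<close>.\<close>
  have "2 * (2::nat) ^ log_len x < 2 ^ ?W" using L by (subst power_Suc[symmetric], intro power_strict_increasing) auto
  then have W: "?B < 2 ^ ?W" "0 < ?W" using N L by auto
  obtain pc \<sigma> h where run: "(mstep x ?B P)\<^sup>*\<^sup>* (0, (\<lambda>_. 0), 0, []) (pc, \<sigma>, h, f x)" and fin: "final_pc P pc"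
    using assms by blast
  let ?c0 = "cfg (enter P 0) 0 [\<lambda>_::'r. False] 0 []"
  have "rep ?B (\<lambda>_. 0) [\<lambda>_::'r. False]" by (simp add: rep_def)
  from sim_msteps[OF run this _ W] obtain cs' :: "'r cell list" where
    r: "(bstep (the_tm P) x ?W)\<^sup>*\<^sup>* ?c0 (cfg (enter P pc) h cs' 0 (f x))" by blast
  have "(\<lambda>_. 0)(0 := cell_code True (\<lambda>_::'r. False)) = tape [\<lambda>_::'r. False]"
    by (auto simp: tape_def fun_eq_iff)
  then have "bstep (the_tm P) x ?W init_config ?c0"
    by (simp add: bstep_def init_config_def tm_step_def the_tm_def delta_def cfg_def)
  with r have "(bstep (the_tm P) x ?W)\<^sup>*\<^sup>* init_config (cfg (enter P pc) h cs' 0 (f x))" by auto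
  from bstep_run[OF this] obtain t where t: "cfg (enter P pc) h cs' 0 (f x) = tm_run (the_tm P) x t"
    "\<forall>m<t. wpos (tm_run (the_tm P) x m) \<le> ?W" unfolding tm_run_def by auto
  have "enter P pc = 1" using fin by (auto simp: enter_def state_code_def final_pc_def)
  then show "\<exists>t. cst (tm_run (the_tm P) x t) = 1 \<and> outp (tm_run (the_tm P) x t) = f x \<and>
            (\<forall>m\<le>t. wpos (tm_run (the_tm P) x m) \<le> ?W)"
    using t by (intro exI[of _ t]) (auto simp: cfg_def le_less t(1)[symmetric])
qed


subsection \<open>A while language\<close>

datatype 'r com = Basic "'r basic" | Skip | Rej
  | Seq "'r com" "'r com" (infixr ";;" 60)
  | Cond "'r test" "'r com" "'r com"
  | Loop "'r test" "'r com"

text \<open>The Boolean argument is \<open>False\<close> if the run was aborted by \<open>Rej\<close>.\<close>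

inductive big :: "sym list \<Rightarrow> nat \<Rightarrow> 'r com \<Rightarrow> 'r state \<Rightarrow> bool \<Rightarrow> 'r state \<Rightarrow> bool"
  for x B where
  BBasic: "basic_ok B b s \<Longrightarrow> s' = basic_eff x b s \<Longrightarrow> big x B (Basic b) s True s'"
| BSkip: "big x B Skip s True s"
| BRej: "big x B Rej s False s"
| BSeq: "big x B c1 s True s' \<Longrightarrow> big x B c2 s' ok s'' \<Longrightarrow> big x B (c1 ;; c2) s ok s''"
| BSeqR: "big x B c1 s False s' \<Longrightarrow> big x B (c1 ;; c2) s False s'"
| BCondT: "test_holds x t s \<Longrightarrow> big x B c1 s ok s' \<Longrightarrow> big x B (Cond t c1 c2) s ok s'"
| BCondF: "\<not> test_holds x t s \<Longrightarrow> big x B c2 s ok s' \<Longrightarrow> big x B (Cond t c1 c2) s ok s'"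
| BLoopF: "\<not> test_holds x t s \<Longrightarrow> big x B (Loop t c) s True s"
| BLoopT: "test_holds x t s \<Longrightarrow> big x B c s True s' \<Longrightarrow> big x B (Loop t c) s' ok s''
    \<Longrightarrow> big x B (Loop t c) s ok s''"
| BLoopR: "test_holds x t s \<Longrightarrow> big x B c s False s' \<Longrightarrow> big x B (Loop t c) s False s'"

text \<open>Jump targets are absolute, hence the start address \<open>i\<close>. A
  \<open>JNot\<close> on \<open>TSym {}\<close> is an unconditional jump, as this test never
  holds.\<close>

fun compile :: "nat \<Rightarrow> 'r com \<Rightarrow> 'r instr list" where
  "compile i (Basic b) = [Bas b]"
| "compile i Skip = []"
| "compile i Rej = [Hlt]"
| "compile i (c1 ;; c2) = compile i c1 @ compile (i + length (compile i c1)) c2"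
| "compile i (Cond t c1 c2) =
    (let A = compile (Suc i) c1; j = Suc (Suc (i + length A)); D = compile j c2
     in [JNot t j] @ A @ [JNot (TSym {}) (j + length D)] @ D)"
| "compile i (Loop t c) =
    (let A = compile (Suc i) c in [JNot t (Suc (Suc (i + length A)))] @ A @ [JNot (TSym {}) i])"

lemma mstep_JNot:
  assumes "P = pre @ JNot t tgt # post"
  shows "mstep x B P (length pre, s) (if test_holds x t s then Suc (length pre) else tgt, s)"
  by (rule mstep.intros) (simp_all add: assms)

lemma never: "\<not> test_holds x (TSym {}) s" by (cases s) auto

text \<open>The surrounding code \<open>pre\<close> and \<open>post\<close> is arbitrary, so that
  the induction hypotheses apply to subcommands at their absolute addresses.\<close>

lemma compile_correct:
  assumes "big x B c s ok s'" and "P = pre @ compile (length pre) c @ post"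
  shows "\<exists>pc. (mstep x B P)\<^sup>*\<^sup>* (length pre, s) (pc, s') \<and>
     (if ok then pc = length pre + length (compile (length pre) c) else final_pc P pc)"
  using assms
proof (induction arbitrary: pre post rule: big.induct)
  case (BBasic b s s')
  have "mstep x B P (length pre, s) (Suc (length pre), basic_eff x b s)"
    by (rule mstep.intros) (use BBasic in auto)
  then show ?case using BBasic by auto
next
  case (BSkip s)
  then show ?case by auto
next
  case (BRej s)
  then show ?case by (intro exI[of _ "length pre"]) (auto simp: final_pc_def)
next
  case (BSeq c1 s s' c2 ok s'')
  let ?p = "pre @ compile (length pre) c1"
  from BSeq.IH(1)[of pre "compile (length ?p) c2 @ post"] BSeq.IH(2)[of ?p post] BSeq.prems
  show ?case by (auto simp: ac_simps)
next
  case (BSeqR c1 s s' c2)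
  let ?p = "pre @ compile (length pre) c1"
  from BSeqR.IH[of pre "compile (length ?p) c2 @ post"] BSeqR.prems
  show ?case by auto
next
  case (BCondT t s c1 ok s' c2)
  define A where "A = compile (Suc (length pre)) c1"
  define j where "j = Suc (Suc (length pre + length A))"
  define D where "D = compile j c2"
  have P: "P = pre @ JNot t j # (A @ [JNot (TSym {}) (j + length D)] @ D @ post)"
    using BCondT.prems by (simp add: A_def j_def D_def Let_def)
  have 1: "mstep x B P (length pre, s) (Suc (length pre), s)"
    using mstep_JNot[OF P, of x B s] BCondT.hyps by auto
  from BCondT.IH[of "pre @ [JNot t j]" "[JNot (TSym {}) (j + length D)] @ D @ post"] P
  obtain pc where 2: "(mstep x B P)\<^sup>*\<^sup>* (Suc (length pre), s) (pc, s')"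
     "if ok then pc = Suc (length pre) + length A else final_pc P pc" by (auto simp: A_def)
  have P': "P = (pre @ JNot t j # A) @ JNot (TSym {}) (j + length D) # (D @ post)" using P by simp
  have 3: "mstep x B P (length (pre @ JNot t j # A), s') (j + length D, s')"
    using mstep_JNot[OF P', of x B s'] never[of x s'] by simp
  from 1 2(1) have 4: "(mstep x B P)\<^sup>*\<^sup>* (length pre, s) (pc, s')" by auto
  have len: "length pre + length (compile (length pre) (Cond t c1 c2)) = j + length D"
    by (simp add: A_def j_def D_def Let_def)
  show ?case
  proof (cases ok)
    case True
    with 2 3 4 have "(mstep x B P)\<^sup>*\<^sup>* (length pre, s) (j + length D, s')"
      by (auto intro: rtranclp.rtrancl_into_rtrancl)
    then show ?thesis using len True by auto
  qed (use 2 4 in auto)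
next
  case (BCondF t s c2 ok s' c1)
  define A where "A = compile (Suc (length pre)) c1"
  define j where "j = Suc (Suc (length pre + length A))"
  define D where "D = compile j c2"
  have P: "P = pre @ JNot t j # (A @ [JNot (TSym {}) (j + length D)] @ D @ post)"
    using BCondF.prems by (simp add: A_def j_def D_def Let_def)
  have 1: "mstep x B P (length pre, s) (j, s)"
    using mstep_JNot[OF P, of x B s] BCondF.hyps by auto
  have len: "length pre + length (compile (length pre) (Cond t c1 c2)) = j + length D"
    by (simp add: A_def j_def D_def Let_def)
  define p where "p = pre @ JNot t j # A @ [JNot (TSym {}) (j + length D)]"
  have lp: "length p = j" by (simp add: p_def j_def)
  have "P = p @ compile (length p) c2 @ post" unfolding lp by (simp add: p_def P flip: D_def)
  from BCondF.IH[OF this, unfolded lp, folded D_def]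
  obtain pc where 2: "(mstep x B P)\<^sup>*\<^sup>* (j, s) (pc, s')"
     "if ok then pc = j + length D else final_pc P pc" by blast
  from 1 2(1) have "(mstep x B P)\<^sup>*\<^sup>* (length pre, s) (pc, s')" by auto
  then show ?case using 2(2) len by auto
next
  case (BLoopF t s c)
  define A where "A = compile (Suc (length pre)) c"
  have P: "P = pre @ JNot t (Suc (Suc (length pre + length A))) # (A @ [JNot (TSym {}) (length pre)] @ post)"
    using BLoopF.prems by (simp add: A_def Let_def)
  show ?case using mstep_JNot[OF P, of x B s] BLoopF.hyps by (auto simp: A_def Let_def)
next
  case (BLoopT t s c s' ok s'')
  define A where "A = compile (Suc (length pre)) c"
  let ?i = "JNot t (Suc (Suc (length pre + length A)))"
  have P: "P = pre @ ?i # (A @ [JNot (TSym {}) (length pre)] @ post)"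
    using BLoopT.prems by (simp add: A_def Let_def)
  have 1: "mstep x B P (length pre, s) (Suc (length pre), s)"
    using mstep_JNot[OF P, of x B s] BLoopT.hyps by auto
  from BLoopT.IH(1)[of "pre @ [?i]" "[JNot (TSym {}) (length pre)] @ post"] P
  have 2: "(mstep x B P)\<^sup>*\<^sup>* (Suc (length pre), s) (Suc (length pre) + length A, s')" by (auto simp: A_def)
  have P': "P = (pre @ ?i # A) @ JNot (TSym {}) (length pre) # post" using P by simp
  have 3: "mstep x B P (Suc (length pre) + length A, s') (length pre, s')"
    using mstep_JNot[OF P', of x B s'] never[of x s'] by simp
  have 4: "(mstep x B P)\<^sup>*\<^sup>* (length pre, s) (length pre, s')"
    using 1 2 3 by (meson converse_rtranclp_into_rtranclp rtranclp.rtrancl_into_rtrancl)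
  from BLoopT.IH(2)[OF BLoopT.prems] show ?case using 4 by (meson rtranclp_trans)
next
  case (BLoopR t s c s')
  define A where "A = compile (Suc (length pre)) c"
  let ?i = "JNot t (Suc (Suc (length pre + length A)))"
  have P: "P = pre @ ?i # (A @ [JNot (TSym {}) (length pre)] @ post)"
    using BLoopR.prems by (simp add: A_def Let_def)
  have 1: "mstep x B P (length pre, s) (Suc (length pre), s)"
    using mstep_JNot[OF P, of x B s] BLoopR.hyps by auto
  from BLoopR.IH[of "pre @ [?i]" "[JNot (TSym {}) (length pre)] @ post"] P 
  obtain pc where "(mstep x B P)\<^sup>*\<^sup>* (Suc (length pre), s) (pc, s')" "final_pc P pc" by (auto simp: A_def)
  then show ?case using 1 by (auto intro: converse_rtranclp_into_rtranclp)
qed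

theorem logspace_computable_com:
  fixes c :: "'r::finite com"
  assumes "\<And>x. \<exists>ok \<sigma> h. big x (2 * length x + 4) c ((\<lambda>_. 0), 0, []) ok (\<sigma>, h, f x)"
  shows "logspace_computable f"
proof (rule logspace_computable_machine)
  fix x
  obtain ok \<sigma> h where "big x (2 * length x + 4) c ((\<lambda>_. 0), 0, []) ok (\<sigma>, h, f x)" using assms by blast
  from compile_correct[OF this, of "compile 0 c" "[]" "[]"]
  show "\<exists>pc \<sigma> h. (mstep x (2 * length x + 4) (compile 0 c))\<^sup>*\<^sup>* (0, (\<lambda>_. 0), 0, []) (pc, \<sigma>, h, f x)
      \<and> final_pc (compile 0 c) pc"
    by (auto simp: final_pc_def split: if_splits)
qed

section \<open>The formula\<close>

text \<open>Atom 0 distinguishes path traces from markers, and the world \<open>w\<close> is the atom \<open>wn w\<close>. On a marker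
  the atoms 2, 4, 6 become true one after the other and stay true; their changes delimit the
  interval \<open>E\<close> (2 but not 4) and the interval \<open>N\<close> (4 but not 6).\<close>

definition wn :: "nat \<Rightarrow> nat" where "wn w = 2 * w + 1"

definition fE :: fml where "fE = Conj (Neg (Atom 0)) (Conj (Atom 2) (Neg (Atom 4)))"
definition fN :: fml where "fN = Conj (Neg (Atom 0)) (Conj (Atom 4) (Neg (Atom 6)))"
definition fTop :: fml where "fTop = Tilde (Conj (Atom 0) (Tilde (Atom 0)))"
text \<open>In team semantics a contradiction between literals still holds of the empty team;
  \<open>fBot\<close> is the neutral element of \<open>Disj\<close> rather than a false
  formula.\<close>

definition fBot :: fml where "fBot = Conj (Atom 0) (Neg (Atom 0))"

definition bigC :: "fml list \<Rightarrow> fml" where "bigC fs = foldr Conj fs fTop"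
definition bigD :: "fml list \<Rightarrow> fml" where "bigD fs = foldr Disj fs fBot"

definition monotone_c :: "nat \<Rightarrow> fml" where
  "monotone_c i = Neg (Fut (Conj (Atom i) (Fut (Neg (Atom i)))))"

text \<open>A formula \<open>Tilde (Disj fTop \<psi>)\<close> says that no subteam satisfies \<open>\<psi>\<close>. Thus the \<open>E\<close>-intervals
  of two markers are equal or disjoint, and no \<open>N\<close>-interval reaches into a second block: at the end
  of the first one, a marker of that block would be in its own \<open>N\<close>-interval as well.\<close>

definition aligned_c :: fml where
  "aligned_c = Tilde (Disj fTop (Conj (Fut fE) (Fut (Conj (Tilde fE) (Tilde (Neg fE))))))"

definition next_c :: fml where
  "next_c = Tilde (Disj fTop (Conj (Fut (Conj (Tilde (Neg fN)) (Tilde (Neg fE)))) (Fut fN)))"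

text \<open>The conditions that do not depend on the structure. The sixth makes every marker reach
  its \<open>N\<close>-interval, so that no block is infinite.\<close>

definition fixed_cs :: "fml list" where
  "fixed_cs = [Neg (Conj (Atom 0) (Fut (Neg (Atom 0)))), Neg (Conj (Neg (Atom 0)) (Fut (Atom 0))),
     monotone_c 2, monotone_c 4, monotone_c 6,
     Neg (Conj (Neg (Atom 0)) (Tilde (Fut fN))), aligned_c, next_c]"

definition root_c :: "nat \<Rightarrow> fml" where
  "root_c r = Neg (Conj (Atom 0) (Neg (Atom r)))"

definition cover_c :: "nat \<Rightarrow> fml" where
  "cover_c w = Tilde (Fut (Neg (Conj fE (Atom w))))"

text \<open>The world of a marker is read in its \<open>E\<close>-interval as the target of an edge
  and later in its \<open>N\<close>-interval as the source of the next one. Path traces are exempt,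
  as their world changes.\<close>

definition persist_c :: "nat \<Rightarrow> fml" where
  "persist_c w = Neg (Fut (Conj (Conj (Neg (Atom 0)) (Atom w)) (Fut (Neg (Atom w)))))"

definition excl_c :: "nat \<Rightarrow> nat \<Rightarrow> fml" where
  "excl_c u v = Neg (Fut (Conj (Atom u) (Atom v)))"

text \<open>This yields seriality: by \<open>cover_c\<close> each world has a marker in
  \<open>E\<close> at time 0, and the world of this marker must be the source of an edge.\<close>

definition source_c :: "fml list \<Rightarrow> fml" where
  "source_c fs = Neg (Conj fE (bigC fs))"

text \<open>Only markers with the same \<open>E\<close>-interval can be in \<open>E\<close> together, so the subteam consists of such
  markers and of path traces; it is split according to the edge taken at that block.\<close>

definition step_part :: "nat \<Rightarrow> nat \<Rightarrow> fml" where
  "step_part u v = Conj (Tilde (Atom 0))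
     (Conj (Tilde (Fut (Conj (Tilde (Neg fE)) (Tilde (Disj (Neg (Atom 0)) (Atom u))))))
           (Tilde (Fut (Conj (Tilde (Neg fN)) (Tilde (Disj (Neg (Atom 0)) (Atom v)))))))"

definition step_c :: "fml list \<Rightarrow> fml" where
  "step_c fs = Tilde (Disj fTop (Conj (Tilde (Atom 0)) (Conj (Fut (Disj (Atom 0) fE)) (Tilde (bigD fs)))))"

text \<open>\<open>link_part u v\<close> denies that the edge \<open>(u, v)\<close> fits the markers currently in \<open>N\<close> and \<open>E\<close>.
  \<open>complete_c\<close> says: whenever the markers of a subteam containing all path traces spell out a path
  from the root, some path trace agrees with them.\<close>

definition link_part :: "nat \<Rightarrow> nat \<Rightarrow> fml" where
  "link_part u v = Tilde (Conj (Disj (Neg fN) (Atom u)) (Disj (Neg fE) (Atom v)))"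

definition match_part :: "nat \<Rightarrow> fml" where
  "match_part w = Tilde (Fut (Conj (Tilde (Neg (Conj fE (Atom w)))) (Tilde (Disj (Neg (Atom 0)) (Atom w)))))"

definition complete_c :: "nat \<Rightarrow> fml list \<Rightarrow> fml list \<Rightarrow> fml" where
  "complete_c r fs gs = Tilde (Disj (Neg (Atom 0)) (Conj (Disj (Neg fE) (Atom r)) (Conj (Tilde (Fut (Neg fE)))
     (Conj (Tilde (Fut (Conj (Tilde (Neg fN)) (bigC fs))))
       (Tilde (Disj (Atom 0) (Conj (Tilde (Neg (Atom 0))) (bigC gs))))))))"

definition graph_cs :: "nat \<Rightarrow> (nat \<times> nat) list \<Rightarrow> nat \<Rightarrow> fml list" where
  "graph_cs n es r = fixed_cs @ [root_c (wn r)]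
     @ concat (map (\<lambda>w. [cover_c (wn w), persist_c (wn w)]) [0..<n])
     @ concat (map (\<lambda>u. map (\<lambda>v. excl_c (wn u) (wn v)) [0..<u]) [0..<n])
     @ [source_c (map (\<lambda>(u, v). Neg (Atom (wn u))) es),
        step_c (map (\<lambda>(u, v). step_part (wn u) (wn v)) es),
        complete_c (wn r) (map (\<lambda>(u, v). link_part (wn u) (wn v)) es)
          (map (\<lambda>w. match_part (wn w)) [0..<n])]"

text \<open>A world is listed once per occurrence of \<open>p\<close> in its label list, because the
  machine prints a disjunct whenever it meets the atom while scanning the labels.\<close>

definition matches :: "kripke \<Rightarrow> nat \<Rightarrow> nat list" where
  "matches K p = concat (map (\<lambda>i. map (\<lambda>_. i) (filter (\<lambda>q. q = p) (klab K ! i))) [0..<kn K])"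

text \<open>\<open>Conj (Atom p) fBot\<close> holds of the empty team only and is neutral for
  \<open>Disj\<close>. The atom stands before \<open>fBot\<close> so that its numeral is copied
  where it occurs and everything else is inserted before it or behind it.\<close>

definition atom_f :: "kripke \<Rightarrow> nat \<Rightarrow> fml" where
  "atom_f K p = foldr (\<lambda>i. Disj (Atom (wn i))) (matches K p) (Conj (Atom p) fBot)"

primrec subst_f :: "kripke \<Rightarrow> fml \<Rightarrow> fml" where
  "subst_f K (Atom p) = atom_f K p"
| "subst_f K (Neg \<phi>) = Neg (subst_f K \<phi>)"
| "subst_f K (Conj \<phi> \<psi>) = Conj (subst_f K \<phi>) (subst_f K \<psi>)"
| "subst_f K (Disj \<phi> \<psi>) = Disj (subst_f K \<phi>) (subst_f K \<psi>)"
| "subst_f K (Next \<phi>) = Next (subst_f K \<phi>)"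
| "subst_f K (Fut \<phi>) = Fut (subst_f K \<phi>)"
| "subst_f K (Glob \<phi>) = Glob (subst_f K \<phi>)"
| "subst_f K (Until \<phi> \<psi>) = Until (subst_f K \<phi>) (subst_f K \<psi>)"
| "subst_f K (Rel \<phi> \<psi>) = Rel (subst_f K \<phi>) (subst_f K \<psi>)"
| "subst_f K (Tilde \<phi>) = Tilde (subst_f K \<phi>)"

text \<open>The split in the last conjunct is forced: its halves are the markers and the path
  traces, so \<open>subst_f K \<phi>\<close> speaks of all path traces and nothing else.\<close>

definition red :: "kripke \<Rightarrow> fml \<Rightarrow> fml" where
  "red K \<phi> = foldr Conj (graph_cs (kn K) (kedges K) (kroot K))
     (Disj (Neg (Atom 0)) (Conj (Atom 0) (subst_f K \<phi>)))"

subsection \<open>Team semantics of the building blocks\<close>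

definition Ev :: "nat set \<Rightarrow> bool" where "Ev A \<longleftrightarrow> 0 \<notin> A \<and> 2 \<in> A \<and> 4 \<notin> A"
definition Nv :: "nat set \<Rightarrow> bool" where "Nv A \<longleftrightarrow> 0 \<notin> A \<and> 4 \<in> A \<and> 6 \<notin> A"

text \<open>The usual flatness property, restricted to formulas that inspect the first letter only;
  disjunctions of such formulas can be evaluated trace by trace.\<close>

definition flat :: "fml \<Rightarrow> (nat set \<Rightarrow> bool) \<Rightarrow> bool" where
  "flat \<phi> P \<longleftrightarrow> (\<forall>T. tsat T \<phi> \<longleftrightarrow> (\<forall>t\<in>T. P (t 0)))"

lemma ball_suffix [simp]: "(\<forall>t\<in>team_suffix T k. P t) \<longleftrightarrow> (\<forall>t\<in>T. P (tsuffix t k))"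
  by (auto simp: team_suffix_def)

lemma bex_suffix [simp]: "(\<exists>t\<in>team_suffix T k. P t) \<longleftrightarrow> (\<exists>t\<in>T. P (tsuffix t k))"
  by (auto simp: team_suffix_def)

lemma tsuffix_nth [simp]: "tsuffix t k j = t (k + j)" by (simp add: tsuffix_def)

lemma suffix_singleton [simp]: "team_suffix {t} k = {tsuffix t k}"
  by (simp add: team_suffix_def)

lemma flatD: "flat \<phi> P \<Longrightarrow> tsat T \<phi> \<longleftrightarrow> (\<forall>t\<in>T. P (t 0))" by (simp add: flat_def)

lemma flat_Atom: "flat (Atom p) (\<lambda>A. p \<in> A)" by (simp add: flat_def)

lemma flat_Neg: "flat \<phi> P \<Longrightarrow> flat (Neg \<phi>) (\<lambda>A. \<not> P A)" by (simp add: flat_def)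

lemma flat_Conj: "flat \<phi> P \<Longrightarrow> flat \<psi> Q \<Longrightarrow> flat (Conj \<phi> \<psi>) (\<lambda>A. P A \<and> Q A)"
  by (auto simp: flat_def)

lemma flat_Disj: 
  assumes "flat \<phi> P" "flat \<psi> Q"
  shows "flat (Disj \<phi> \<psi>) (\<lambda>A. P A \<or> Q A)"
  unfolding flat_def
proof (intro allI iffI)
  fix T
  show "\<forall>t\<in>T. P (t 0) \<or> Q (t 0)" if "tsat T (Disj \<phi> \<psi>)"
    using that assms by (auto simp: flat_def)
  assume "\<forall>t\<in>T. P (t 0) \<or> Q (t 0)"
  then have "T = {t\<in>T. P (t 0)} \<union> {t\<in>T. Q (t 0)}" by auto
  moreover have "tsat {t\<in>T. P (t 0)} \<phi>" "tsat {t\<in>T. Q (t 0)} \<psi>" using assms by (auto simp: flat_def)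
  ultimately show "tsat T (Disj \<phi> \<psi>)" unfolding tsat.simps by blast
qed

lemma flat_E: "flat fE Ev" unfolding fE_def Ev_def by (intro flat_Conj flat_Neg flat_Atom)
lemma flat_N: "flat fN Nv" unfolding fN_def Nv_def by (intro flat_Conj flat_Neg flat_Atom)

lemma sat_E [simp]: "tsat T fE \<longleftrightarrow> (\<forall>t\<in>T. Ev (t 0))" by (rule flatD[OF flat_E])
lemma sat_N [simp]: "tsat T fN \<longleftrightarrow> (\<forall>t\<in>T. Nv (t 0))" by (rule flatD[OF flat_N])

lemma sat_imp [simp]:
  "tsat T (Disj (Neg (Atom a)) (Atom b)) \<longleftrightarrow> (\<forall>t\<in>T. a \<in> t 0 \<longrightarrow> b \<in> t 0)"
  "tsat T (Disj (Neg fE) (Atom b)) \<longleftrightarrow> (\<forall>t\<in>T. Ev (t 0) \<longrightarrow> b \<in> t 0)"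
  "tsat T (Disj (Neg fN) (Atom b)) \<longleftrightarrow> (\<forall>t\<in>T. Nv (t 0) \<longrightarrow> b \<in> t 0)"
  "tsat T (Disj (Atom a) fE) \<longleftrightarrow> (\<forall>t\<in>T. a \<in> t 0 \<or> Ev (t 0))"
  using flatD[OF flat_Disj[OF flat_Neg[OF flat_Atom] flat_Atom]]
    flatD[OF flat_Disj[OF flat_Neg[OF flat_E] flat_Atom]]
    flatD[OF flat_Disj[OF flat_Neg[OF flat_N] flat_Atom]]
    flatD[OF flat_Disj[OF flat_Atom flat_E]] by (simp_all only: imp_conv_disj)

lemma sat_Top [simp]: "tsat T fTop" by (simp add: fTop_def) blast
lemma sat_Bot [simp]: "tsat T fBot \<longleftrightarrow> T = {}" by (auto simp: fBot_def)

lemma sat_bigC [simp]: "tsat T (bigC fs) \<longleftrightarrow> (\<forall>f\<in>set fs. tsat T f)"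
  unfolding bigC_def by (induction fs) auto

lemma sat_foldr_Conj: "tsat T (foldr Conj fs g) \<longleftrightarrow> (\<forall>f\<in>set fs. tsat T f) \<and> tsat T g"
  by (induction fs) auto

lemma sat_Disj_Top: "tsat T (Disj fTop \<phi>) \<longleftrightarrow> (\<exists>S\<subseteq>T. tsat S \<phi>)"
  by auto

lemma bigD_elim:
  "tsat T (bigD fs) \<Longrightarrow> t \<in> T \<Longrightarrow> \<exists>f\<in>set fs. \<exists>S\<subseteq>T. t \<in> S \<and> tsat S f"
  unfolding bigD_def
proof (induction fs arbitrary: T)
  case (Cons f fs)
  from Cons.prems obtain S U where T: "T = S \<union> U" "tsat S f" "tsat U (foldr Disj fs fBot)" by auto
  show ?case
  proof (cases "t \<in> S")
    case False
    with T Cons.prems have "t \<in> U" by blast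
    from Cons.IH[OF T(3) this] obtain g S' where "g \<in> set fs" "S' \<subseteq> U" "t \<in> S'" "tsat S' g" by blast
    then show ?thesis using T(1) by (intro bexI[of _ g] exI[of _ S']) auto
  next
    case True
    then show ?thesis using T by (intro bexI[of _ f] exI[of _ S]) auto
  qed
qed auto

lemma bigD_intro:
  "T = (\<Union>e\<in>set es. S e) \<Longrightarrow> (\<And>e. e \<in> set es \<Longrightarrow> tsat (S e) (g e)) \<Longrightarrow> tsat T (bigD (map g es))"
  unfolding bigD_def
proof (induction es arbitrary: T)
  case (Cons e es)
  have "tsat (S e) (g e)" using Cons.prems by simp
  moreover have "tsat (\<Union>e\<in>set es. S e) (foldr Disj (map g es) fBot)" using Cons by simp
  moreover have "T = S e \<union> (\<Union>e\<in>set es. S e)" using Cons.prems by simp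
  ultimately show ?case by (simp, blast)
qed auto

lemma sat_monotone: "tsat T (monotone_c i) \<longleftrightarrow> (\<forall>t\<in>T. \<forall>j j'. j \<le> j' \<longrightarrow> i \<in> t j \<longrightarrow> i \<in> t j')"
  by (auto simp: monotone_c_def) (metis le_add_diff_inverse, metis le_add1)

lemma sat_aligned: "tsat T aligned_c \<longleftrightarrow> 
   (\<forall>S\<subseteq>T. \<forall>i j. (\<forall>t\<in>S. Ev (t i)) \<longrightarrow> (\<forall>t\<in>S. Ev (t j)) \<or> (\<forall>t\<in>S. \<not> Ev (t j)))"
proof -
  have 1: "tsat S (Conj (Fut fE) (Fut (Conj (Tilde fE) (Tilde (Neg fE))))) \<longleftrightarrow>
    (\<exists>i. \<forall>t\<in>S. Ev (t i)) \<and> (\<exists>j. \<not> (\<forall>t\<in>S. Ev (t j)) \<and> \<not> (\<forall>t\<in>S. \<not> Ev (t j)))" for S by simp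
  show ?thesis unfolding aligned_c_def tsat.simps(10)[of T] sat_Disj_Top 1 by meson
qed

lemma sat_next: "tsat T next_c \<longleftrightarrow>
   (\<forall>S\<subseteq>T. \<forall>i j. (\<exists>t\<in>S. Nv (t i)) \<and> (\<exists>t\<in>S. Ev (t i)) \<longrightarrow> (\<exists>t\<in>S. \<not> Nv (t j)))"
proof -
  have 1: "tsat S (Conj (Fut (Conj (Tilde (Neg fN)) (Tilde (Neg fE)))) (Fut fN)) \<longleftrightarrow>
    (\<exists>i. (\<exists>t\<in>S. Nv (t i)) \<and> (\<exists>t\<in>S. Ev (t i))) \<and> (\<exists>j. \<forall>t\<in>S. Nv (t j))" for S by simp
  show ?thesis unfolding next_c_def tsat.simps(10)[of T] sat_Disj_Top 1 by meson
qed

lemma sat_root: "tsat T (root_c r) \<longleftrightarrow> (\<forall>t\<in>T. 0 \<in> t 0 \<longrightarrow> r \<in> t 0)"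
  by (auto simp: root_c_def)

lemma sat_cover: "tsat T (cover_c w) \<longleftrightarrow> (\<forall>j. \<exists>t\<in>T. Ev (t j) \<and> w \<in> t j)"
  by (auto simp: cover_c_def)

lemma sat_persist: "tsat T (persist_c w) \<longleftrightarrow>
   (\<forall>t\<in>T. \<forall>j j'. j \<le> j' \<longrightarrow> 0 \<notin> t j \<longrightarrow> w \<in> t j \<longrightarrow> w \<in> t j')"
  by (auto simp: persist_c_def) (metis le_add_diff_inverse, metis le_add1)

lemma sat_excl: "tsat T (excl_c u v) \<longleftrightarrow> (\<forall>t\<in>T. \<forall>j. \<not> (u \<in> t j \<and> v \<in> t j))"
  by (auto simp: excl_c_def)

lemma sat_source: "tsat T (source_c (map (\<lambda>(u, v). Neg (Atom (wn u))) es)) \<longleftrightarrow>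
   (\<forall>t\<in>T. Ev (t 0) \<longrightarrow> (\<exists>(u, v)\<in>set es. wn u \<in> t 0))"
proof -
  have "tsat S (bigC (map (\<lambda>(u, v). Neg (Atom (wn u))) es)) \<longleftrightarrow> (\<forall>(u, v)\<in>set es. \<forall>t\<in>S. wn u \<notin> t 0)" for S
    unfolding sat_bigC set_map ball_simps by (intro ball_cong refl) (simp add: case_prod_beta)
  then show ?thesis by (simp add: source_c_def case_prod_beta)
qed

lemma sat_step_part: "tsat S (step_part u v) \<longleftrightarrow> (\<exists>t\<in>S. 0 \<notin> t 0)
   \<and> (\<forall>j. (\<exists>t\<in>S. Ev (t j)) \<longrightarrow> (\<forall>t\<in>S. 0 \<in> t j \<longrightarrow> u \<in> t j))
   \<and> (\<forall>j. (\<exists>t\<in>S. Nv (t j)) \<longrightarrow> (\<forall>t\<in>S. 0 \<in> t j \<longrightarrow> v \<in> t j))"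
proof -
  have 1: "tsat S (Tilde (Fut (Conj (Tilde (Neg fE)) (Tilde (Disj (Neg (Atom 0)) (Atom u)))))) \<longleftrightarrow>
      (\<forall>j. (\<exists>t\<in>S. Ev (t j)) \<longrightarrow> (\<forall>t\<in>S. 0 \<in> t j \<longrightarrow> u \<in> t j))"
    unfolding tsat.simps(3,6,10) sat_imp by simp blast
  have 2: "tsat S (Tilde (Fut (Conj (Tilde (Neg fN)) (Tilde (Disj (Neg (Atom 0)) (Atom v)))))) \<longleftrightarrow>
      (\<forall>j. (\<exists>t\<in>S. Nv (t j)) \<longrightarrow> (\<forall>t\<in>S. 0 \<in> t j \<longrightarrow> v \<in> t j))"
    unfolding tsat.simps(3,6,10) sat_imp by simp blast
  show ?thesis unfolding step_part_def tsat.simps(3)[of S] 1 2 by simp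
qed

lemma sat_step: "tsat T (step_c fs) \<longleftrightarrow>
   (\<forall>S\<subseteq>T. \<forall>j. (\<exists>t\<in>S. 0 \<notin> t 0) \<longrightarrow> (\<forall>t\<in>S. 0 \<in> t j \<or> Ev (t j)) \<longrightarrow> tsat S (bigD fs))"
proof -
  have 1: "tsat S (Conj (Tilde (Atom 0)) (Conj (Fut (Disj (Atom 0) fE)) (Tilde (bigD fs)))) \<longleftrightarrow>
    (\<exists>t\<in>S. 0 \<notin> t 0) \<and> (\<exists>j. \<forall>t\<in>S. 0 \<in> t j \<or> Ev (t j)) \<and> \<not> tsat S (bigD fs)" for S
    unfolding tsat.simps(3,6,10) sat_imp by simp
  show ?thesis unfolding step_c_def tsat.simps(10)[of T] sat_Disj_Top 1 by meson
qed

lemma sat_link_part: "tsat S (link_part u v) \<longleftrightarrow>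
   \<not> ((\<forall>t\<in>S. Nv (t 0) \<longrightarrow> u \<in> t 0) \<and> (\<forall>t\<in>S. Ev (t 0) \<longrightarrow> v \<in> t 0))"
  unfolding link_part_def tsat.simps(3,10) sat_imp ..

lemma sat_match_part: "tsat S (match_part w) \<longleftrightarrow>
   (\<forall>j. (\<exists>t\<in>S. Ev (t j) \<and> w \<in> t j) \<longrightarrow> (\<forall>t\<in>S. 0 \<in> t j \<longrightarrow> w \<in> t j))"
  unfolding match_part_def tsat.simps(3,6,10) sat_imp by simp blast

lemma ball_upt: "(\<forall>x\<in>{0..<n}. P x) \<longleftrightarrow> (\<forall>x<n. P x)" for n :: nat by auto

lemma split_dual:
  "(\<not> (\<exists>S U. T = S \<union> U \<and> P S \<and> A U \<and> B U \<and> C U \<and> \<not> D U)) \<longleftrightarrow>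
   (\<forall>U S. T = U \<union> S \<longrightarrow> P U \<longrightarrow> A S \<longrightarrow> B S \<longrightarrow> C S \<longrightarrow> D S)"
  by blast

lemma sat_complete: "tsat T (complete_c r (map (\<lambda>(u, v). link_part (wn u) (wn v)) es) (map (\<lambda>w. match_part (wn w)) [0..<n]))
  \<longleftrightarrow> (\<forall>U S. T = U \<union> S \<longrightarrow> (\<forall>t\<in>U. 0 \<notin> t 0) \<longrightarrow> (\<forall>t\<in>S. Ev (t 0) \<longrightarrow> r \<in> t 0) \<longrightarrow> (\<forall>j. \<exists>t\<in>S. Ev (t j)) \<longrightarrow>
        (\<forall>j. (\<exists>t\<in>S. Nv (t j)) \<longrightarrow>
          (\<exists>(u, v)\<in>set es. (\<forall>t\<in>S. Nv (t j) \<longrightarrow> wn u \<in> t j) \<and> (\<forall>t\<in>S. Ev (t j) \<longrightarrow> wn v \<in> t j))) \<longrightarrow>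
        (\<exists>V S2. S = V \<union> S2 \<and> (\<forall>t\<in>V. 0 \<in> t 0) \<and> (\<exists>t\<in>S2. 0 \<in> t 0) \<and>
          (\<forall>w<n. \<forall>j. (\<exists>t\<in>S2. Ev (t j) \<and> wn w \<in> t j) \<longrightarrow> (\<forall>t\<in>S2. 0 \<in> t j \<longrightarrow> wn w \<in> t j))))"
proof -
  have 1: "tsat S (Tilde (Disj (Atom 0) (Conj (Tilde (Neg (Atom 0))) (bigC (map (\<lambda>w. match_part (wn w)) [0..<n])))))
    \<longleftrightarrow> \<not> (\<exists>V S2. S = V \<union> S2 \<and> (\<forall>t\<in>V. 0 \<in> t 0) \<and> (\<exists>t\<in>S2. 0 \<in> t 0) \<and>
          (\<forall>w<n. \<forall>j. (\<exists>t\<in>S2. Ev (t j) \<and> wn w \<in> t j) \<longrightarrow> (\<forall>t\<in>S2. 0 \<in> t j \<longrightarrow> wn w \<in> t j)))" for S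
  proof -
    have "(\<forall>f\<in>set (map (\<lambda>w. match_part (wn w)) [0..<n]). tsat S f) \<longleftrightarrow>
      (\<forall>w<n. \<forall>j. (\<exists>t\<in>S. Ev (t j) \<and> wn w \<in> t j) \<longrightarrow> (\<forall>t\<in>S. 0 \<in> t j \<longrightarrow> wn w \<in> t j))" for S
      unfolding set_map ball_simps sat_match_part set_upt ball_upt ..
    then show ?thesis unfolding tsat.simps sat_bigC by simp
  qed
  have 2: "tsat S (Tilde (Fut (Conj (Tilde (Neg fN)) (bigC (map (\<lambda>(u, v). link_part (wn u) (wn v)) es)))))
    \<longleftrightarrow> (\<forall>j. (\<exists>t\<in>S. Nv (t j)) \<longrightarrow>
          (\<exists>(u, v)\<in>set es. (\<forall>t\<in>S. Nv (t j) \<longrightarrow> wn u \<in> t j) \<and> (\<forall>t\<in>S. Ev (t j) \<longrightarrow> wn v \<in> t j)))" for S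
  proof -
    have "(\<exists>f\<in>set (map (\<lambda>(u, v). link_part (wn u) (wn v)) es). \<not> tsat S f) \<longleftrightarrow>
      (\<exists>(u, v)\<in>set es. (\<forall>t\<in>S. Nv (t 0) \<longrightarrow> wn u \<in> t 0) \<and> (\<forall>t\<in>S. Ev (t 0) \<longrightarrow> wn v \<in> t 0))" for S
      unfolding set_map bex_simps by (intro bex_cong refl) (simp add: sat_link_part case_prod_beta)
    then show ?thesis unfolding tsat.simps sat_bigC by simp blast
  qed
  have 3: "tsat S (Tilde (Fut (Neg fE))) \<longleftrightarrow> (\<forall>j. \<exists>t\<in>S. Ev (t j))" for S by auto
  have 4: "tsat U (Neg (Atom 0)) \<longleftrightarrow> (\<forall>t\<in>U. 0 \<notin> t 0)" for U by auto
  show ?thesis unfolding complete_c_def tsat.simps(10)[of T] tsat.simps(4)[of T] tsat.simps(3) sat_imp 1 2 3 4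
    by (rule split_dual)
qed


subsection \<open>Teams of paths and markers\<close>

text \<open>The content of \<open>graph_cs\<close> in terms of traces. Only \<open>step\<close>
  still mentions \<open>tsat\<close>: its disjunction is taken apart for a given model and built up
  for the intended one.\<close>

locale marked_team =
  fixes T :: team and n :: nat and es :: "(nat \<times> nat) list" and r :: nat
  assumes kind1: "\<forall>t\<in>T. 0 \<in> t 0 \<longrightarrow> (\<forall>j. 0 \<in> t j)"
    and kind0: "\<forall>t\<in>T. 0 \<notin> t 0 \<longrightarrow> (\<forall>j. 0 \<notin> t j)"
    and mono: "\<forall>i\<in>{2, 4, 6}. \<forall>t\<in>T. \<forall>j j'. j \<le> j' \<longrightarrow> i \<in> t j \<longrightarrow> i \<in> t j'"
    and has_next: "\<forall>t\<in>T. 0 \<notin> t 0 \<longrightarrow> (\<exists>j. Nv (t j))"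
    and aligned: "\<forall>S\<subseteq>T. \<forall>i j. (\<forall>t\<in>S. Ev (t i)) \<longrightarrow> (\<forall>t\<in>S. Ev (t j)) \<or> (\<forall>t\<in>S. \<not> Ev (t j))"
    and next_short: "\<forall>S\<subseteq>T. \<forall>i j. (\<exists>t\<in>S. Nv (t i)) \<and> (\<exists>t\<in>S. Ev (t i)) \<longrightarrow> (\<exists>t\<in>S. \<not> Nv (t j))"
    and root: "\<forall>t\<in>T. 0 \<in> t 0 \<longrightarrow> wn r \<in> t 0"
    and cover: "\<forall>w<n. (\<forall>j. \<exists>t\<in>T. Ev (t j) \<and> wn w \<in> t j) \<and>
       (\<forall>t\<in>T. \<forall>j j'. j \<le> j' \<longrightarrow> 0 \<notin> t j \<longrightarrow> wn w \<in> t j \<longrightarrow> wn w \<in> t j')"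
    and excl: "\<forall>u<n. \<forall>v<u. \<forall>t\<in>T. \<forall>j. \<not> (wn u \<in> t j \<and> wn v \<in> t j)"
    and source: "\<forall>t\<in>T. Ev (t 0) \<longrightarrow> (\<exists>(u, v)\<in>set es. wn u \<in> t 0)"
    and step: "\<forall>S\<subseteq>T. \<forall>j. (\<exists>t\<in>S. 0 \<notin> t 0) \<longrightarrow> (\<forall>t\<in>S. 0 \<in> t j \<or> Ev (t j)) \<longrightarrow>
        tsat S (bigD (map (\<lambda>(u, v). step_part (wn u) (wn v)) es))"
    and complete: "\<forall>U S. T = U \<union> S \<longrightarrow> (\<forall>t\<in>U. 0 \<notin> t 0) \<longrightarrow> (\<forall>t\<in>S. Ev (t 0) \<longrightarrow> wn r \<in> t 0) \<longrightarrow> (\<forall>j. \<exists>t\<in>S. Ev (t j)) \<longrightarrow>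
        (\<forall>j. (\<exists>t\<in>S. Nv (t j)) \<longrightarrow>
          (\<exists>(u, v)\<in>set es. (\<forall>t\<in>S. Nv (t j) \<longrightarrow> wn u \<in> t j) \<and> (\<forall>t\<in>S. Ev (t j) \<longrightarrow> wn v \<in> t j))) \<longrightarrow>
        (\<exists>V S2. S = V \<union> S2 \<and> (\<forall>t\<in>V. 0 \<in> t 0) \<and> (\<exists>t\<in>S2. 0 \<in> t 0) \<and>
          (\<forall>w<n. \<forall>j. (\<exists>t\<in>S2. Ev (t j) \<and> wn w \<in> t j) \<longrightarrow> (\<forall>t\<in>S2. 0 \<in> t j \<longrightarrow> wn w \<in> t j)))"

lemma sat_kind:
  "tsat T (Neg (Conj (Atom 0) (Fut (Neg (Atom 0))))) \<longleftrightarrow> (\<forall>t\<in>T. 0 \<in> t 0 \<longrightarrow> (\<forall>j. 0 \<in> t j))"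
  "tsat T (Neg (Conj (Neg (Atom 0)) (Fut (Atom 0)))) \<longleftrightarrow> (\<forall>t\<in>T. 0 \<notin> t 0 \<longrightarrow> (\<forall>j. 0 \<notin> t j))"
  by (simp, simp add: disj_imp)

lemma sat_has_next:
  "tsat T (Neg (Conj (Neg (Atom 0)) (Tilde (Fut fN)))) \<longleftrightarrow> (\<forall>t\<in>T. 0 \<notin> t 0 \<longrightarrow> (\<exists>j. Nv (t j)))"
  by (simp add: disj_imp)

lemma sat_fixed: "(\<forall>c\<in>set fixed_cs. tsat T c) \<longleftrightarrow>
    (\<forall>t\<in>T. 0 \<in> t 0 \<longrightarrow> (\<forall>j. 0 \<in> t j)) \<and> (\<forall>t\<in>T. 0 \<notin> t 0 \<longrightarrow> (\<forall>j. 0 \<notin> t j)) \<and>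
    (\<forall>i\<in>{2, 4, 6}. tsat T (monotone_c i)) \<and>
    (\<forall>t\<in>T. 0 \<notin> t 0 \<longrightarrow> (\<exists>j. Nv (t j))) \<and> tsat T aligned_c \<and> tsat T next_c"
proof -
  have "(\<forall>x\<in>insert a A. P x) \<longleftrightarrow> P a \<and> (\<forall>x\<in>A. P x)" for a :: 'a and A P by (rule ball_simps)
  moreover have "(\<forall>x\<in>insert a A. P x) \<longleftrightarrow> P a \<and> (\<forall>x\<in>A. P x)" for a :: nat and A P by (rule ball_simps)
  moreover have "(\<forall>x\<in>insert a A. P x) \<longleftrightarrow> P a \<and> (\<forall>x\<in>A. P x)" for a :: fml and A P by (rule ball_simps)
  moreover have "(\<forall>x\<in>{}. P x) \<longleftrightarrow> True" for P :: "nat \<Rightarrow> bool" by simp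
  moreover have "(\<forall>x\<in>{}. P x) \<longleftrightarrow> True" for P :: "fml \<Rightarrow> bool" by simp
  ultimately show ?thesis
    by (simp only: fixed_cs_def list.set sat_kind sat_has_next ball_empty simp_thms conj_assoc)
qed

lemma sat_graph: "(\<forall>c\<in>set (graph_cs n es r). tsat T c) \<longleftrightarrow> marked_team T n es r"
proof -
  have 1: "(\<forall>c\<in>set (concat (map (\<lambda>w. [cover_c (wn w), persist_c (wn w)]) [0..<n])). tsat T c) \<longleftrightarrow>
     (\<forall>w<n. tsat T (cover_c (wn w)) \<and> tsat T (persist_c (wn w)))" by (simp add: ball_upt)
  have 2: "(\<forall>c\<in>set (concat (map (\<lambda>u. map (\<lambda>v. excl_c (wn u) (wn v)) [0..<u]) [0..<n])). tsat T c) \<longleftrightarrow>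
     (\<forall>u<n. \<forall>v<u. tsat T (excl_c (wn u) (wn v)))" by (simp add: ball_upt)
  have 3: "(\<forall>x\<in>{x}. P x) \<longleftrightarrow> P x" "(\<forall>x\<in>{x, y, z}. P x) \<longleftrightarrow> P x \<and> P y \<and> P z" for x y z :: fml and P by simp_all
  show ?thesis
    unfolding graph_cs_def set_append ball_Un 1 2 sat_fixed list.set 3
      sat_root sat_cover sat_persist sat_excl sat_source sat_step sat_complete
      sat_monotone sat_aligned sat_next marked_team_def
    by (simp only: conj_assoc simp_thms)
qed

section \<open>The partition of time into blocks and the paths carried by it\<close>

context marked_team
begin

lemma kind: "\<forall>t\<in>T. \<forall>j. 0 \<in> t j \<longleftrightarrow> 0 \<in> t 0"
  using kind1 kind0 by blast

definition mk :: "nat \<Rightarrow> nat \<Rightarrow> trace" where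
  "mk j w = (SOME t. t \<in> T \<and> Ev (t j) \<and> wn w \<in> t j)"

text \<open>The end of the block that contains \<open>j\<close>. The marker of world 0 serves as a
  sample, since by \<open>aligned\<close> all markers in \<open>E\<close> at \<open>j\<close> have
  the same \<open>E\<close>-interval.\<close>

definition nxt :: "nat \<Rightarrow> nat" where
  "nxt j = (LEAST i. j < i \<and> 4 \<in> mk j 0 i)"

definition blk :: "nat \<Rightarrow> nat" where "blk k = (nxt ^^ k) 0"

lemma mk: assumes "w < n" shows "mk j w \<in> T" "Ev (mk j w j)" "wn w \<in> mk j w j"
proof -
  have "\<exists>t. t \<in> T \<and> Ev (t j) \<and> wn w \<in> t j" using cover assms by blast
  from someI_ex[OF this] show "mk j w \<in> T" "Ev (mk j w j)" "wn w \<in> mk j w j" by (auto simp: mk_def)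
qed

lemma mk_marker: "w < n \<Longrightarrow> 0 \<notin> mk j w i"
  using mk[of w j] kind unfolding Ev_def by metis

lemma monoD: "t \<in> T \<Longrightarrow> i \<in> {2, 4, 6} \<Longrightarrow> j \<le> j' \<Longrightarrow> i \<in> t j \<Longrightarrow> i \<in> t j'"
  using mono by blast

text \<open>\<open>has_next\<close> provides an instant at which the sample carries atom 4; it lies
  after \<open>j\<close>, because the atom is absent at \<open>j\<close> and would have
  persisted.\<close>

lemma nxt0:
  assumes "0 < n"
  shows "j < nxt j \<and> 4 \<in> mk j 0 (nxt j)" "\<And>i. j \<le> i \<Longrightarrow> i < nxt j \<Longrightarrow> 4 \<notin> mk j 0 i"
proof -
  note m = mk[OF assms, of j] mk_marker[OF assms, of j]
  obtain i where i: "Nv (mk j 0 i)" using has_next m by blast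
  have "j < i"
  proof (rule ccontr)
    assume "\<not> j < i"
    then have "4 \<in> mk j 0 j" using monoD[of "mk j 0" 4 i j] m i by (auto simp: Nv_def)
    then show False using m by (auto simp: Ev_def)
  qed
  then have "\<exists>i. j < i \<and> 4 \<in> mk j 0 i" using i by (auto simp: Nv_def)
  from LeastI_ex[OF this] show "j < nxt j \<and> 4 \<in> mk j 0 (nxt j)" unfolding nxt_def .
  fix i assume "j \<le> i" "i < nxt j"
  then show "4 \<notin> mk j 0 i" using not_less_Least[of i "\<lambda>i. j < i \<and> 4 \<in> mk j 0 i"] m
    by (cases "j = i") (auto simp: nxt_def Ev_def)
qed

lemma n_pos: "w < n \<Longrightarrow> 0 < n" by simp

lemma mk_Ev:
  assumes "w < n" "j \<le> i"
  shows "Ev (mk j w i) \<longleftrightarrow> i < nxt j"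
proof -
  note m0 = mk[OF n_pos[OF assms(1)], of j] mk_marker[OF n_pos[OF assms(1)], of j] nxt0[OF n_pos[OF assms(1)], of j]
  note m = mk[OF assms(1), of j]
  have "Ev (mk j w i) \<longleftrightarrow> Ev (mk j 0 i)"
    using aligned[rule_format, of "{mk j w, mk j 0}" j i] m m0 by auto
  also have "\<dots> \<longleftrightarrow> i < nxt j"
  proof (cases "i < nxt j")
    case True
    have "2 \<in> mk j 0 i" using monoD[of "mk j 0" 2 j i] m0 assms by (auto simp: Ev_def)
    then show ?thesis using True m0 assms(2) by (auto simp: Ev_def)
  next
    case False
    then show ?thesis using monoD[of "mk j 0" 4 "nxt j" i] m0 by (auto simp: Ev_def)
  qed
  finally show ?thesis .
qed

lemma mk_4:
  assumes "w < n"
  shows "4 \<in> mk j w i \<longleftrightarrow> nxt j \<le> i"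
proof -
  note m = mk[OF assms, of j] mk_marker[OF assms, of j]
  have j: "j < nxt j" using nxt0 n_pos[OF assms] by blast
  have 2: "2 \<in> mk j w (nxt j)" using monoD[of "mk j w" 2 j "nxt j"] m j by (auto simp: Ev_def)
  have "\<not> Ev (mk j w (nxt j))" using mk_Ev[OF assms, of j "nxt j"] j by simp
  then have 4: "4 \<in> mk j w (nxt j)" using 2 m by (auto simp: Ev_def)
  show ?thesis
  proof (cases "nxt j \<le> i")
    case True
    then show ?thesis using 4 monoD[of "mk j w" 4 "nxt j" i] m by auto
  next
    case False
    \<comment> \<open>\<open>mk_Ev\<close> says nothing about instants before \<open>j\<close>; the
      absence of atom 4 at \<open>max i j\<close> is carried back to \<open>i\<close> by
      monotonicity.\<close>
    have "4 \<notin> mk j w (max i j)" using mk_Ev[OF assms, of j "max i j"] False j by (auto simp: Ev_def)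
    then show ?thesis using False monoD[of "mk j w" 4 i "max i j"] m by auto
  qed
qed

text \<open>At some instant of the \<open>N\<close>-interval atom 6 is absent; this instant is not
  before \<open>nxt j\<close>, so by monotonicity atom 6 is absent at \<open>nxt j\<close>
  too.\<close>

lemma mk_Nv: assumes "w < n" shows "Nv (mk j w (nxt j))"
proof -
  note m = mk[OF assms, of j] mk_marker[OF assms, of j]
  obtain i where i: "Nv (mk j w i)" using has_next m by blast
  then have "nxt j \<le> i" using mk_4[OF assms] by (auto simp: Nv_def)
  then have "6 \<notin> mk j w (nxt j)" using i monoD[of "mk j w" 6 "nxt j" i] m by (auto simp: Nv_def)
  then show ?thesis using m mk_4[OF assms, of j "nxt j"] by (auto simp: Nv_def)
qed

lemma excl_eq: "u < n \<Longrightarrow> v < n \<Longrightarrow> t \<in> T \<Longrightarrow> wn u \<in> t j \<Longrightarrow> wn v \<in> t j \<Longrightarrow> u = v"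
  using excl by (metis linorder_neqE_nat)

text \<open>The subteam consists of the path trace and one marker of the block. Each part of its
  split must contain a marker, so the part with the path trace contains this one, whose
  \<open>E\<close>- and \<open>N\<close>-intervals then fix the times at which source and target are
  tested.\<close>

lemma path_step:
  assumes t: "t \<in> T" "0 \<in> t 0" and n: "0 < n"
  shows "\<exists>(u, v)\<in>set es. (\<forall>i. j \<le> i \<and> i < nxt j \<longrightarrow> wn u \<in> t i) \<and> wn v \<in> t (nxt j)"
proof -
  note m = mk[OF n, of j] mk_marker[OF n, of j]
  have 0: "0 \<in> t i" for i using t kind by blast
  have "tsat {mk j 0, t} (bigD (map (\<lambda>(u, v). step_part (wn u) (wn v)) es))"
    using step[rule_format, of "{mk j 0, t}" j] m t 0 by auto
  from bigD_elim[OF this, of t] obtain u v S where uv: "(u, v) \<in> set es" and S: "S \<subseteq> {mk j 0, t}" "t \<in> S"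
    and sat: "tsat S (step_part (wn u) (wn v))" by auto
  have "mk j 0 \<in> S" using sat S t unfolding sat_step_part by auto
  have E: "(\<exists>t\<in>S. Ev (t i)) \<longrightarrow> (\<forall>t\<in>S. 0 \<in> t i \<longrightarrow> wn u \<in> t i)"
    and N: "(\<exists>t\<in>S. Nv (t i)) \<longrightarrow> (\<forall>t\<in>S. 0 \<in> t i \<longrightarrow> wn v \<in> t i)" for i
    using sat unfolding sat_step_part by simp_all
  have "wn u \<in> t i" if "j \<le> i" "i < nxt j" for i
    using E[of i] \<open>mk j 0 \<in> S\<close> S(2) 0[of i] mk_Ev[OF n that(1)] that(2) by blast
  moreover have "wn v \<in> t (nxt j)"
    using N[of "nxt j"] \<open>mk j 0 \<in> S\<close> S(2) 0[of "nxt j"] mk_Nv[OF n] by blast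
  ultimately show ?thesis using uv by blast
qed

lemma blk_Suc: "blk (Suc k) = nxt (blk k)" by (simp add: blk_def)
lemma blk_0 [simp]: "blk 0 = 0" by (simp add: blk_def)

lemma blk_less: "0 < n \<Longrightarrow> blk k < blk (Suc k)"
  using nxt0(1)[of "blk k"] by (simp add: blk_Suc)

lemma blk_mono:
  assumes "0 < n" "k \<le> l"
  shows "blk k \<le> blk l"
  using assms(2)
proof (induction rule: dec_induct)
  case (step m)
  then show ?case using blk_less[OF assms(1), of m] by linarith
qed simp

text \<open>The edges found for consecutive blocks fit together: at the first instant of the later
  block the trace carries both the target of one and the source of the other, and
  \<open>excl\<close> identifies them.\<close>

lemma trace_path:
  assumes t: "t \<in> T" "0 \<in> t 0" and n: "0 < n" "r < n" "\<forall>(u, v)\<in>set es. u < n \<and> v < n"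
  obtains \<pi> where "\<pi> 0 = r" "\<And>k. (\<pi> k, \<pi> (Suc k)) \<in> set es"
    "\<And>k i. blk k \<le> i \<Longrightarrow> i < blk (Suc k) \<Longrightarrow> wn (\<pi> k) \<in> t i"
proof -
  have "\<forall>k. \<exists>e. e \<in> set es \<and> (\<forall>i. blk k \<le> i \<and> i < blk (Suc k) \<longrightarrow> wn (fst e) \<in> t i) \<and> wn (snd e) \<in> t (blk (Suc k))"
  proof
    fix k
    obtain u v where "(u, v) \<in> set es" "\<forall>i. blk k \<le> i \<and> i < nxt (blk k) \<longrightarrow> wn u \<in> t i" "wn v \<in> t (nxt (blk k))"
      using path_step[OF t n(1), of "blk k"] by blast
    then show "\<exists>e. e \<in> set es \<and> (\<forall>i. blk k \<le> i \<and> i < blk (Suc k) \<longrightarrow> wn (fst e) \<in> t i) \<and> wn (snd e) \<in> t (blk (Suc k))"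
      unfolding blk_Suc by (intro exI[of _ "(u, v)"]) simp
  qed
  then obtain e where e: "\<And>k. e k \<in> set es" "\<And>k i. blk k \<le> i \<Longrightarrow> i < blk (Suc k) \<Longrightarrow> wn (fst (e k)) \<in> t i"
    "\<And>k. wn (snd (e k)) \<in> t (blk (Suc k))" by metis
  have lt: "fst (e k) < n" "snd (e k) < n" for k using e(1)[of k] n(3) by (auto simp: case_prod_beta)
  have "fst (e (Suc k)) = snd (e k)" for k
    using excl_eq[OF lt(1)[of "Suc k"] lt(2)[of k] t(1) _ e(3)[of k]] e(2)[of "Suc k" "blk (Suc k)"] blk_less[OF n(1)] by auto
  then have st: "(fst (e k), fst (e (Suc k))) \<in> set es" for k using e(1)[of k] by simp
  have "fst (e 0) = r"
    using excl_eq[OF lt(1)[of 0] n(2) t(1), of 0] e(2)[of 0 0] root t blk_less[OF n(1), of 0] by auto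
  then show ?thesis using that[of "\<lambda>k. fst (e k)"] st e(2) by blast
qed

lemma blk_find: "0 < n \<Longrightarrow> \<exists>k. blk k \<le> i \<and> i < blk (Suc k)"
proof (induction i)
  case 0
  then show ?case using blk_less[of 0] by (intro exI[of _ 0]) auto
next
  case (Suc i)
  then obtain k where k: "blk k \<le> i" "i < blk (Suc k)" by blast
  show ?case
  proof (cases "Suc i < blk (Suc k)")
    case True
    then show ?thesis using k by (intro exI[of _ k]) auto
  next
    case False
    then have "Suc i = blk (Suc k)" using k by simp
    then show ?thesis using blk_less[OF Suc.prems, of "Suc k"] by (intro exI[of _ "Suc k"]) auto
  qed
qed

text \<open>\<open>complete\<close> is applied to all path traces together with one marker per
  block, that of \<open>\<pi> k\<close> for block \<open>k\<close>. During a block only its own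
  marker is in \<open>E\<close> and only the marker of the preceding block can be in
  \<open>N\<close>, so these markers link along the edges of \<open>\<pi>\<close>.\<close>

lemma path_trace:
  assumes n: "0 < n" and es: "\<forall>(u, v)\<in>set es. u < n \<and> v < n"
    and \<pi>: "\<pi> 0 = r" "\<And>k. (\<pi> k, \<pi> (Suc k)) \<in> set es"
  obtains t where "t \<in> T" "0 \<in> t 0" "\<And>k i. blk k \<le> i \<Longrightarrow> i < blk (Suc k) \<Longrightarrow> wn (\<pi> k) \<in> t i"
proof -
  have lt: "\<pi> k < n" for k using \<pi>(2)[of k] es by auto
  define m where "m k = mk (blk k) (\<pi> k)" for k
  have mT: "m k \<in> T" and mw: "wn (\<pi> k) \<in> m k (blk k)" and m0: "0 \<notin> m k i" for k i
    using mk(1,3)[OF lt] mk_marker[OF lt] by (simp_all add: m_def)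
  have m4: "4 \<in> m k i \<longleftrightarrow> blk (Suc k) \<le> i" for k i using mk_4[OF lt] by (simp add: m_def blk_Suc)
  have mE: "blk k \<le> i \<Longrightarrow> Ev (m k i) \<longleftrightarrow> i < blk (Suc k)" for k i using mk_Ev[OF lt] by (simp add: m_def blk_Suc)
  have mN: "Nv (m k (blk (Suc k)))" for k using mk_Nv[OF lt] by (simp add: m_def blk_Suc)
  have mw': "blk k \<le> i \<Longrightarrow> wn (\<pi> k) \<in> m k i" for k i
    using cover lt[of k] mT[of k] mw[of k] m0[of k "blk k"] by blast
  have onlyE: "l = k" if "Ev (m l i)" "blk k \<le> i" "i < blk (Suc k)" for l k i
  proof (rule ccontr)
    assume "l \<noteq> k"
    then consider "l < k" | "k < l" by linarith
    then show False
    proof cases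
      case 1
      then have "blk (Suc l) \<le> i" using blk_mono[OF n, of "Suc l" k] that by simp
      then show False using that m4 by (auto simp: Ev_def)
    next
      case 2
      \<comment> \<open>Sharing the instant \<open>i\<close> in \<open>E\<close>, both markers would
        have the same \<open>E\<close>-interval; but at \<open>blk l\<close> that of
        \<open>m k\<close> is over while \<open>m l\<close> is in \<open>E\<close>.\<close>
      have "Ev (m k i)" using mE that by blast
      then have "Ev (m l (blk l)) \<longleftrightarrow> Ev (m k (blk l))"
        using aligned[rule_format, of "{m l, m k}" i "blk l"] mT that by auto
      moreover have "Ev (m l (blk l))" using mE[of l "blk l"] blk_less[OF n] by simp
      moreover have "4 \<in> m k (blk l)" using m4 blk_mono[OF n, of "Suc k" l] 2 by simp
      ultimately show False by (auto simp: Ev_def)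
    qed
  qed
  have onlyN: "k = Suc l" if "Nv (m l i)" "blk k \<le> i" "i < blk (Suc k)" for l k i
  proof (rule ccontr)
    assume ne: "k \<noteq> Suc l"
    have "blk (Suc l) \<le> i" using that m4 by (auto simp: Nv_def)
    then have "\<not> k < Suc l" using blk_mono[OF n, of "Suc k" "Suc l"] that by linarith
    then have "Suc (Suc l) \<le> k" using ne by simp
    then have le: "blk (Suc (Suc l)) \<le> i" using blk_mono[OF n] that le_trans by blast
    \<comment> \<open>The \<open>N\<close>-interval of \<open>m l\<close> would last until the end
      of block \<open>Suc l\<close>, where \<open>m (Suc l)\<close> is in \<open>N\<close> as well.
      As \<open>m l\<close> is in \<open>N\<close> and \<open>m (Suc l)\<close> in \<open>E\<close>
      at the start of that block, \<open>next_short\<close> forbids this.\<close>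
    have "6 \<notin> m l (blk (Suc (Suc l)))" using monoD[OF mT[of l], of 6 _ i] le that by (auto simp: Nv_def)
    then have "Nv (m l (blk (Suc (Suc l))))" using m0 m4 blk_less[OF n, of "Suc l"] by (auto simp: Nv_def)
    moreover have "Ev (m (Suc l) (blk (Suc l)))" using mE blk_less[OF n] by simp
    ultimately show False
      using next_short[rule_format, of "{m l, m (Suc l)}" "blk (Suc l)" "blk (Suc (Suc l))"] mN mT by auto
  qed
  define S where "S = {t\<in>T. 0 \<in> t 0} \<union> range m"
  have S_cases: "(\<exists>k. t = m k) \<or> (\<forall>j. 0 \<in> t j)" if "t \<in> S" for t using that kind by (auto simp: S_def)
  have inE: "\<exists>l. t = m l" if "t \<in> S" "Ev (t i)" for t i using S_cases[OF that(1)] that(2) by (auto simp: Ev_def)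
  have inN: "\<exists>l. t = m l" if "t \<in> S" "Nv (t i)" for t i using S_cases[OF that(1)] that(2) by (auto simp: Nv_def)
  have E_at: "wn (\<pi> k) \<in> t i" if "t \<in> S" "Ev (t i)" "blk k \<le> i" "i < blk (Suc k)" for t k i
    using inE[OF that(1,2)] onlyE[OF _ that(3,4)] mw'[OF that(3)] that(2) by blast
  have N_at: "\<exists>l. k = Suc l \<and> wn (\<pi> l) \<in> t i" if h: "t \<in> S" "Nv (t i)" "blk k \<le> i" "i < blk (Suc k)" for t k i
  proof -
    obtain l where l: "t = m l" using inN[OF h(1,2)] by blast
    then have k: "k = Suc l" using onlyN[OF _ h(3,4)] h(2) by blast
    then have "blk l \<le> i" using h(3) blk_mono[OF n, of l k] by simp
    then show ?thesis using k l mw' by blast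
  qed
  have "\<exists>V S2. S = V \<union> S2 \<and> (\<forall>t\<in>V. 0 \<in> t 0) \<and> (\<exists>t\<in>S2. 0 \<in> t 0) \<and>
          (\<forall>w<n. \<forall>j. (\<exists>t\<in>S2. Ev (t j) \<and> wn w \<in> t j) \<longrightarrow> (\<forall>t\<in>S2. 0 \<in> t j \<longrightarrow> wn w \<in> t j))"
  proof (rule complete[rule_format])
    show "T = {t\<in>T. 0 \<notin> t 0} \<union> S" using mT by (auto simp: S_def)
    show "wn r \<in> t 0" if "t \<in> S" "Ev (t 0)" for t using E_at[OF that, of 0] blk_less[OF n, of 0] \<pi> by simp
    show "\<exists>t\<in>S. Ev (t j)" for j
    proof -
      obtain k where "blk k \<le> j" "j < blk (Suc k)" using blk_find n by blast
      then show ?thesis using mE[of k j] by (auto simp: S_def)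
    qed
    show "\<exists>(u, v)\<in>set es. (\<forall>t\<in>S. Nv (t j) \<longrightarrow> wn u \<in> t j) \<and> (\<forall>t\<in>S. Ev (t j) \<longrightarrow> wn v \<in> t j)"
      if ex: "\<exists>t\<in>S. Nv (t j)" for j
    proof -
      obtain k where k: "blk k \<le> j" "j < blk (Suc k)" using blk_find n by blast
      then obtain l where l: "k = Suc l" using ex N_at by blast
      have "\<forall>t\<in>S. Nv (t j) \<longrightarrow> wn (\<pi> l) \<in> t j" using N_at[OF _ _ k] l by blast
      moreover have "\<forall>t\<in>S. Ev (t j) \<longrightarrow> wn (\<pi> (Suc l)) \<in> t j" using E_at[OF _ _ k] l by blast
      ultimately show ?thesis using \<pi>(2)[of l] by blast
    qed
  qed simp
  then obtain V S2 t where V: "S = V \<union> S2" "\<forall>t\<in>V. 0 \<in> t 0" "t \<in> S2" "0 \<in> t 0"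
    and match: "\<And>w j t' t. w < n \<Longrightarrow> t' \<in> S2 \<Longrightarrow> Ev (t' j) \<Longrightarrow> wn w \<in> t' j \<Longrightarrow> t \<in> S2 \<Longrightarrow> 0 \<in> t j \<Longrightarrow> wn w \<in> t j"
    by blast
  have tT: "t \<in> T" using V mT by (auto simp: S_def)
  have "wn (\<pi> k) \<in> t i" if "blk k \<le> i" "i < blk (Suc k)" for k i
  proof (rule match[OF lt, of "m k"])
    have "m k \<in> S" by (simp add: S_def)
    \<comment> \<open>All members of \<open>V\<close> are path traces, hence no marker was lost in
      the split.\<close>
    then show "m k \<in> S2" using V m0[of k 0] by blast
    show "Ev (m k i)" using mE that by simp
    show "wn (\<pi> k) \<in> m k i" using mw' that by simp
    show "t \<in> S2" by fact
    show "0 \<in> t i" using kind tT V by blast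
  qed
  then show ?thesis using that tT V by blast
qed

end

subsection \<open>Stuttering and substitution\<close>

definition lab_holds :: "kripke \<Rightarrow> nat \<Rightarrow> nat set \<Rightarrow> bool" where
  "lab_holds K p A \<longleftrightarrow> (\<exists>i<kn K. p \<in> set (klab K ! i) \<and> wn i \<in> A)"

lemma flat_atom_f: "flat (atom_f K p) (lab_holds K p)"
proof -
  have "flat (foldr (\<lambda>i. Disj (Atom (wn i))) is (Conj (Atom p) fBot)) (\<lambda>A. \<exists>i\<in>set is. wn i \<in> A)" for "is"
  proof (induction "is")
    case (Cons i "is")
    show ?case using flat_Disj[OF flat_Atom Cons] by simp
  qed (simp add: flat_def fBot_def, blast)
  moreover have "(\<lambda>A. \<exists>i\<in>set (matches K p). wn i \<in> A) = lab_holds K p"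
    by (auto simp: matches_def lab_holds_def fun_eq_iff)
  ultimately show ?thesis by (metis atom_f_def)
qed

text \<open>\<open>s\<close> lists the first instants of the blocks. Block \<open>k\<close> of
  \<open>x\<close> is contracted to letter \<open>k\<close> of \<open>y\<close>, the world atoms of
  \<open>x\<close> being decoded into labels.\<close>

definition stut :: "kripke \<Rightarrow> (nat \<Rightarrow> nat) \<Rightarrow> trace \<Rightarrow> trace \<Rightarrow> bool" where
  "stut K s x y \<longleftrightarrow> (\<forall>k i. s k \<le> i \<longrightarrow> i < s (Suc k) \<longrightarrow> (\<forall>p. lab_holds K p (x i) \<longleftrightarrow> p \<in> y k))"

definition bitotal :: "('a \<Rightarrow> 'b \<Rightarrow> bool) \<Rightarrow> 'a set \<Rightarrow> 'b set \<Rightarrow> bool" where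
  "bitotal R X Y \<longleftrightarrow> (\<forall>x\<in>X. \<exists>y\<in>Y. R x y) \<and> (\<forall>y\<in>Y. \<exists>x\<in>X. R x y)"

lemma strict_mono_find:
  fixes s :: "nat \<Rightarrow> nat"
  assumes "strict_mono s" "s 0 = 0"
  shows "\<exists>k. s k \<le> i \<and> i < s (Suc k)"
proof (induction i)
  case 0
  then show ?case using assms strict_monoD[OF assms(1), of 0 1] by (intro exI[of _ 0]) auto
next
  case (Suc i)
  then obtain k where k: "s k \<le> i" "i < s (Suc k)" by blast
  show ?case
  proof (cases "Suc i < s (Suc k)")
    case True
    then show ?thesis using k by (intro exI[of _ k]) auto
  next
    case False
    then show ?thesis using k strict_monoD[OF assms(1), of "Suc k" "Suc (Suc k)"] by (intro exI[of _ "Suc k"]) auto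
  qed
qed

text \<open>A suffix of \<open>x\<close> cutting into block \<open>k\<close> keeps the rest of this
  block as its first block, which is why it still corresponds to the suffix of \<open>y\<close> at
  \<open>k\<close>; the later boundaries are measured from \<open>i\<close>.\<close>

lemma stut_suffix:
  assumes s: "strict_mono s" and i: "s k \<le> i" "i < s (Suc k)" and st: "stut K s x y"
  shows "stut K (\<lambda>l. if l = 0 then 0 else s (k + l) - i) (tsuffix x i) (tsuffix y k)"
  unfolding stut_def
proof (intro allI impI)
  fix l j p
  assume j: "(if l = 0 then 0 else s (k + l) - i) \<le> j" "j < (if Suc l = 0 then 0 else s (k + Suc l) - i)"
  have "s (k + l) \<le> i + j" using j(1) i(1) by (cases "l = 0") auto
  moreover have "i + j < s (Suc (k + l))" using j(2) by simp
  ultimately have "lab_holds K p (x (i + j)) \<longleftrightarrow> p \<in> y (k + l)" using st unfolding stut_def by blast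
  then show "lab_holds K p (tsuffix x i j) \<longleftrightarrow> p \<in> tsuffix y k l" by simp
qed

lemma strict_mono_shift:
  fixes s :: "nat \<Rightarrow> nat"
  assumes s: "strict_mono s" and i: "i < s (Suc k)"
  shows "strict_mono (\<lambda>l. if l = 0 then 0 else s (k + l) - i)"
proof (rule strict_mono_Suc_iff[THEN iffD2], intro allI)
  fix l
  have "s (k + l) < s (Suc (k + l))" "s (Suc k) \<le> s (Suc (k + l))"
    using s by (auto simp: strict_mono_less strict_mono_less_eq)
  then show "(if l = 0 then 0 else s (k + l) - i) < (if Suc l = 0 then 0 else s (k + Suc l) - i)"
    using i by auto
qed

text \<open>The boundaries \<open>s\<close> vary in the induction, because \<open>Fut\<close> may
  cut a block. They are common to all pairs of traces, so a suffix of one team corresponds to a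
  single suffix of the other. For \<open>Disj\<close> each half of a split is carried over to the
  set of its partners.\<close>

lemma sat_subst:
  assumes "onlyF \<phi>" "strict_mono s" "s 0 = 0" "bitotal (stut K s) X Y"
  shows "tsat X (subst_f K \<phi>) \<longleftrightarrow> tsat Y \<phi>"
  using assms
proof (induction \<phi> arbitrary: s X Y)
  case (Atom p)
  have "stut K s x y \<Longrightarrow> lab_holds K p (x 0) \<longleftrightarrow> p \<in> y 0" for x y
    using strict_monoD[OF Atom.prems(2), of 0 "Suc 0"] Atom.prems(3) unfolding stut_def by force
  then show ?case using Atom.prems(4) unfolding bitotal_def subst_f.simps flatD[OF flat_atom_f] tsat.simps by meson
next
  case (Neg \<phi>)
  have "tsat {x} (subst_f K \<phi>) \<longleftrightarrow> tsat {y} \<phi>" if "stut K s x y" for x y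
    by (rule Neg.IH[of s]) (use Neg.prems that in \<open>auto simp: bitotal_def\<close>)
  then show ?case using Neg.prems(4) unfolding bitotal_def subst_f.simps tsat.simps by meson
next
  case (Disj \<phi> \<psi>)
  show ?case
  proof
    assume "tsat X (subst_f K (Disj \<phi> \<psi>))"
    then obtain S U where X: "X = S \<union> U" and sat: "tsat S (subst_f K \<phi>)" "tsat U (subst_f K \<psi>)" by auto
    define S' where "S' = {y\<in>Y. \<exists>x\<in>S. stut K s x y}"
    define U' where "U' = {y\<in>Y. \<exists>x\<in>U. stut K s x y}"
    have b: "bitotal (stut K s) S S'" "bitotal (stut K s) U U'" "Y = S' \<union> U'"
      using Disj.prems(4) X unfolding bitotal_def S'_def U'_def by blast+
    have "tsat S' \<phi>" "tsat U' \<psi>" using Disj.IH(1)[OF _ _ _ b(1)] Disj.IH(2)[OF _ _ _ b(2)] Disj.prems sat by auto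
    then show "tsat Y (Disj \<phi> \<psi>)" using b(3) unfolding tsat.simps by blast
  next
    assume "tsat Y (Disj \<phi> \<psi>)"
    then obtain S U where Y: "Y = S \<union> U" and sat: "tsat S \<phi>" "tsat U \<psi>" by auto
    define S' where "S' = {x\<in>X. \<exists>y\<in>S. stut K s x y}"
    define U' where "U' = {x\<in>X. \<exists>y\<in>U. stut K s x y}"
    have b: "bitotal (stut K s) S' S" "bitotal (stut K s) U' U" "X = S' \<union> U'"
      using Disj.prems(4) Y unfolding bitotal_def S'_def U'_def by blast+
    have "tsat S' (subst_f K \<phi>)" "tsat U' (subst_f K \<psi>)"
      using Disj.IH(1)[OF _ _ _ b(1)] Disj.IH(2)[OF _ _ _ b(2)] Disj.prems sat by auto
    then show "tsat X (subst_f K (Disj \<phi> \<psi>))" using b(3) unfolding tsat.simps subst_f.simps by blast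
  qed
next
  case (Fut \<phi>)
  have *: "tsat (team_suffix X i) (subst_f K \<phi>) \<longleftrightarrow> tsat (team_suffix Y k) \<phi>" if i: "s k \<le> i" "i < s (Suc k)" for i k
  proof (rule Fut.IH)
    show "onlyF \<phi>" using Fut.prems by simp
    show "strict_mono (\<lambda>l. if l = 0 then 0 else s (k + l) - i)" by (rule strict_mono_shift[OF Fut.prems(2) i(2)])
    show "bitotal (stut K (\<lambda>l. if l = 0 then 0 else s (k + l) - i)) (team_suffix X i) (team_suffix Y k)"
      using Fut.prems(4) stut_suffix[OF Fut.prems(2) i] unfolding bitotal_def ball_suffix bex_suffix by blast
  qed simp
  show ?case
  proof
    assume "tsat X (subst_f K (Fut \<phi>))"
    then obtain i where i: "tsat (team_suffix X i) (subst_f K \<phi>)" by auto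
    obtain k where "s k \<le> i" "i < s (Suc k)" using strict_mono_find[OF Fut.prems(2,3)] by blast
    from *[OF this] i show "tsat Y (Fut \<phi>)" by auto
  next
    assume "tsat Y (Fut \<phi>)"
    then obtain k where k: "tsat (team_suffix Y k) \<phi>" by auto
    have "s k < s (Suc k)" using strict_monoD[OF Fut.prems(2)] by simp
    from *[OF order_refl this] k show "tsat X (subst_f K (Fut \<phi>))" by auto
  qed
next
  case (Conj \<phi> \<psi>)
  then show ?case using Conj.IH[of s X Y] by simp
next
  case (Tilde \<phi>)
  then show ?case using Tilde.IH[of s X Y] by simp
qed auto

subsection \<open>The intended model\<close>

text \<open>In the intended model every block is a single instant: the marker is in \<open>E\<close>
  at \<open>i\<close> only and in \<open>N\<close> at \<open>Suc i\<close> only.\<close>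

definition marker :: "nat \<Rightarrow> nat \<Rightarrow> trace" where
  "marker i w = (\<lambda>j. {wn w} \<union> (if j < i then {} else {2}) \<union> (if j \<le> i then {} else {4})
     \<union> (if j \<le> Suc i then {} else {6}))"

definition ptr :: "(nat \<Rightarrow> nat) \<Rightarrow> trace" where "ptr \<pi> = (\<lambda>j. {0, wn (\<pi> j)})"

definition model :: "kripke \<Rightarrow> team" where
  "model K = {marker i w | i w. w < kn K} \<union> {ptr \<pi> | \<pi>. is_path K \<pi>}"

lemma wn_neq [simp]: "wn w \<noteq> 0" "wn w \<noteq> 2" "wn w \<noteq> 4" "wn w \<noteq> 6" "0 \<noteq> wn w" "2 \<noteq> wn w" "4 \<noteq> wn w" "6 \<noteq> wn w"
  by (simp_all add: wn_def, presburger+)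

lemma wn_inj [simp]: "wn u = wn v \<longleftrightarrow> u = v" by (simp add: wn_def)

lemma marker_simps [simp]:
  "0 \<notin> marker i w j" "2 \<in> marker i w j \<longleftrightarrow> i \<le> j" "4 \<in> marker i w j \<longleftrightarrow> i < j" "6 \<in> marker i w j \<longleftrightarrow> Suc i < j"
  "wn u \<in> marker i w j \<longleftrightarrow> u = w" "Ev (marker i w j) \<longleftrightarrow> j = i" "Nv (marker i w j) \<longleftrightarrow> j = Suc i"
  by (auto simp: marker_def Ev_def Nv_def)

lemma ptr_simps [simp]:
  "0 \<in> ptr \<pi> j" "2 \<notin> ptr \<pi> j" "4 \<notin> ptr \<pi> j" "6 \<notin> ptr \<pi> j"
  "wn u \<in> ptr \<pi> j \<longleftrightarrow> u = \<pi> j" "\<not> Ev (ptr \<pi> j)" "\<not> Nv (ptr \<pi> j)"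
  by (auto simp: ptr_def Ev_def Nv_def)

lemma model_cases:
  assumes "t \<in> model K"
  obtains (mark) i w where "t = marker i w" "w < kn K" | (path) \<pi> where "t = ptr \<pi>" "is_path K \<pi>"
  using assms by (auto simp: model_def)

lemma model_Ev: "t \<in> model K \<Longrightarrow> Ev (t j) \<Longrightarrow> \<exists>w<kn K. t = marker j w"
  by (elim model_cases) auto

lemma model_Nv: "t \<in> model K \<Longrightarrow> Nv (t j) \<Longrightarrow> \<exists>w<kn K. \<exists>i. j = Suc i \<and> t = marker i w"
  by (elim model_cases) auto

lemma model_kind: "t \<in> model K \<Longrightarrow> 0 \<in> t j \<Longrightarrow> \<exists>\<pi>. t = ptr \<pi> \<and> is_path K \<pi>"
  by (elim model_cases) auto

lemma model_kind0: "t \<in> model K \<Longrightarrow> 0 \<notin> t j \<Longrightarrow> \<exists>w<kn K. \<exists>i. t = marker i w"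
  by (elim model_cases) auto

lemma model_step:
  assumes S: "S \<subseteq> model K" and ex: "\<exists>t\<in>S. 0 \<notin> t 0" and at: "\<forall>t\<in>S. 0 \<in> t j \<or> Ev (t j)" and ne: "kedges K \<noteq> []"
  shows "tsat S (bigD (map (\<lambda>(u, v). step_part (wn u) (wn v)) (kedges K)))"
proof -
  \<comment> \<open>Each part receives all markers of \<open>S\<close>, which overlapping splits
    allow. Thus even a part without path traces contains a marker, as \<open>step_part\<close>
    demands.\<close>
  define P where "P e = {t\<in>S. 0 \<notin> t 0} \<union> {t\<in>S. 0 \<in> t 0 \<and> wn (fst e) \<in> t j \<and> wn (snd e) \<in> t (Suc j)}" for e :: "nat \<times> nat"
  have mark: "\<exists>w. t = marker j w" if h: "t \<in> S" "0 \<notin> t i" for t i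
  proof -
    obtain w i' where t: "t = marker i' w" using model_kind0[of t K i] h S by blast
    then have "Ev (t j)" using at h(1) by force
    then show ?thesis using t by auto
  qed
  have "S = (\<Union>e\<in>set (kedges K). P e)"
  proof (intro equalityI subsetI)
    fix t assume t: "t \<in> S"
    show "t \<in> (\<Union>e\<in>set (kedges K). P e)"
    proof (cases "0 \<in> t 0")
      case True
      then obtain \<pi> where "t = ptr \<pi>" "is_path K \<pi>" using model_kind t S by blast
      then show ?thesis using t by (intro UN_I[of "(\<pi> j, \<pi> (Suc j))"]) (auto simp: P_def is_path_def)
    next
      case False
      obtain e where "e \<in> set (kedges K)" using ne by (cases "kedges K") auto
      then show ?thesis using t False by (auto simp: P_def)
    qed
  next
    fix t assume "t \<in> (\<Union>e\<in>set (kedges K). P e)"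
    then show "t \<in> S" unfolding P_def by blast
  qed
  moreover have "tsat (P e) (case e of (u, v) \<Rightarrow> step_part (wn u) (wn v))" for e
  proof -
    obtain u v where e: "e = (u, v)" by fastforce
    have E: "i = j" if "t \<in> P e" "Ev (t i)" for t i
      using that mark[of t i] by (auto simp: P_def Ev_def)
    have N: "i = Suc j" if "t \<in> P e" "Nv (t i)" for t i
      using that mark[of t i] by (auto simp: P_def Nv_def)
    have X: "wn u \<in> t j \<and> wn v \<in> t (Suc j)" if "t \<in> P e" "0 \<in> t i" for t i
    proof -
      have "t \<in> model K" using that S by (auto simp: P_def)
      then have "0 \<in> t 0" using model_kind[of t K i] that(2) by auto
      then show ?thesis using that by (auto simp: P_def e)
    qed
    have "\<exists>t\<in>P e. 0 \<notin> t 0" using ex by (auto simp: P_def)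
    then show ?thesis unfolding e prod.case sat_step_part using E N X unfolding e by blast
  qed
  ultimately show ?thesis by (rule bigD_intro)
qed

text \<open>The linking condition leaves one world per instant: all markers of \<open>S\<close> for
  instant \<open>j\<close> are in \<open>N\<close> at \<open>Suc j\<close>, where a single edge must
  fit them. The resulting sequence is a path, its trace belongs to \<open>S\<close> because
  \<open>U\<close> contains markers only, and putting the path traces of \<open>S\<close> into
  \<open>V\<close> leaves this one alone with the markers.\<close>

lemma model_complete:
  assumes T: "model K = U \<union> S" and U: "\<forall>t\<in>U. 0 \<notin> t 0" and r: "\<forall>t\<in>S. Ev (t 0) \<longrightarrow> wn (kroot K) \<in> t 0"
    and cov: "\<forall>j. \<exists>t\<in>S. Ev (t j)"
    and link: "\<forall>j. (\<exists>t\<in>S. Nv (t j)) \<longrightarrow> (\<exists>(u, v)\<in>set (kedges K).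
       (\<forall>t\<in>S. Nv (t j) \<longrightarrow> wn u \<in> t j) \<and> (\<forall>t\<in>S. Ev (t j) \<longrightarrow> wn v \<in> t j))"
  shows "\<exists>V S2. S = V \<union> S2 \<and> (\<forall>t\<in>V. 0 \<in> t 0) \<and> (\<exists>t\<in>S2. 0 \<in> t 0) \<and>
          (\<forall>w<n. \<forall>j. (\<exists>t\<in>S2. Ev (t j) \<and> wn w \<in> t j) \<longrightarrow> (\<forall>t\<in>S2. 0 \<in> t j \<longrightarrow> wn w \<in> t j))"
proof -
  have S: "S \<subseteq> model K" using T by blast
  have "\<forall>j. \<exists>w. marker j w \<in> S"
  proof
    fix j
    obtain t where "t \<in> S" "Ev (t j)" using cov by blast
    then show "\<exists>w. marker j w \<in> S" using model_Ev S by blast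
  qed
  then obtain \<pi> where \<pi>: "\<And>j. marker j (\<pi> j) \<in> S" by metis
  have lk: "\<exists>u v. (u, v) \<in> set (kedges K) \<and> (\<forall>w. marker j w \<in> S \<longrightarrow> w = u) \<and> (\<forall>w. marker (Suc j) w \<in> S \<longrightarrow> w = v)" for j
  proof -
    have "\<exists>t\<in>S. Nv (t (Suc j))" using \<pi>[of j] by force
    then obtain u v where uv: "(u, v) \<in> set (kedges K)" "\<forall>t\<in>S. Nv (t (Suc j)) \<longrightarrow> wn u \<in> t (Suc j)"
      "\<forall>t\<in>S. Ev (t (Suc j)) \<longrightarrow> wn v \<in> t (Suc j)" using link by blast
    have "\<forall>w. marker j w \<in> S \<longrightarrow> w = u" using uv(2) by force
    moreover have "\<forall>w. marker (Suc j) w \<in> S \<longrightarrow> w = v" using uv(3) by force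
    ultimately show ?thesis using uv(1) by blast
  qed
  have uniq: "w = \<pi> j" if "marker j w \<in> S" for j w using lk[of j] that \<pi>[of j] by metis
  have "(\<pi> j, \<pi> (Suc j)) \<in> set (kedges K)" for j using lk[of j] \<pi> by metis
  moreover have "\<pi> 0 = kroot K" using r \<pi>[of 0] by force
  ultimately have "is_path K \<pi>" by (simp add: is_path_def)
  then have "ptr \<pi> \<in> U \<union> S" unfolding T[symmetric] model_def by blast
  then have pS: "ptr \<pi> \<in> S" using U by auto
  have m: "w = \<pi> j" if h: "t \<in> S" "Ev (t j)" "wn w \<in> t j" for t w j
  proof -
    obtain w' where t: "t = marker j w'" using model_Ev[of t K j] h S by blast
    then have "w' = \<pi> j" using uniq h(1) by blast
    then show ?thesis using t h(3) by simp
  qed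
  show ?thesis
  proof (intro exI conjI)
    show "S = {t\<in>S. 0 \<in> t 0} \<union> ({t\<in>S. 0 \<notin> t 0} \<union> {ptr \<pi>})" using pS by blast
    show "\<forall>t\<in>{t\<in>S. 0 \<in> t 0}. 0 \<in> t 0" by blast
    show "\<exists>t\<in>{t\<in>S. 0 \<notin> t 0} \<union> {ptr \<pi>}. 0 \<in> t 0" by simp
    show "\<forall>w<n. \<forall>j. (\<exists>t\<in>{t\<in>S. 0 \<notin> t 0} \<union> {ptr \<pi>}. Ev (t j) \<and> wn w \<in> t j) \<longrightarrow>
        (\<forall>t\<in>{t\<in>S. 0 \<notin> t 0} \<union> {ptr \<pi>}. 0 \<in> t j \<longrightarrow> wn w \<in> t j)"
    proof (intro allI impI ballI)
      fix w j t
      assume "\<exists>t\<in>{t\<in>S. 0 \<notin> t 0} \<union> {ptr \<pi>}. Ev (t j) \<and> wn w \<in> t j"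
      then have w: "w = \<pi> j" using m by auto
      assume t: "t \<in> {t\<in>S. 0 \<notin> t 0} \<union> {ptr \<pi>}" "0 \<in> t j"
      then have "t \<in> model K" using S pS by auto
      then obtain \<pi>' where "t = ptr \<pi>'" using model_kind t(2) by blast
      then have "t = ptr \<pi>" using t(1) by auto
      then show "wn w \<in> t j" using w by simp
    qed
  qed
qed

lemma model_marked:
  assumes wf: "0 < kn K" "kroot K < kn K" and ser: "\<forall>u<kn K. \<exists>v. (u, v) \<in> set (kedges K)"
  shows "marked_team (model K) (kn K) (kedges K) (kroot K)"
proof
  show "\<forall>t\<in>model K. 0 \<in> t 0 \<longrightarrow> (\<forall>j. 0 \<in> t j)" using model_kind by force
  show "\<forall>t\<in>model K. 0 \<notin> t 0 \<longrightarrow> (\<forall>j. 0 \<notin> t j)" using model_kind0 by force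
  show "\<forall>i\<in>{2, 4, 6}. \<forall>t\<in>model K. \<forall>j j'. j \<le> j' \<longrightarrow> i \<in> t j \<longrightarrow> i \<in> t j'"
    by (intro ballI, erule model_cases) auto
  show "\<forall>t\<in>model K. 0 \<notin> t 0 \<longrightarrow> (\<exists>j. Nv (t j))" by (intro ballI, erule model_cases) auto
  show "\<forall>S\<subseteq>model K. \<forall>i j. (\<forall>t\<in>S. Ev (t i)) \<longrightarrow> (\<forall>t\<in>S. Ev (t j)) \<or> (\<forall>t\<in>S. \<not> Ev (t j))"
  proof (intro allI impI)
    fix S i j assume S: "S \<subseteq> model K" "\<forall>t\<in>S. Ev (t i)"
    then have "\<exists>w. t = marker i w" if "t \<in> S" for t using that model_Ev by blast
    then show "(\<forall>t\<in>S. Ev (t j)) \<or> (\<forall>t\<in>S. \<not> Ev (t j))" by (cases "i = j") force+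
  qed
  show "\<forall>S\<subseteq>model K. \<forall>i j. (\<exists>t\<in>S. Nv (t i)) \<and> (\<exists>t\<in>S. Ev (t i)) \<longrightarrow> (\<exists>t\<in>S. \<not> Nv (t j))"
  proof (intro allI impI)
    fix S i j assume S: "S \<subseteq> model K" "(\<exists>t\<in>S. Nv (t i)) \<and> (\<exists>t\<in>S. Ev (t i))"
    then obtain w i' u where "marker i w \<in> S" "i = Suc i'" "marker i' u \<in> S" using model_Ev model_Nv by blast
    then show "\<exists>t\<in>S. \<not> Nv (t j)" by (cases "j = Suc i'") force+
  qed
  show "\<forall>t\<in>model K. 0 \<in> t 0 \<longrightarrow> wn (kroot K) \<in> t 0"
    by (intro ballI, erule model_cases) (auto simp: is_path_def)
  show "\<forall>w<kn K. (\<forall>j. \<exists>t\<in>model K. Ev (t j) \<and> wn w \<in> t j) \<and>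
       (\<forall>t\<in>model K. \<forall>j j'. j \<le> j' \<longrightarrow> 0 \<notin> t j \<longrightarrow> wn w \<in> t j \<longrightarrow> wn w \<in> t j')"
  proof (intro allI impI conjI)
    fix w j assume w: "w < kn K"
    then have "marker j w \<in> model K" by (auto simp: model_def)
    then show "\<exists>t\<in>model K. Ev (t j) \<and> wn w \<in> t j" by (intro bexI[of _ "marker j w"]) simp_all
    show "\<forall>t\<in>model K. \<forall>j j'. j \<le> j' \<longrightarrow> 0 \<notin> t j \<longrightarrow> wn w \<in> t j \<longrightarrow> wn w \<in> t j'"
      by (intro ballI, erule model_cases) auto
  qed
  show "\<forall>u<kn K. \<forall>v<u. \<forall>t\<in>model K. \<forall>j. \<not> (wn u \<in> t j \<and> wn v \<in> t j)"
    by (intro allI impI ballI, erule model_cases) auto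
  show "\<forall>t\<in>model K. Ev (t 0) \<longrightarrow> (\<exists>(u, v)\<in>set (kedges K). wn u \<in> t 0)"
  proof (intro ballI impI)
    fix t assume "t \<in> model K" "Ev (t 0)"
    then obtain w where t: "w < kn K" "t = marker 0 w" using model_Ev by blast
    then obtain v where "(w, v) \<in> set (kedges K)" using ser by blast
    then show "\<exists>(u, v)\<in>set (kedges K). wn u \<in> t 0" using t by (intro bexI[of _ "(w, v)"]) simp_all
  qed
  have "kedges K \<noteq> []" using ser wf by auto
  then show "\<forall>S\<subseteq>model K. \<forall>j. (\<exists>t\<in>S. 0 \<notin> t 0) \<longrightarrow> (\<forall>t\<in>S. 0 \<in> t j \<or> Ev (t j)) \<longrightarrow>
        tsat S (bigD (map (\<lambda>(u, v). step_part (wn u) (wn v)) (kedges K)))"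
    using model_step by blast
qed (intro allI impI, rule model_complete)

definition wf_nonserial :: "kripke \<Rightarrow> bool" where
  "wf_nonserial K \<longleftrightarrow> 0 < kn K \<and> (\<forall>(u, v)\<in>set (kedges K). u < kn K \<and> v < kn K)
     \<and> length (klab K) = kn K \<and> kroot K < kn K"

lemma wf_kripke_iff: "wf_kripke K \<longleftrightarrow> wf_nonserial K \<and> (\<forall>u<kn K. \<exists>v. (u, v) \<in> set (kedges K))"
  by (auto simp: wf_kripke_def wf_nonserial_def)

lemma lab_holds_single:
  assumes "u < kn K" "\<And>v. v < kn K \<Longrightarrow> wn v \<in> A \<longleftrightarrow> v = u"
  shows "lab_holds K p A \<longleftrightarrow> p \<in> set (klab K ! u)"
  using assms by (auto simp: lab_holds_def)

text \<open>Contracting the blocks relates the path traces of \<open>T\<close> to the traces of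
  \<open>K\<close>: \<open>trace_path\<close> gives totality on one side and
  \<open>path_trace\<close> on the other, so \<open>sat_subst\<close> applies.\<close>

lemma red_sound:
  assumes wf: "wf_nonserial K" and F: "onlyF \<phi>" and sat: "tsat T (red K \<phi>)"
  shows "wf_kripke K \<and> tsat (kteam K) \<phi>"
proof -
  have "marked_team T (kn K) (kedges K) (kroot K)" and fin: "tsat T (Disj (Neg (Atom 0)) (Conj (Atom 0) (subst_f K \<phi>)))"
    using sat unfolding red_def sat_foldr_Conj sat_graph by blast+
  then interpret marked_team T "kn K" "kedges K" "kroot K" by blast
  have n: "0 < kn K" and es: "\<forall>(u, v)\<in>set (kedges K). u < kn K \<and> v < kn K" and r: "kroot K < kn K"
    using wf by (auto simp: wf_nonserial_def)
  have ser: "\<exists>v. (u, v) \<in> set (kedges K)" if u: "u < kn K" for u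
  proof -
    \<comment> \<open>The marker of \<open>u\<close> at time 0 carries the source of some edge; as
      it carries only one world, this source is \<open>u\<close>.\<close>
    obtain u' v where e: "(u', v) \<in> set (kedges K)" "wn u' \<in> mk 0 u 0" using source mk[OF u, of 0] by blast
    have "u' < kn K" using e(1) es by auto
    then have "u' = u" using excl_eq[OF _ u mk(1)[OF u] e(2) mk(3)[OF u]] by simp
    then show ?thesis using e(1) by blast
  qed
  define X where "X = {t\<in>T. 0 \<in> t 0}"
  from fin obtain S U where SU: "T = S \<union> U" "\<forall>t\<in>S. 0 \<notin> t 0" "\<forall>t\<in>U. 0 \<in> t 0" "tsat U (subst_f K \<phi>)" by auto
  then have "U = X" by (auto simp: X_def)
  then have sX: "tsat X (subst_f K \<phi>)" using SU by simp
  have key: "stut K blk t (path_trace K \<pi>)" if t: "t \<in> T" and \<pi>: "\<And>k. (\<pi> k, \<pi> (Suc k)) \<in> set (kedges K)"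
    and at: "\<And>k i. blk k \<le> i \<Longrightarrow> i < blk (Suc k) \<Longrightarrow> wn (\<pi> k) \<in> t i" for t \<pi>
    unfolding stut_def path_trace_def
  proof (intro allI impI)
    fix k i p assume i: "blk k \<le> i" "i < blk (Suc k)"
    have lt: "\<pi> k < kn K" using \<pi>[of k] es by auto
    show "lab_holds K p (t i) \<longleftrightarrow> p \<in> set (klab K ! \<pi> k)"
      by (rule lab_holds_single[OF lt]) (use excl_eq[OF _ lt t _ at[OF i]] at[OF i] in blast)
  qed
  have "bitotal (stut K blk) X (kteam K)" unfolding bitotal_def
  proof (intro conjI ballI)
    fix t assume "t \<in> X"
    then have t: "t \<in> T" "0 \<in> t 0" by (auto simp: X_def)
    from trace_path[OF t n r es] obtain \<pi> where \<pi>: "\<pi> 0 = kroot K" "\<And>k. (\<pi> k, \<pi> (Suc k)) \<in> set (kedges K)"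
      "\<And>k i. blk k \<le> i \<Longrightarrow> i < blk (Suc k) \<Longrightarrow> wn (\<pi> k) \<in> t i" by blast
    then have "path_trace K \<pi> \<in> kteam K" by (auto simp: kteam_def is_path_def)
    then show "\<exists>y\<in>kteam K. stut K blk t y" using key[of t \<pi>, OF t(1) \<pi>(2,3)] by blast
  next
    fix y assume "y \<in> kteam K"
    then obtain \<pi> where y: "y = path_trace K \<pi>" and \<pi>: "\<pi> 0 = kroot K" "\<And>k. (\<pi> k, \<pi> (Suc k)) \<in> set (kedges K)"
      by (auto simp: kteam_def is_path_def)
    from path_trace[OF n es \<pi>] obtain t where t: "t \<in> T" "0 \<in> t 0"
      "\<And>k i. blk k \<le> i \<Longrightarrow> i < blk (Suc k) \<Longrightarrow> wn (\<pi> k) \<in> t i" by blast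
    then have "t \<in> X" by (simp add: X_def)
    then show "\<exists>x\<in>X. stut K blk x y" using key[of t \<pi>, OF t(1) \<pi>(2) t(3)] y by blast
  qed
  moreover have "strict_mono blk" using blk_less[OF n] by (simp add: strict_mono_Suc_iff)
  ultimately have "tsat (kteam K) \<phi>" using sat_subst[of \<phi> blk K X "kteam K"] F sX by simp
  then show ?thesis using wf ser by (simp add: wf_kripke_iff)
qed

lemma red_complete:
  assumes wf: "wf_kripke K" and F: "onlyF \<phi>" and sat: "tsat (kteam K) \<phi>"
  shows "tsat (model K) (red K \<phi>)"
proof -
  have lt: "is_path K \<pi> \<Longrightarrow> \<pi> k < kn K" for \<pi> k using wf by (fastforce simp: wf_kripke_def is_path_def)
  define X where "X = {ptr \<pi> | \<pi>. is_path K \<pi>}"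
  have key: "stut K (\<lambda>k. k) (ptr \<pi>) (path_trace K \<pi>)" if "is_path K \<pi>" for \<pi>
    unfolding stut_def path_trace_def
  proof (intro allI impI)
    fix k i p assume "k \<le> i" "i < Suc k"
    then have "i = k" by simp
    then show "lab_holds K p (ptr \<pi> i) \<longleftrightarrow> p \<in> set (klab K ! \<pi> k)" using lab_holds_single[OF lt[OF that]] by simp
  qed
  have "bitotal (stut K (\<lambda>k. k)) X (kteam K)" using key unfolding bitotal_def X_def kteam_def by blast
  then have "tsat X (subst_f K \<phi>)" using sat_subst[OF F, of "\<lambda>k. k"] sat by (simp add: strict_mono_def)
  moreover have "\<forall>t\<in>X. 0 \<in> t 0" by (auto simp: X_def)
  moreover have "model K = {marker i w | i w. w < kn K} \<union> X" by (simp add: model_def X_def)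
  moreover have "\<forall>t\<in>{marker i w | i w. w < kn K}. 0 \<notin> t 0" by auto
  ultimately have "tsat (model K) (Disj (Neg (Atom 0)) (Conj (Atom 0) (subst_f K \<phi>)))" by (simp, blast)
  moreover have "marked_team (model K) (kn K) (kedges K) (kroot K)"
    using wf by (intro model_marked) (auto simp: wf_kripke_def)
  ultimately show ?thesis unfolding red_def sat_foldr_Conj sat_graph by blast
qed

subsection \<open>The fragment\<close>

lemma foldr_Conj_fragment:
  "tdepth (foldr Conj fs g) \<le> k \<longleftrightarrow> (\<forall>f\<in>set fs. tdepth f \<le> k) \<and> tdepth g \<le> k"
  "onlyF (foldr Conj fs g) \<longleftrightarrow> (\<forall>f\<in>set fs. onlyF f) \<and> onlyF g"
  by (induction fs) auto

lemma foldr_Disj_fragment: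
  "tdepth (foldr Disj fs g) \<le> k \<longleftrightarrow> (\<forall>f\<in>set fs. tdepth f \<le> k) \<and> tdepth g \<le> k"
  "onlyF (foldr Disj fs g) \<longleftrightarrow> (\<forall>f\<in>set fs. onlyF f) \<and> onlyF g"
  by (induction fs) auto

lemma bigC_fragment [simp]:
  "tdepth (bigC fs) \<le> k \<longleftrightarrow> (\<forall>f\<in>set fs. tdepth f \<le> k)"
  "onlyF (bigC fs) \<longleftrightarrow> (\<forall>f\<in>set fs. onlyF f)"
  "tdepth (bigD fs) \<le> k \<longleftrightarrow> (\<forall>f\<in>set fs. tdepth f \<le> k)"
  "onlyF (bigD fs) \<longleftrightarrow> (\<forall>f\<in>set fs. onlyF f)"
  by (auto simp: bigC_def bigD_def foldr_Conj_fragment foldr_Disj_fragment fTop_def fBot_def)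

lemma graph_cs_fragment: "\<forall>c\<in>set (graph_cs n es r). tdepth c \<le> 2 \<and> onlyF c"
proof -
  have "tdepth (bigC (map (\<lambda>(u, v). Neg (Atom (wn u))) es)) \<le> 0"
    "tdepth (bigD (map (\<lambda>(u, v). step_part (wn u) (wn v)) es)) \<le> 1"
    "tdepth (bigC (map (\<lambda>(u, v). link_part (wn u) (wn v)) es)) \<le> 0"
    "tdepth (bigC (map (\<lambda>w. match_part (wn w)) [0..<n])) \<le> 1"
    by (auto simp only: bigC_fragment set_map, auto simp: step_part_def link_part_def match_part_def fE_def fN_def)
  then show ?thesis
    by (auto simp: graph_cs_def fixed_cs_def monotone_c_def aligned_c_def next_c_def root_c_def cover_c_def
      persist_c_def excl_c_def source_c_def step_c_def complete_c_def step_part_def link_part_def match_part_def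
      fE_def fN_def fTop_def)
qed

lemma subst_fragment: "tdepth (subst_f K \<phi>) = tdepth \<phi> \<and> onlyF (subst_f K \<phi>) = onlyF \<phi>"
proof (induction \<phi>)
  case (Atom p)
  have "tdepth (foldr (\<lambda>i. Disj (Atom (wn i))) is (Conj (Atom p) fBot)) = 0 \<and>
    onlyF (foldr (\<lambda>i. Disj (Atom (wn i))) is (Conj (Atom p) fBot))" for "is"
    by (induction "is") (auto simp: fBot_def)
  then show ?case by (simp add: atom_f_def)
qed auto

lemma red_fragment: "2 \<le> k \<Longrightarrow> red K \<phi> \<in> LTL_F k \<longleftrightarrow> \<phi> \<in> LTL_F k"
  using graph_cs_fragment[of "kn K" "kedges K" "kroot K"]
  by (fastforce simp: red_def LTL_F_def foldr_Conj_fragment subst_fragment)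

theorem red_correct:
  assumes "2 \<le> k" "wf_nonserial K"
  shows "red K \<phi> \<in> LTL_F k \<and> (\<exists>T. tsat T (red K \<phi>)) \<longleftrightarrow> wf_kripke K \<and> \<phi> \<in> LTL_F k \<and> tsat (kteam K) \<phi>"
proof -
  have "onlyF \<phi>" if "\<phi> \<in> LTL_F k" using that by (simp add: LTL_F_def)
  then show ?thesis using red_fragment[OF assms(1)] red_sound[OF assms(2)] red_complete by blast
qed

section \<open>The transducer\<close>

lemma big_det: "big x B c s ok s' \<Longrightarrow> big x B c s ok2 s2 \<Longrightarrow> ok2 = ok \<and> s2 = s'"
proof (induction arbitrary: ok2 s2 rule: big.induct)
  case (BBasic b s s')
  from BBasic.prems show ?case by cases (use BBasic in auto)
next
  case (BSkip s)
  from BSkip.prems show ?case by cases auto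
next
  case (BRej s)
  from BRej.prems show ?case by cases auto
next
  case (BSeq c1 s s' c2 ok s'')
  from BSeq.prems show ?case by cases (use BSeq.IH in blast)+
next
  case (BSeqR c1 s s' c2)
  from BSeqR.prems show ?case by cases (use BSeqR.IH in blast)+
next
  case (BCondT t s c1 ok s' c2)
  from BCondT.prems show ?case by cases (use BCondT in blast)+
next
  case (BCondF t s c2 ok s' c1)
  from BCondF.prems show ?case by cases (use BCondF in blast)+
next
  case (BLoopF t s c)
  from BLoopF.prems show ?case by cases (use BLoopF in blast)+
next
  case (BLoopT t s c s' ok s'')
  from BLoopT.prems show ?case by cases (use BLoopT in blast)+
next
  case (BLoopR t s c s')
  from BLoopR.prems show ?case by cases (use BLoopR in blast)+
qed

text \<open>Runs are deterministic, so a known run turns \<open>wp\<close> into a rewrite rule.\<close>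

definition wp :: "sym list \<Rightarrow> nat \<Rightarrow> 'r com \<Rightarrow> (bool \<Rightarrow> 'r state \<Rightarrow> bool) \<Rightarrow> 'r state \<Rightarrow> bool" where
  "wp x B c Q s \<longleftrightarrow> (\<exists>ok s'. big x B c s ok s' \<and> Q ok s')"

lemma wp_big: "big x B c s ok s' \<Longrightarrow> wp x B c Q s \<longleftrightarrow> Q ok s'"
  unfolding wp_def using big_det by blast

lemma wp_mono: "wp x B c Q s \<Longrightarrow> (\<And>ok s'. Q ok s' \<Longrightarrow> Q' ok s') \<Longrightarrow> wp x B c Q' s"
  unfolding wp_def by blast

lemma wp_exact: "wp x B c (\<lambda>ok t. ok = ok' \<and> t = s') s \<longleftrightarrow> big x B c s ok' s'"
  unfolding wp_def by blast

lemma wp_eqI: "wp x B c (\<lambda>ok t. ok = ok' \<and> t = s') s \<Longrightarrow> wp x B c Q s \<longleftrightarrow> Q ok' s'"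
  using wp_big unfolding wp_exact by blast

lemma wp_Skip [simp]: "wp x B Skip Q s \<longleftrightarrow> Q True s"
  by (rule wp_big) (rule big.intros)

lemma wp_Rej [simp]: "wp x B Rej Q s \<longleftrightarrow> Q False s"
  by (rule wp_big) (rule big.intros)

lemma wp_Basic [simp]: "basic_ok B b s \<Longrightarrow> wp x B (Basic b) Q s \<longleftrightarrow> Q True (basic_eff x b s)"
  by (rule wp_big) (auto intro: big.intros)

lemma wp_Seq [simp]:
  "wp x B (c1 ;; c2) Q s \<longleftrightarrow> wp x B c1 (\<lambda>ok s'. if ok then wp x B c2 Q s' else Q False s') s"
proof
  assume "wp x B (c1 ;; c2) Q s"
  then obtain ok s' where 1: "big x B (c1 ;; c2) s ok s'" and 2: "Q ok s'" by (auto simp: wp_def)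
  from 1 show "wp x B c1 (\<lambda>ok s'. if ok then wp x B c2 Q s' else Q False s') s"
  proof cases
    case (BSeq s1)
    then have "wp x B c2 Q s1" using 2 unfolding wp_def by blast
    then show ?thesis using BSeq unfolding wp_def[of x B c1] by (intro exI[of _ True] exI[of _ s1]) simp
  next
    case BSeqR
    then show ?thesis using 2 unfolding wp_def[of x B c1] by (intro exI[of _ False] exI[of _ s']) simp
  qed
next
  assume "wp x B c1 (\<lambda>ok s'. if ok then wp x B c2 Q s' else Q False s') s"
  then obtain ok s' where h: "big x B c1 s ok s'" "if ok then wp x B c2 Q s' else Q False s'" unfolding wp_def by blast
  then show "wp x B (c1 ;; c2) Q s"
  proof (cases ok)
    case True
    then obtain ok2 s2 where "big x B c2 s' ok2 s2" "Q ok2 s2" using h unfolding wp_def by auto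
    moreover have "big x B c1 s True s'" using True h by simp
    ultimately show ?thesis unfolding wp_def by (blast intro: BSeq)
  next
    case False
    then have "big x B (c1 ;; c2) s False s'" "Q False s'" using h by (auto intro: BSeqR)
    then show ?thesis unfolding wp_def by blast
  qed
qed

lemma wp_Cond [simp]:
  "wp x B (Cond t c1 c2) Q s \<longleftrightarrow> (if test_holds x t s then wp x B c1 Q s else wp x B c2 Q s)"
proof -
  have "big x B (Cond t c1 c2) s ok s' \<longleftrightarrow> (if test_holds x t s then big x B c1 s ok s' else big x B c2 s ok s')" for ok s'
    by (auto intro: big.intros elim: big.cases)
  then show ?thesis by (simp add: wp_def)
qed

lemma wp_Loop:
  "wp x B (Loop t c) Q s \<longleftrightarrow> (if test_holds x t s
     then wp x B c (\<lambda>ok s'. if ok then wp x B (Loop t c) Q s' else Q False s') s else Q True s)"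
proof (cases "test_holds x t s")
  case True
  have "big x B (Loop t c) s ok s' \<longleftrightarrow> big x B (c ;; Loop t c) s ok s'" for ok s'
  proof
    show "big x B (c ;; Loop t c) s ok s'" if "big x B (Loop t c) s ok s'"
      using that by cases (use True in \<open>auto intro: big.intros\<close>)
    show "big x B (Loop t c) s ok s'" if "big x B (c ;; Loop t c) s ok s'"
      using that by cases (use True in \<open>auto intro: big.intros\<close>)
  qed
  then have "wp x B (Loop t c) Q s \<longleftrightarrow> wp x B (c ;; Loop t c) Q s" by (simp only: wp_def)
  then show ?thesis using True by simp
next
  case False
  then show ?thesis using wp_big[OF BLoopF[of x t s B c]] by simp
qed

section \<open>Register programs and formula templates\<close>

datatype reg = ZERO | LMT | NN | CNT | CT2 | U | V | TMP | EP | LP | PP | RT | PA | PB | QB | EQ | GO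

instance reg :: finite
proof
  have "(UNIV :: reg set) = {ZERO, LMT, NN, CNT, CT2, U, V, TMP, EP, LP, PP, RT, PA, PB, QB, EQ, GO}"
    by (auto intro: reg.exhaust)
  then show "finite (UNIV :: reg set)" by (metis finite.emptyI finite_insert)
qed

abbreviation (input) "inc r \<equiv> Basic (Inc r)"
abbreviation (input) "dec r \<equiv> Basic (Dec r)"
abbreviation (input) "left \<equiv> Basic MovL"
abbreviation (input) "right \<equiv> Basic MovR"
abbreviation (input) "zero r \<equiv> Basic (Cpy r ZERO)"
abbreviation (input) "cpy r s \<equiv> Basic (Cpy r s)"
abbreviation (input) "inside \<equiv> TSym (- {None})"
abbreviation (input) "at_sym a \<equiv> TSym {Some a}"
abbreviation (input) "digit \<equiv> TSym {Some D0, Some D1}"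
abbreviation (input) "pos_reg r \<equiv> TLess ZERO r"

text \<open>The first move is unconditional, because on the right end marker the test
  \<open>inside\<close> fails already.\<close>

definition rewind :: "reg com" where "rewind = left ;; Loop inside left"

definition goto :: "reg \<Rightarrow> reg com" where
  "goto r = rewind ;; cpy TMP r ;; Loop (pos_reg TMP) (right ;; dec TMP)"

text \<open>A program cannot inspect the head position directly; it is measured by counting the
  moves to the left end, and \<open>goto\<close> then brings the head back.\<close>

definition save :: "reg \<Rightarrow> reg com" where
  "save r = zero r ;; left ;; inc r ;; Loop inside (left ;; inc r) ;; goto r"

text \<open>A leading zero shows up as \<open>D0\<close> while the register is 0 and is rejected, so
  only canonical numerals pass. The value is tested against \<open>LMT\<close> before each doubling,
  which keeps the register within \<open>2 * length x + 1\<close>.\<close>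

definition readnum :: "reg \<Rightarrow> reg com" where
  "readnum r = zero r ;;
     Loop digit (Cond (TLess r LMT)
       (Cond (at_sym D0) (Cond (pos_reg r) (Basic (Dbl False r)) Rej) (Basic (Dbl True r))) Rej ;; right) ;;
     Cond (at_sym Hash) right Rej ;; Cond (TLess LMT r) Rej Skip"

text \<open>The value of an atom may exceed every register, so only the shape of its numeral is
  checked.\<close>

definition skipatom :: "reg com" where
  "skipatom = Cond (at_sym D0) Rej Skip ;; Loop digit right ;; Cond (at_sym Hash) right Rej"

fun outs :: "sym list \<Rightarrow> reg com" where
  "outs [] = Skip"
| "outs (s # ss) = Basic (OutS s) ;; outs ss"

definition range_loop :: "reg \<Rightarrow> reg \<Rightarrow> reg com \<Rightarrow> reg com" where
  "range_loop u l body = zero u ;; Loop (TLess u l) (body ;; inc u) ;; zero u"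

definition count_loop :: "reg \<Rightarrow> reg com \<Rightarrow> reg com" where
  "count_loop c body = Loop (pos_reg c) (body ;; dec c)"

text \<open>In a formula template, atom 1 stands for the world in register \<open>U\<close> and atom 3 for the
  world in register \<open>V\<close>.\<close>

fun prt :: "fml \<Rightarrow> reg com" where
  "prt (Atom a) = (if a = 1 then outs [CAtom] ;; Basic (OutBin U) ;; outs [D1, Hash]
     else if a = 3 then outs [CAtom] ;; Basic (OutBin V) ;; outs [D1, Hash]
     else outs (CAtom # enc_nat a))"
| "prt (Neg \<phi>) = outs [CNeg] ;; prt \<phi>"
| "prt (Conj \<phi> \<psi>) = outs [CConj] ;; prt \<phi> ;; prt \<psi>"
| "prt (Disj \<phi> \<psi>) = outs [CDisj] ;; prt \<phi> ;; prt \<psi>"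
| "prt (Next \<phi>) = outs [CX] ;; prt \<phi>"
| "prt (Fut \<phi>) = outs [CF] ;; prt \<phi>"
| "prt (Glob \<phi>) = outs [CG] ;; prt \<phi>"
| "prt (Until \<phi> \<psi>) = outs [CU] ;; prt \<phi> ;; prt \<psi>"
| "prt (Rel \<phi> \<psi>) = outs [CR] ;; prt \<phi> ;; prt \<psi>"
| "prt (Tilde \<phi>) = outs [CTilde] ;; prt \<phi>"

primrec amap :: "(nat \<Rightarrow> nat) \<Rightarrow> fml \<Rightarrow> fml" where
  "amap f (Atom p) = Atom (f p)"
| "amap f (Neg \<phi>) = Neg (amap f \<phi>)"
| "amap f (Conj \<phi> \<psi>) = Conj (amap f \<phi>) (amap f \<psi>)"
| "amap f (Disj \<phi> \<psi>) = Disj (amap f \<phi>) (amap f \<psi>)"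
| "amap f (Next \<phi>) = Next (amap f \<phi>)"
| "amap f (Fut \<phi>) = Fut (amap f \<phi>)"
| "amap f (Glob \<phi>) = Glob (amap f \<phi>)"
| "amap f (Until \<phi> \<psi>) = Until (amap f \<phi>) (amap f \<psi>)"
| "amap f (Rel \<phi> \<psi>) = Rel (amap f \<phi>) (amap f \<psi>)"
| "amap f (Tilde \<phi>) = Tilde (amap f \<phi>)"

definition inst :: "nat \<Rightarrow> nat \<Rightarrow> nat \<Rightarrow> nat" where
  "inst u v a = (if a = 1 then wn u else if a = 3 then wn v else a)"

text \<open>Head positions are described by the part \<open>y\<close> of the input still to be read.
  The empty rest belongs to the right end marker.\<close>

definition pos :: "sym list \<Rightarrow> sym list \<Rightarrow> nat" where
  "pos x y = Suc (length x - length y)"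

lemma suffix_tl: "suffix (s # y) x \<Longrightarrow> suffix y x" by (metis suffix_ConsD)
lemma suffix_app: "suffix (ds @ y) x \<Longrightarrow> suffix y x" by (metis suffix_appendD)

lemma pos_le: "pos x y \<le> Suc (length x)" by (simp add: pos_def)
lemma pos_pos: "0 < pos x y" by (simp add: pos_def)

lemma pos_Cons: "suffix (s # y) x \<Longrightarrow> pos x y = Suc (pos x (s # y))"
  by (auto simp: pos_def suffix_def)

lemma pos_lt: "suffix (s # y) x \<Longrightarrow> pos x (s # y) \<le> length x"
  by (auto simp: pos_def suffix_def)

lemma read_pos: "suffix y x \<Longrightarrow> read_in x (pos x y) = (case y of [] \<Rightarrow> None | s # _ \<Rightarrow> Some s)"
  by (cases y) (auto simp: read_in_def pos_def suffix_def nth_append)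

lemma read_inside: "read_in x h = None \<longleftrightarrow> h = 0 \<or> length x < h"
  by (auto simp: read_in_def)

text \<open>This is the reason for coding worlds as odd atoms: the numeral of \<open>wn w\<close> is
  printed by appending a fixed digit, with no arithmetic, and the even atoms remain free for the
  marks.\<close>

lemma bin_wn: "bin (wn w) = bin w @ [D1]"
  using bin_double[of w True] by (simp add: wn_def)

lemma bin_step: "0 < m \<Longrightarrow> bin m = bin (m div 2) @ [if odd m then D1 else D0]"
  by (subst bin.simps) simp

lemma bin_digits: "set (bin m) \<subseteq> {D0, D1}"
proof (induction m rule: less_induct)
  case (less m)
  then show ?case by (cases "m = 0") (auto simp: bin_step)
qed

lemma bin_hd: "bin m = d # ds \<Longrightarrow> d = D1"
proof (induction m arbitrary: d ds rule: less_induct)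
  case (less m)
  then have "0 < m" by (cases "m = 0") auto
  moreover from this have "m div 2 = 0 \<Longrightarrow> m = 1" by linarith
  ultimately show ?case using less.prems less.IH[of "m div 2"]
    by (cases "bin (m div 2)") (auto simp: bin_step)
qed

lemma wp_outs [simp]: "wp x B (outs ss) Q (\<sigma>, h, out) \<longleftrightarrow> Q True (\<sigma>, h, out @ ss)"
  by (induction ss arbitrary: out) auto

lemma wp_prt [simp]:
  "wp x B (prt \<phi>) Q (\<sigma>, h, out) \<longleftrightarrow> Q True (\<sigma>, h, out @ enc_fml (amap (inst (\<sigma> U) (\<sigma> V)) \<phi>))"
  by (induction \<phi> arbitrary: out Q) (auto simp: inst_def enc_nat_def bin_wn)

section \<open>Behaviour of the subroutines on well-formed codes\<close>

locale input =
  fixes x :: "sym list" and B :: nat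
  assumes B: "B = 2 * length x + 4"
begin

lemma wp_rewind_loop: "h \<le> length x \<Longrightarrow> wp x B (Loop inside left) Q (\<sigma>, h, out) \<longleftrightarrow> Q True (\<sigma>, 0, out)"
proof (induction h)
  case 0
  show ?case by (subst wp_Loop) (simp add: read_inside)
next
  case (Suc h)
  then show ?case by (subst wp_Loop) (simp add: read_inside)
qed

lemma wp_rewind: "h \<le> Suc (length x) \<Longrightarrow> wp x B rewind Q (\<sigma>, h, out) \<longleftrightarrow> Q True (\<sigma>, 0, out)"
  unfolding rewind_def by (simp add: wp_rewind_loop)

lemma wp_forward_loop:
  "\<sigma> ZERO = 0 \<Longrightarrow> n + h \<le> Suc (length x) \<Longrightarrow> wp x B (Loop (pos_reg TMP) (right ;; dec TMP)) Q (\<sigma>(TMP := n), h, out)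
     \<longleftrightarrow> Q True (\<sigma>(TMP := 0), n + h, out)"
proof (induction n arbitrary: h)
  case 0
  then show ?case by (subst wp_Loop) simp
next
  case (Suc n)
  then have "min (Suc (length x)) (Suc h) = Suc h" by simp
  then show ?case using Suc.prems by (subst wp_Loop, simp add: Suc.IH, simp add: fun_upd_def)
qed

lemma wp_goto [simp]:
  assumes "\<sigma> ZERO = 0" "\<sigma> TMP = 0" "r \<noteq> TMP" "\<sigma> r \<le> Suc (length x)" "h \<le> Suc (length x)"
  shows "wp x B (goto r) Q (\<sigma>, h, out) \<longleftrightarrow> Q True (\<sigma>, \<sigma> r, out)"
proof -
  have "\<sigma>(TMP := 0) = \<sigma>" using assms(2) by auto
  then show ?thesis using assms unfolding goto_def by (simp add: wp_rewind wp_forward_loop)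
qed

lemma wp_save_loop:
  "h \<le> length x \<Longrightarrow> k + h \<le> B \<Longrightarrow> wp x B (Loop inside (left ;; inc r)) Q (\<sigma>(r := k), h, out)
    \<longleftrightarrow> Q True (\<sigma>(r := k + h), 0, out)"
proof (induction h arbitrary: k)
  case 0
  show ?case by (subst wp_Loop) (simp add: read_inside)
next
  case (Suc h)
  show ?case using Suc.prems by (subst wp_Loop, simp add: read_inside Suc.IH, simp add: fun_upd_def)
qed

lemma wp_save [simp]:
  assumes "\<sigma> ZERO = 0" "\<sigma> TMP = 0" "r \<noteq> TMP" "r \<noteq> ZERO" "0 < h" "h \<le> Suc (length x)"
  shows "wp x B (save r) Q (\<sigma>, h, out) \<longleftrightarrow> Q True (\<sigma>(r := h), h, out)"
proof -
  have "h - 1 \<le> length x" "Suc 0 + (h - 1) \<le> B" using assms B by auto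
  from wp_save_loop[OF this, where \<sigma> = \<sigma> and r = r] show ?thesis using assms \<open>Suc 0 + (h - 1) \<le> B\<close> unfolding save_def by simp
qed

definition ready :: "(reg \<Rightarrow> nat) \<Rightarrow> bool" where
  "ready \<sigma> \<longleftrightarrow> \<sigma> ZERO = 0 \<and> \<sigma> TMP = 0 \<and> \<sigma> LMT = Suc (length x)"

lemma read_sfx: "suffix y x \<Longrightarrow> (read_in x (pos x y) = Some s) \<longleftrightarrow> (\<exists>z. y = s # z)"
  by (auto simp: read_pos split: list.splits)

lemma right_pos [simp]: "suffix (s # y) x \<Longrightarrow> Suc (min (length x) (pos x (s # y))) = pos x y"
  using pos_lt by (simp add: pos_Cons)

text \<open>\<open>h i\<close> is the head position at the start of round \<open>i\<close>; a body
  may thus consume one entry of a list per round.\<close>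

lemma wp_range_loop:
  assumes "\<sigma> ZERO = 0" "u \<noteq> ZERO" "u \<noteq> l" "\<sigma> l = n" "n \<le> B"
    and body: "\<And>i out Q. i < n \<Longrightarrow> wp x B body Q (\<sigma>(u := i), h i, out) \<longleftrightarrow> Q True (\<sigma>(u := i), h (Suc i), out @ f i)"
  shows "wp x B (range_loop u l body) Q (\<sigma>, h 0, out) \<longleftrightarrow> Q True (\<sigma>(u := 0), h n, out @ concat (map f [0..<n]))"
proof -
  have loop: "wp x B (Loop (TLess u l) (body ;; inc u)) Q (\<sigma>(u := k), h k, out) \<longleftrightarrow>
      Q True (\<sigma>(u := n), h n, out @ concat (map f [k..<n]))" if "k \<le> n" for k out Q
    using that
  proof (induction "n - k" arbitrary: k out)
    case 0
    then show ?case using assms by (subst wp_Loop) simp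
  next
    case (Suc d)
    then have k: "k < n" "d = n - Suc k" "Suc k \<le> n" by auto
    show ?case
      by (subst wp_Loop) (use k assms in \<open>simp add: body Suc.hyps(1)[OF k(2,3)] upt_conv_Cons\<close>)
  qed
  show ?thesis using assms loop[of 0] unfolding range_loop_def by simp
qed

lemma wp_count_loop:
  assumes "\<sigma> ZERO = 0" "c \<noteq> ZERO" and body: "\<And>a y k out Q. a \<in> set xs \<Longrightarrow> suffix (e a @ y) x \<Longrightarrow>
      wp x B body Q (\<sigma>(c := k), pos x (e a @ y), out) \<longleftrightarrow> Q True (\<sigma>(c := k), pos x y, out @ g a)"
    and "suffix (concat (map e xs) @ z) x"
  shows "wp x B (count_loop c body) Q (\<sigma>(c := length xs), pos x (concat (map e xs) @ z), out) \<longleftrightarrow>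
     Q True (\<sigma>(c := 0), pos x z, out @ concat (map g xs))"
  using assms(3,4) unfolding count_loop_def
proof (induction xs arbitrary: out)
  case Nil
  then show ?case using assms by (subst wp_Loop) simp
next
  case (Cons a xs)
  have "suffix (e a @ concat (map e xs) @ z) x" using Cons.prems(2) by simp
  note sf0 = this and sf = suffix_app[OF this]
  have b: "wp x B body Q (\<sigma>(c := k), pos x (e a @ concat (map e xs) @ z), out) \<longleftrightarrow>
     Q True (\<sigma>(c := k), pos x (concat (map e xs) @ z), out @ g a)" for Q k out
    by (rule Cons.prems(1)[OF list.set_intros(1) sf0])
  have IH: "wp x B (Loop (pos_reg c) (body ;; dec c)) Q (\<sigma>(c := length xs), pos x (concat (map e xs) @ z), out) \<longleftrightarrow>
     Q True (\<sigma>(c := 0), pos x z, out @ concat (map g xs))" for out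
    by (rule Cons.IH[OF Cons.prems(1) sf]) auto
  show ?case by (subst wp_Loop) (use assms in \<open>simp add: b IH\<close>)
qed

text \<open>Both sides are runs of the same loop, before and after the numeral. In this form the
  last digit can be split off in the induction, as in the recursion of \<open>bin\<close>.\<close>

lemma wp_read_digits:
  assumes "ready \<sigma>" "r \<notin> {ZERO, LMT, TMP}" "m \<le> Suc (length x)" "suffix (bin m @ y) x"
  shows "wp x B (Loop digit (Cond (TLess r LMT)
       (Cond (at_sym D0) (Cond (pos_reg r) (Basic (Dbl False r)) Rej) (Basic (Dbl True r))) Rej ;; right))
       Q (\<sigma>(r := 0), pos x (bin m @ y), out) \<longleftrightarrow>
    wp x B (Loop digit (Cond (TLess r LMT)
       (Cond (at_sym D0) (Cond (pos_reg r) (Basic (Dbl False r)) Rej) (Basic (Dbl True r))) Rej ;; right))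
       Q (\<sigma>(r := m), pos x y, out)"
    (is "wp x B ?L Q _ \<longleftrightarrow> _")
  using assms(3,4)
proof (induction m arbitrary: y rule: less_induct)
  case (less m)
  show ?case
  proof (cases "m = 0")
    case False
    define b where "b = (if odd m then D1 else D0)"
    have bm: "bin m = bin (m div 2) @ [b]" using False by (simp add: bin_step b_def)
    have sf: "suffix (bin (m div 2) @ b # y) x" using less.prems bm by simp
    then have sb: "suffix (b # y) x" using suffix_app by blast
    have "wp x B ?L Q (\<sigma>(r := 0), pos x (bin m @ y), out) \<longleftrightarrow> wp x B ?L Q (\<sigma>(r := m div 2), pos x (b # y), out)"
      unfolding bm append_assoc append_Cons append_Nil by (rule less.IH) (use sf False less.prems in auto)
    also have "\<dots> \<longleftrightarrow> wp x B ?L Q (\<sigma>(r := m), pos x y, out)"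
    proof -
      have lt: "m div 2 < Suc (length x)" using False less.prems by simp
      have mB: "m \<le> B" using less.prems B by simp
      have r: "ZERO \<noteq> r" "LMT \<noteq> r" using assms(2) by auto
      have H: "\<sigma> ZERO = 0" "\<sigma> LMT = Suc (length x)" using assms(1) by (auto simp: ready_def)
      show ?thesis
      proof (cases "odd m")
        case True
        then have "Suc (2 * (m div 2)) = m" by presburger
        then show ?thesis using lt mB r H sb True by (subst wp_Loop) (simp add: read_pos b_def)
      next
        case even: False
        then have "2 * (m div 2) = m" "0 < m div 2" using False by presburger+
        then show ?thesis using lt mB r H sb even by (subst wp_Loop) (simp add: read_pos b_def)
      qed
    qed
    finally show ?thesis .
  qed simp
qed

lemma wp_readnum [simp]:
  assumes "ready \<sigma>" "r \<notin> {ZERO, LMT, TMP}" "m \<le> Suc (length x)" "suffix (enc_nat m @ y) x"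
  shows "wp x B (readnum r) Q (\<sigma>, pos x (enc_nat m @ y), out) \<longleftrightarrow> Q True (\<sigma>(r := m), pos x y, out)"
proof -
  have sf: "suffix (bin m @ Hash # y) x" using assms(4) by (simp add: enc_nat_def)
  then have "suffix (Hash # y) x" using suffix_app by blast
  then have stop: "wp x B (Loop digit c) Q (\<sigma>(r := m), pos x (Hash # y), out) \<longleftrightarrow> Q True (\<sigma>(r := m), pos x (Hash # y), out)"
    for c Q out by (subst wp_Loop) (simp add: read_pos)
  have r: "ZERO \<noteq> r" "LMT \<noteq> r" and H: "\<sigma> ZERO = 0" "\<sigma> LMT = Suc (length x)"
    using assms(1,2) by (auto simp: ready_def)
  show ?thesis using \<open>suffix (Hash # y) x\<close> r H assms(3)
    unfolding readnum_def enc_nat_def append_assoc append_Cons append_Nil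
    by (simp add: wp_read_digits[OF assms(1-3) sf] stop read_pos)
qed

lemma wp_skip_digits:
  "set ds \<subseteq> {D0, D1} \<Longrightarrow> suffix (ds @ y) x \<Longrightarrow> wp x B (Loop digit right) Q (\<sigma>, pos x (ds @ y), out)
    \<longleftrightarrow> wp x B (Loop digit right) Q (\<sigma>, pos x y, out)"
proof (induction ds)
  case (Cons d ds)
  have "wp x B (Loop digit right) Q (\<sigma>, pos x (d # ds @ y), out) \<longleftrightarrow>
    wp x B (Loop digit right) Q (\<sigma>, pos x (ds @ y), out)"
    by (subst wp_Loop) (use Cons.prems in \<open>auto simp: read_pos\<close>)
  also have "\<dots> \<longleftrightarrow> wp x B (Loop digit right) Q (\<sigma>, pos x y, out)"
    using Cons.IH Cons.prems suffix_tl[of d "ds @ y"] by simp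
  finally show ?case by simp
qed simp

lemma wp_skipatom [simp]:
  assumes "suffix (enc_nat m @ y) x"
  shows "wp x B skipatom Q (\<sigma>, pos x (enc_nat m @ y), out) \<longleftrightarrow> Q True (\<sigma>, pos x y, out)"
proof -
  have sf: "suffix (bin m @ Hash # y) x" using assms by (simp add: enc_nat_def)
  then have sh: "suffix (Hash # y) x" using suffix_app by blast
  have "read_in x (pos x (bin m @ Hash # y)) \<noteq> Some D0"
    using sf bin_hd[of m] by (cases "bin m") (auto simp: read_pos)
  have stop: "wp x B (Loop digit c) Q (\<sigma>, pos x (Hash # y), out) \<longleftrightarrow> Q True (\<sigma>, pos x (Hash # y), out)"
    for c Q out using sh by (subst wp_Loop) (simp add: read_pos)
  from \<open>read_in x _ \<noteq> _\<close> show ?thesis using sh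
    unfolding skipatom_def enc_nat_def append_assoc append_Cons append_Nil
    by (simp add: wp_skip_digits[OF bin_digits sf] stop read_pos)
qed

end

subsection \<open>Decoding\<close>

definition bval :: "sym list \<Rightarrow> nat" where
  "bval = foldl (\<lambda>a s. 2 * a + of_bool (s = D1)) 0"

lemma bval_bin [simp]: "bval (bin m) = m"
proof (induction m rule: less_induct)
  case (less m)
  show ?case
  proof (cases "m = 0")
    case False
    then have "bval (bin m) = 2 * bval (bin (m div 2)) + of_bool (odd m)"
      by (simp add: bin_step bval_def)
    then show ?thesis using less False by simp
  qed (simp add: bval_def)
qed

lemma bin_inj: "bin m = bin n \<longleftrightarrow> m = n"
  by (metis bval_bin)

lemma bval_append: "bval a * 2 ^ length ds \<le> bval (a @ ds)"
  by (induction ds rule: rev_induct) (auto simp: bval_def algebra_simps)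

text \<open>Each further digit at least doubles the value. Hence a numeral whose proper prefix has
  reached the limit exceeds it, which justifies early rejection.\<close>

lemma bin_extend:
  assumes "bin a @ ds = bin m" "ds \<noteq> []"
  shows "2 * a \<le> m"
proof -
  obtain d ds' where ds: "ds = d # ds'" using assms(2) by (cases ds) auto
  have "a * 2 \<le> a * 2 ^ length ds" by (simp add: ds)
  also have "\<dots> \<le> m" using bval_append[of "bin a" ds] assms(1) by simp
  finally show ?thesis by simp
qed

text \<open>Unique readability in front of an arbitrary rest. The predicate restricts the class of
  objects: concatenated entries, for instance, are decodable only among lists of a known
  length.\<close>

definition prefix_free :: "('a \<Rightarrow> sym list) \<Rightarrow> ('a \<Rightarrow> bool) \<Rightarrow> bool" where
  "prefix_free e P \<longleftrightarrow> (\<forall>a b y z. P a \<longrightarrow> P b \<longrightarrow> e a @ y = e b @ z \<longrightarrow> a = b \<and> y = z)"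

lemma prefix_freeD:
  "prefix_free e P \<Longrightarrow> e a @ y = e b @ z \<Longrightarrow> P a \<Longrightarrow> P b \<Longrightarrow> a = b \<and> y = z"
  unfolding prefix_free_def by blast

lemma Hash_split:
  "Hash \<notin> set ds \<Longrightarrow> Hash \<notin> set ds' \<Longrightarrow> ds @ Hash # y = ds' @ Hash # z \<longleftrightarrow> ds = ds' \<and> y = z"
proof (induction ds arbitrary: ds')
  case Nil
  then show ?case by (cases ds') auto
next
  case (Cons d ds)
  then show ?case by (cases ds') auto
qed

lemma Hash_notin_bin: "Hash \<notin> set (bin m)" using bin_digits by fastforce

lemma enc_nat_inj [simp]: "enc_nat a @ y = enc_nat b @ z \<longleftrightarrow> a = b \<and> y = z"
  by (simp add: enc_nat_def Hash_split Hash_notin_bin bin_inj)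

lemma pf_nat: "prefix_free enc_nat P" by (simp add: prefix_free_def)

abbreviation enc_edge :: "nat \<times> nat \<Rightarrow> sym list" where
  "enc_edge \<equiv> \<lambda>(u, v). enc_nat u @ enc_nat v"

lemma pf_edge: "prefix_free enc_edge P"
  by (auto simp: prefix_free_def)

lemma pf_concat:
  assumes "prefix_free e P"
  shows "prefix_free (\<lambda>xs. concat (map e xs)) (\<lambda>xs. length xs = n \<and> (\<forall>a\<in>set xs. P a))"
  unfolding prefix_free_def
proof (intro allI impI)
  fix xs ys y z
  assume "length xs = n \<and> (\<forall>a\<in>set xs. P a)" "length ys = n \<and> (\<forall>a\<in>set ys. P a)"
    "concat (map e xs) @ y = concat (map e ys) @ z"
  then show "xs = ys \<and> y = z"
  proof (induction xs arbitrary: ys n)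
    case (Cons a xs)
    then obtain b ys' where ys: "ys = b # ys'" by (cases ys) auto
    have "a = b \<and> concat (map e xs) @ y = concat (map e ys') @ z"
      using prefix_freeD[OF assms, of a "concat (map e xs) @ y" b "concat (map e ys') @ z"] Cons.prems by (simp add: ys)
    then show ?case using Cons.IH[of "length xs" ys'] Cons.prems ys by auto
  qed auto
qed

lemma pf_list:
  assumes "prefix_free e P"
  shows "prefix_free (enc_list e) (\<lambda>xs. Q xs \<and> (\<forall>a\<in>set xs. P a))"
  unfolding prefix_free_def
proof (intro allI impI)
  fix xs ys y z
  assume "Q xs \<and> (\<forall>a\<in>set xs. P a)" "Q ys \<and> (\<forall>a\<in>set ys. P a)" "enc_list e xs @ y = enc_list e ys @ z"
  then have "length xs = length ys" "concat (map e xs) @ y = concat (map e ys) @ z"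
    "\<forall>a\<in>set xs. P a" "\<forall>a\<in>set ys. P a" by (auto simp: enc_list_def)
  then show "xs = ys \<and> y = z" using prefix_freeD[OF pf_concat[OF assms, of "length xs"]] by simp
qed

lemma digits_bin: "set ds \<subseteq> {D0, D1} \<Longrightarrow> (\<And>d ds'. ds = d # ds' \<Longrightarrow> d = D1) \<Longrightarrow> \<exists>q. ds = bin q"
proof (induction ds rule: rev_induct)
  case (snoc d ds)
  show ?case
  proof (cases "ds = []")
    case True
    then have "d # [] = bin 1" using snoc.prems by (simp add: bin_step)
    then show ?thesis using True by auto
  next
    case False
    then obtain q where q: "ds = bin q" using snoc by (cases ds) auto
    then have "0 < q" using False by (cases q) auto
    then have "bin (2 * q + of_bool (d = D1)) = ds @ [d]"
      using bin_double[of q "d = D1"] snoc.prems(1) q by auto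
    then show ?thesis by metis
  qed
qed (use bin_0 in metis)

subsection \<open>Checking the input\<close>

context input
begin

text \<open>On input \<open>y\<close> the program succeeds iff \<open>y\<close> starts with the code of some object satisfying
  \<open>P\<close>; it then stops behind this code.\<close>

definition Tot :: "('a \<Rightarrow> sym list) \<Rightarrow> ('a \<Rightarrow> bool) \<Rightarrow> ('a \<Rightarrow> sym list \<Rightarrow> reg \<Rightarrow> nat) \<Rightarrow> sym list \<Rightarrow> sym list
    \<Rightarrow> bool \<Rightarrow> reg state \<Rightarrow> bool" where
  "Tot e P sf y out ok s' \<longleftrightarrow> snd (snd s') = out \<and>
     (if ok then \<exists>a z. y = e a @ z \<and> P a \<and> s' = (sf a z, pos x z, out) else \<not> (\<exists>a z. y = e a @ z \<and> P a))"

lemma TotI: "y = e a @ z \<Longrightarrow> P a \<Longrightarrow> s' = (sf a z, pos x z, out) \<Longrightarrow> Tot e P sf y out True s'"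
  by (auto simp: Tot_def)

text \<open>A failing test after a successful read settles the matter: by prefix-freeness no other
  object can be coded at the start of \<open>y\<close>.\<close>

lemma Tot_filter:
  assumes c1: "wp x B c1 (Tot e P sf y out) s" and pf: "prefix_free e P" and y: "suffix y x"
    and c2: "\<And>a z Q. P a \<Longrightarrow> y = e a @ z \<Longrightarrow> suffix z x \<Longrightarrow> wp x B c2 Q (sf a z, pos x z, out) \<longleftrightarrow>
       (if P' a then Q True (sf' a z, pos x z, out) else Q False (sf'' a z, pos x z, out))"
  shows "wp x B (c1 ;; c2) (Tot e (\<lambda>a. P a \<and> P' a) sf' y out) s"
  unfolding wp_Seq
proof (rule wp_mono[OF c1])
  fix ok s' assume t: "Tot e P sf y out ok s'"
  show "if ok then wp x B c2 (Tot e (\<lambda>a. P a \<and> P' a) sf' y out) s' else Tot e (\<lambda>a. P a \<and> P' a) sf' y out False s'"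
  proof (cases ok)
    case True
    then obtain a z where a: "y = e a @ z" "P a" "s' = (sf a z, pos x z, out)" using t by (auto simp: Tot_def)
    then have sz: "suffix z x" using y suffix_app by blast
    have "Tot e (\<lambda>a. P a \<and> P' a) sf' y out False (sf'' a z, pos x z, out)" if "\<not> P' a"
      using prefix_freeD[OF pf] a that by (auto simp: Tot_def)
    moreover have "Tot e (\<lambda>a. P a \<and> P' a) sf' y out True (sf' a z, pos x z, out)" if "P' a"
      using a that by (intro TotI) auto
    ultimately show ?thesis using True a(3) c2[OF a(2,1) sz] by simp
  next
    case False
    then show ?thesis using t by (auto simp: Tot_def)
  qed
qed

text \<open>The first object is determined by \<open>y\<close>, so failure of the second reader
  excludes every pair. What is read second may depend on the first object, as a list depends on its
  length.\<close>

lemma Tot_seq: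
  assumes c1: "wp x B c1 (Tot e1 P1 sf1 y out) s" and pf: "prefix_free e1 P1" and y: "suffix y x"
    and c2: "\<And>a z. P1 a \<Longrightarrow> y = e1 a @ z \<Longrightarrow> suffix z x \<Longrightarrow> wp x B c2 (Tot (e2 a) (P2 a) (sf2 a z) z out) (sf1 a z, pos x z, out)"
  shows "wp x B (c1 ;; c2) (Tot (\<lambda>(a, b). e1 a @ e2 a b) (\<lambda>(a, b). P1 a \<and> P2 a b)
     (\<lambda>(a, b) z. sf2 a (e2 a b @ z) b z) y out) s"
  unfolding wp_Seq
proof (rule wp_mono[OF c1])
  let ?T = "Tot (\<lambda>(a, b). e1 a @ e2 a b) (\<lambda>(a, b). P1 a \<and> P2 a b) (\<lambda>(a, b) z. sf2 a (e2 a b @ z) b z) y out"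
  fix ok s' assume t: "Tot e1 P1 sf1 y out ok s'"
  show "if ok then wp x B c2 ?T s' else ?T False s'"
  proof (cases ok)
    case True
    then obtain a z where a: "y = e1 a @ z" "P1 a" "s' = (sf1 a z, pos x z, out)" using t by (auto simp: Tot_def)
    then have sz: "suffix z x" using y suffix_app by blast
    have "wp x B c2 ?T (sf1 a z, pos x z, out)"
    proof (rule wp_mono[OF c2[OF a(2,1) sz]])
      fix ok2 s2 assume t2: "Tot (e2 a) (P2 a) (sf2 a z) z out ok2 s2"
      show "?T ok2 s2"
      proof (cases ok2)
        case True
        then obtain b z2 where "z = e2 a b @ z2" "P2 a b" "s2 = (sf2 a z b z2, pos x z2, out)"
          using t2 by (auto simp: Tot_def)
        then show ?thesis using True a unfolding Tot_def by (auto intro!: exI[of _ a] exI[of _ b] exI[of _ z2])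
      next
        case False
        have "\<not> (\<exists>b z2. z = e2 a b @ z2 \<and> P2 a b)" "snd (snd s2) = out" using t2 False by (auto simp: Tot_def)
        moreover have "a' = a \<and> e2 a' b @ z' = z" if "y = e1 a' @ e2 a' b @ z'" "P1 a'" for a' b z'
          using prefix_freeD[OF pf, of a z a' "e2 a' b @ z'"] a that by simp
        ultimately show ?thesis using False unfolding Tot_def by (auto, blast)
      qed
    qed
    then show ?thesis using True a(3) by simp
  next
    case False
    then show ?thesis using t by (auto simp: Tot_def)
  qed
qed

lemma Tot_mono:
  assumes "wp x B c (Tot e P sf y out) s"
    and "\<And>a z. y = e a @ z \<Longrightarrow> P a \<Longrightarrow> \<exists>b. y = e' b @ z \<and> P' b \<and> sf a z = sf' b z"
    and "\<And>b z. y = e' b @ z \<Longrightarrow> P' b \<Longrightarrow> \<exists>a z. y = e a @ z \<and> P a"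
  shows "wp x B c (Tot e' P' sf' y out) s"
proof (rule wp_mono[OF assms(1)])
  fix ok s' assume t: "Tot e P sf y out ok s'"
  show "Tot e' P' sf' y out ok s'"
  proof (cases ok)
    case True
    then obtain a z where a: "y = e a @ z" "P a" "s' = (sf a z, pos x z, out)" using t by (auto simp: Tot_def)
    obtain b where "y = e' b @ z" "P' b" "sf a z = sf' b z" using assms(2)[OF a(1,2)] by blast
    then show ?thesis using True a(3) by (auto intro: TotI)
  next
    case False
    have "\<not> (\<exists>b z. y = e' b @ z \<and> P' b)" using assms(3) t False unfolding Tot_def by (simp, blast)
    then show ?thesis using t False by (simp add: Tot_def)
  qed
qed

lemma Tot_count:
  assumes "\<sigma> ZERO = 0" "c \<noteq> ZERO" and pf: "prefix_free e P"
    and body: "\<And>y k. suffix y x \<Longrightarrow> wp x B body (Tot e P (\<lambda>a z. \<sigma>(c := k)) y out) (\<sigma>(c := k), pos x y, out)"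
  shows "suffix y x \<Longrightarrow> wp x B (count_loop c body)
     (Tot (\<lambda>xs. concat (map e xs)) (\<lambda>xs. length xs = n \<and> (\<forall>a\<in>set xs. P a)) (\<lambda>a z. \<sigma>(c := 0)) y out)
     (\<sigma>(c := n), pos x y, out)"
proof (induction n arbitrary: y)
  case 0
  then show ?case using assms(1,2) unfolding count_loop_def
    by (subst wp_Loop) (simp, rule TotI[of _ _ "[]"], auto)
next
  case (Suc n)
  let ?T = "\<lambda>n. Tot (\<lambda>xs. concat (map e xs)) (\<lambda>xs. length xs = n \<and> (\<forall>a\<in>set xs. P a)) (\<lambda>a z. \<sigma>(c := 0))"
  have IH: "wp x B (count_loop c body) (?T n z out) (\<sigma>(c := n), pos x z, out)" if "suffix z x" for z
    by (rule Suc.IH[OF that])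
  have "wp x B (body ;; dec c) (Tot e (\<lambda>a. P a \<and> True) (\<lambda>a z. \<sigma>(c := n)) y out) (\<sigma>(c := Suc n), pos x y, out)"
    by (rule Tot_filter[OF body[OF Suc.prems] pf Suc.prems]) simp
  then have "wp x B ((body ;; dec c) ;; count_loop c body) (Tot (\<lambda>(a, xs). e a @ concat (map e xs))
     (\<lambda>(a, xs). (P a \<and> True) \<and> (length xs = n \<and> (\<forall>a\<in>set xs. P a))) (\<lambda>(a, xs) z. \<sigma>(c := 0)) y out) (\<sigma>(c := Suc n), pos x y, out)"
  proof (rule Tot_seq, goal_cases)
    case 1
    show ?case using pf by simp
  next
    case 2
    show ?case by (rule Suc.prems)
  next
    case (3 a z)
    show ?case by (rule IH[OF 3(3)])
  qed
  then have "wp x B ((body ;; dec c) ;; count_loop c body) (?T (Suc n) y out) (\<sigma>(c := Suc n), pos x y, out)"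
  proof (rule Tot_mono, goal_cases)
    case (1 a z)
    then show ?case by (cases a) (auto intro!: exI[of _ "fst a # snd a"])
  next
    case (2 xs z)
    then show ?case by (cases xs) auto
  qed
  then show ?case using assms(1,2) unfolding count_loop_def by (subst wp_Loop) simp
qed

text \<open>The loop is entered with \<open>a\<close> already read, so that the induction can follow
  the input. Rejection is sound for two reasons: no numeral starts with \<open>D0\<close>, and a
  value at the limit at least doubles with the next digit. A successful run stops at the first
  non-digit; whether this is \<open>Hash\<close> is tested later.\<close>

lemma Tot_readloop:
  fixes \<sigma> :: "reg \<Rightarrow> nat" and out :: "sym list"
  assumes H: "ready \<sigma>" "r \<notin> {ZERO, LMT, TMP}"
  defines "R \<equiv> \<lambda>y a ok (s' :: reg state). snd (snd s') = out \<and>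
     (if ok then \<exists>ds m z. y = ds @ z \<and> bin a @ ds = bin m \<and> s' = (\<sigma>(r := m), pos x z, out)
      else \<forall>ds m z. y = ds @ Hash # z \<longrightarrow> bin a @ ds = bin m \<longrightarrow> Suc (length x) < m)"
  shows "suffix y x \<Longrightarrow> wp x B (Loop digit (Cond (TLess r LMT)
       (Cond (at_sym D0) (Cond (pos_reg r) (Basic (Dbl False r)) Rej) (Basic (Dbl True r))) Rej ;; right))
       (R y a) (\<sigma>(r := a), pos x y, out)"
    (is "_ \<Longrightarrow> wp x B ?L _ _")
proof (induction y arbitrary: a)
  case Nil
  then show ?case by (subst wp_Loop) (simp add: read_pos R_def, blast)
next
  case (Cons s y)
  have IH: "wp x B ?L (R y a) (\<sigma>(r := a), pos x y, out)" for a
    by (rule Cons.IH[OF suffix_tl[OF Cons.prems]])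
  have r: "ZERO \<noteq> r" "LMT \<noteq> r" and \<sigma>: "\<sigma> ZERO = 0" "\<sigma> LMT = Suc (length x)" using H by (auto simp: ready_def)
  have step: "wp x B ?L (R (s # y) a) (\<sigma>(r := 2 * a + of_bool b), pos x y, out)"
    if "s = (if b then D1 else D0)" "0 < a \<or> b" for b
  proof (rule wp_mono[OF IH])
    fix ok s' assume t: "R y (2 * a + of_bool b) ok s'"
    have bin: "bin (2 * a + of_bool b) = bin a @ [s]" using bin_double[OF that(2)] that(1) by simp
    have s: "s \<noteq> Hash" using that by simp
    show "R (s # y) a ok s'"
    proof (cases ok)
      case True
      then obtain ds m z where "y = ds @ z" "bin a @ s # ds = bin m" "s' = (\<sigma>(r := m), pos x z, out)"
        using t bin by (auto simp: R_def)
      then show ?thesis using True unfolding R_def by (auto intro!: exI[of _ "s # ds"])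
    next
      case False
      have "Suc (length x) < m" if h: "s # y = ds @ Hash # z" "bin a @ ds = bin m" for ds m z
      proof -
        obtain ds' where ds': "ds = s # ds'" "y = ds' @ Hash # z" using h(1) s by (cases ds) auto
        have "bin (2 * a + of_bool b) @ ds' = bin m" using bin ds'(1) h(2) by simp
        moreover have "\<forall>ds m z. y = ds @ Hash # z \<longrightarrow> bin (2 * a + of_bool b) @ ds = bin m \<longrightarrow> Suc (length x) < m"
          using t False unfolding R_def by presburger
        ultimately show ?thesis using ds'(2) by blast
      qed
      then show ?thesis using t False by (simp add: R_def)
    qed
  qed
  have big: "R (s # y) a False (\<sigma>(r := a), pos x (s # y), out)" if "s \<noteq> Hash" "Suc (length x) \<le> a"
  proof -
    have "Suc (length x) < m" if "s # y = ds @ Hash # z" "bin a @ ds = bin m" for ds m z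
    proof -
      have "ds \<noteq> []" using that(1) \<open>s \<noteq> Hash\<close> by auto
      then show ?thesis using bin_extend[OF that(2)] \<open>Suc (length x) \<le> a\<close> by simp
    qed
    then show ?thesis by (simp add: R_def)
  qed
  have lead: "R (D0 # y) 0 False (\<sigma>(r := 0), pos x (D0 # y), out)"
  proof -
    have False if "D0 # y = ds @ Hash # z" "ds = bin m" for ds m z
      using that bin_hd[of m] by (cases "bin m") auto
    then show ?thesis by (auto simp: R_def)
  qed
  consider "s = D0" | "s = D1" | "s \<notin> {D0, D1}" by blast
  then show ?case
  proof cases
    case 1
    show ?thesis
      by (subst wp_Loop)
        (use Cons.prems r \<sigma> B 1 step[of False] big lead in \<open>auto simp: read_pos\<close>)
  next
    case 2
    show ?thesis
      by (subst wp_Loop) (use Cons.prems r \<sigma> B 2 step[of True] big in \<open>auto simp: read_pos\<close>)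
  next
    case 3
    have "R (s # y) a True (\<sigma>(r := a), pos x (s # y), out)"
      unfolding R_def by (simp, rule exI[of _ "[]"], rule exI[of _ a], rule exI[of _ "s # y"], simp)
    then show ?thesis using Cons.prems 3
      by (subst wp_Loop) (auto simp: read_pos)
  qed
qed

lemma Tot_readnum:
  assumes H: "ready \<sigma>" "r \<notin> {ZERO, LMT, TMP}" and y: "suffix y x"
  shows "wp x B (readnum r) (Tot enc_nat (\<lambda>m. m \<le> Suc (length x)) (\<lambda>m z. \<sigma>(r := m)) y out) (\<sigma>, pos x y, out)"
proof (cases "\<exists>m z. y = enc_nat m @ z \<and> m \<le> Suc (length x)")
  case True
  then obtain m z where "y = enc_nat m @ z" "m \<le> Suc (length x)" by blast
  then show ?thesis using wp_readnum[OF H, of m z] y by (auto intro!: TotI)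
next
  case False
  have r: "ZERO \<noteq> r" "LMT \<noteq> r" and \<sigma>: "\<sigma> ZERO = 0" "\<sigma> LMT = Suc (length x)" using H by (auto simp: ready_def)
  have "wp x B (Cond (at_sym Hash) right Rej ;; Cond (TLess LMT r) Rej Skip)
     (Tot enc_nat (\<lambda>m. m \<le> Suc (length x)) (\<lambda>m z. \<sigma>(r := m)) y out) (\<sigma>(r := m), pos x z, out)"
    if "y = ds @ z" "bin 0 @ ds = bin m" for ds m z
  proof -
    have "suffix z x" using y that suffix_app by blast
    moreover have "Suc (length x) < m" if "z = Hash # z'" for z'
      using False \<open>y = ds @ z\<close> \<open>bin 0 @ ds = bin m\<close> that by (auto simp: enc_nat_def not_le)
    ultimately show ?thesis using r \<sigma> False by (cases z) (auto simp: read_pos Tot_def)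
  qed
  note rest = this
  let ?T = "Tot enc_nat (\<lambda>m. m \<le> Suc (length x)) (\<lambda>m z. \<sigma>(r := m)) y out"
  have "wp x B (Loop digit (Cond (TLess r LMT)
       (Cond (at_sym D0) (Cond (pos_reg r) (Basic (Dbl False r)) Rej) (Basic (Dbl True r))) Rej ;; right))
     (\<lambda>ok s'. if ok then wp x B (Cond (at_sym Hash) right Rej ;; Cond (TLess LMT r) Rej Skip) ?T s' else ?T False s')
     (\<sigma>(r := 0), pos x y, out)"
  proof (rule wp_mono[OF Tot_readloop[OF H y]], goal_cases)
    case (1 ok s')
    show ?case
    proof (cases ok)
      case True
      then obtain ds m z where yz: "y = ds @ z" "bin 0 @ ds = bin m" "s' = (\<sigma>(r := m), pos x z, out)" using 1 by auto
      show ?thesis using True rest[OF yz(1,2)] unfolding yz(3) by (simp only: if_True)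
    next
      case ok: False
      then show ?thesis using 1 False by (simp add: Tot_def)
    qed
  qed
  then show ?thesis using \<sigma> unfolding readnum_def by simp
qed

lemma Tot_skipatom:
  assumes y: "suffix y x"
  shows "wp x B skipatom (Tot enc_nat (\<lambda>m. True) (\<lambda>m z. \<sigma>) y out) (\<sigma>, pos x y, out)"
proof (cases "\<exists>m z. y = enc_nat m @ z")
  case True
  then obtain m z where "y = enc_nat m @ z" by blast
  then show ?thesis using wp_skipatom[of m z] y by (auto intro!: TotI)
next
  case False
  define ds where "ds = takeWhile (\<lambda>s. s \<in> {D0, D1}) y"
  define z where "z = dropWhile (\<lambda>s. s \<in> {D0, D1}) y"
  have yz: "y = ds @ z" by (simp add: ds_def z_def)
  have ds: "set ds \<subseteq> {D0, D1}" unfolding ds_def using set_takeWhileD by fastforce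
  have z: "z = [] \<or> hd z \<notin> {D0, D1}" unfolding z_def using hd_dropWhile by blast
  have sz: "suffix z x" using y yz suffix_app by blast
  have stop: "wp x B (Loop digit right) Q (\<sigma>, pos x z, out) \<longleftrightarrow> Q True (\<sigma>, pos x z, out)" for Q
    using sz z by (subst wp_Loop) (cases z, auto simp: read_pos)
  have loop: "wp x B (Loop digit right) Q (\<sigma>, pos x y, out) \<longleftrightarrow> Q True (\<sigma>, pos x z, out)" for Q
  proof -
    have "suffix (ds @ z) x" using y yz by simp
    from wp_skip_digits[OF ds this, of Q \<sigma> out] show ?thesis unfolding yz stop .
  qed
  have fail: "Tot enc_nat (\<lambda>m. True) (\<lambda>m z. \<sigma>) y out False (\<sigma>, h, out)" for h using False by (auto simp: Tot_def)
  have "read_in x (pos x z) \<noteq> Some Hash" if "read_in x (pos x y) \<noteq> Some D0"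
  proof
    assume "read_in x (pos x z) = Some Hash"
    then obtain z' where z': "z = Hash # z'" using sz read_sfx by auto
    \<comment> \<open>With its first symbol different from \<open>D0\<close>, the digit string is
      canonical; a \<open>Hash\<close> behind it would complete a code, which was excluded.\<close>
    have "d = D1" if "ds = d # ds'" for d ds' using ds that \<open>read_in x (pos x y) \<noteq> Some D0\<close> y yz by (auto simp: read_pos)
    then obtain q where "ds = bin q" using digits_bin[OF ds] by metis
    then show False using False yz z' by (auto simp: enc_nat_def)
  qed
  then show ?thesis using fail loop unfolding skipatom_def by simp
qed

end

subsection \<open>Substitution on the level of strings\<close>

text \<open>Comparison of two numerals in place, up to the first \<open>Hash\<close>. It is defined
  on arbitrary words, since an atom symbol in the unparsed part of the input need not be followed by
  a numeral.\<close>

fun cmp :: "sym list \<Rightarrow> sym list \<Rightarrow> bool" where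
  "cmp (s # a) (t # b) \<longleftrightarrow> s = t \<and> (s = Hash \<or> s \<in> {D0, D1} \<and> cmp a b)"
| "cmp _ _ \<longleftrightarrow> False"

definition pre :: "kripke \<Rightarrow> sym list \<Rightarrow> sym list" where
  "pre K y = concat (map (\<lambda>i. concat (map (\<lambda>q. if cmp y (enc_nat q) then CDisj # enc_fml (Atom (wn i)) else [])
     (klab K ! i))) [0..<kn K])"

text \<open>Suited to a single pass: the world disjuncts are emitted at \<open>CAtom\<close>, the
  digits are copied, and \<open>fBot\<close> is emitted at \<open>Hash\<close>, which in the code of
  a formula occurs only at the end of a numeral.\<close>

fun sub_str :: "kripke \<Rightarrow> sym list \<Rightarrow> sym list" where
  "sub_str K [] = []"
| "sub_str K (s # y) = (if s = CAtom then pre K y @ [CConj, CAtom]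
     else if s = Hash then Hash # enc_fml fBot else [s]) @ sub_str K y"

definition red_prefix :: "kripke \<Rightarrow> sym list" where
  "red_prefix K = concat (map (\<lambda>c. CConj # enc_fml c) (graph_cs (kn K) (kedges K) (kroot K)))
     @ CDisj # enc_fml (Neg (Atom 0)) @ CConj # enc_fml (Atom 0)"

definition red_str :: "sym list \<Rightarrow> sym list" where
  "red_str x = (if \<exists>K z. wf_nonserial K \<and> x = enc_kripke K @ z
     then THE w. \<exists>K z. wf_nonserial K \<and> x = enc_kripke K @ z \<and> w = red_prefix K @ sub_str K z else [])"

section \<open>Unique readability of the output and correctness on words\<close>

lemma cmp_cut: "cmp y (ds @ Hash # z) = cmp y (ds @ [Hash])"
proof (induction ds arbitrary: y)
  case Nil
  show ?case by (cases y) auto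
next
  case (Cons d ds)
  then show ?case by (cases y) simp_all
qed

lemma cmp_enc_cut: "cmp y (enc_nat q @ z) = cmp y (enc_nat q)"
  using cmp_cut[of y "bin q" z] by (simp add: enc_nat_def)

lemma cmp_digits: "set ds \<subseteq> {D0, D1} \<Longrightarrow> set ds' \<subseteq> {D0, D1} \<Longrightarrow> cmp (ds @ Hash # z) (ds' @ [Hash]) \<longleftrightarrow> ds = ds'"
proof (induction ds arbitrary: ds')
  case Nil
  then show ?case by (cases ds') auto
next
  case (Cons d ds)
  then show ?case by (cases ds') auto
qed

lemma cmp_enc: "cmp (enc_nat p @ z) (enc_nat q) \<longleftrightarrow> p = q"
  using cmp_digits[OF bin_digits bin_digits] by (simp add: enc_nat_def bin_inj)

lemma enc_foldr_Disj:
  "enc_fml (foldr (\<lambda>i. Disj (Atom (wn i))) ws g) = concat (map (\<lambda>i. CDisj # enc_fml (Atom (wn i))) ws) @ enc_fml g"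
  by (induction "ws") auto

lemma pre_eq: "\<exists>ws. pre K y = concat (map (\<lambda>i. CDisj # enc_fml (Atom (wn i))) ws)"
proof -
  have 1: "\<exists>ws. concat (map (\<lambda>q. if P q then CDisj # enc_fml (Atom (wn i)) else []) qs)
      = concat (map (\<lambda>i. CDisj # enc_fml (Atom (wn i))) ws)" for P :: "nat \<Rightarrow> bool" and i qs
  proof (induction qs)
    case Nil
    show ?case by (rule exI[of _ "[]"]) simp
  next
    case (Cons q qs)
    then obtain "ws" where ws: "concat (map (\<lambda>q. if P q then CDisj # enc_fml (Atom (wn i)) else []) qs)
      = concat (map (\<lambda>i. CDisj # enc_fml (Atom (wn i))) ws)" by blast
    show ?case by (rule exI[of _ "(if P q then [i] else []) @ ws"]) (simp add: ws)
  qed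
  have "\<exists>ws. concat (map (\<lambda>i. concat (map (\<lambda>q. if cmp y (enc_nat q) then CDisj # enc_fml (Atom (wn i)) else [])
     (klab K ! i))) ns) = concat (map (\<lambda>i. CDisj # enc_fml (Atom (wn i))) ws)" for ns
  proof (induction ns)
    case Nil
    show ?case by (rule exI[of _ "[]"]) simp
  next
    case (Cons n ns)
    then obtain is1 where is1: "concat (map (\<lambda>i. concat (map (\<lambda>q. if cmp y (enc_nat q) then CDisj # enc_fml (Atom (wn i)) else [])
     (klab K ! i))) ns) = concat (map (\<lambda>i. CDisj # enc_fml (Atom (wn i))) is1)" by blast
    obtain is2 where is2: "concat (map (\<lambda>q. if cmp y (enc_nat q) then CDisj # enc_fml (Atom (wn n)) else []) (klab K ! n))
      = concat (map (\<lambda>i. CDisj # enc_fml (Atom (wn i))) is2)" using 1[of "\<lambda>q. cmp y (enc_nat q)" n] by blast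
    show ?case by (rule exI[of _ "is2 @ is1"]) (simp add: is1 is2)
  qed
  then show ?thesis by (simp add: pre_def)
qed

lemma concat_map_concat: "concat (map f (concat xss)) = concat (map (\<lambda>xs. concat (map f xs)) xss)"
  by (induction xss) auto

lemma pre_matches: "pre K (enc_nat p @ z) = concat (map (\<lambda>i. CDisj # enc_fml (Atom (wn i))) (matches K p))"
proof -
  have 1: "concat (map (\<lambda>q. if p = q then CDisj # enc_fml (Atom (wn i)) else []) qs)
      = concat (map (\<lambda>i. CDisj # enc_fml (Atom (wn i))) (map (\<lambda>_. i) (filter (\<lambda>q. q = p) qs)))" for i qs
    by (induction qs) auto
  show ?thesis unfolding pre_def matches_def cmp_enc 1 by (simp only: concat_map_concat map_map comp_def)
qed

lemma sub_str_digits: "set ds \<subseteq> {D0, D1} \<Longrightarrow> sub_str K (ds @ y) = ds @ sub_str K y"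
  by (induction ds) auto

lemma sub_str_enc: "sub_str K (enc_fml \<phi> @ z) = enc_fml (subst_f K \<phi>) @ sub_str K z"
proof (induction \<phi> arbitrary: z)
  case (Atom p)
  show ?case
    using pre_matches[of K p z] sub_str_digits[OF bin_digits, of K p "Hash # z"]
    by (simp add: atom_f_def enc_foldr_Disj enc_nat_def)
qed auto

lemma enc_fml_inj: "enc_fml a @ y = enc_fml b @ z \<Longrightarrow> a = b \<and> y = z"
proof (induction a arbitrary: b y z)
  case (Atom p)
  then show ?case by (cases b) auto
next
  case (Neg a)
  then obtain b' where b: "b = Neg b'" by (cases b) auto
  then show ?case using Neg.IH[of y b' z] Neg.prems by simp
next
  case (Next a)
  then obtain b' where b: "b = Next b'" by (cases b) auto
  then show ?case using Next.IH[of y b' z] Next.prems by simp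
next
  case (Fut a)
  then obtain b' where b: "b = Fut b'" by (cases b) auto
  then show ?case using Fut.IH[of y b' z] Fut.prems by simp
next
  case (Glob a)
  then obtain b' where b: "b = Glob b'" by (cases b) auto
  then show ?case using Glob.IH[of y b' z] Glob.prems by simp
next
  case (Tilde a)
  then obtain b' where b: "b = Tilde b'" by (cases b) auto
  then show ?case using Tilde.IH[of y b' z] Tilde.prems by simp
next
  case (Conj a1 a2)
  obtain b1 b2 where b: "b = Conj b1 b2" using Conj.prems by (cases b) auto
  then have "enc_fml a1 @ (enc_fml a2 @ y) = enc_fml b1 @ (enc_fml b2 @ z)" using Conj.prems by simp
  note h = Conj.IH(1)[OF this]
  note h' = Conj.IH(2)[OF conjunct2[OF h]]
  show ?case using conjunct1[OF h] h' by (simp add: b)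
next
  case (Disj a1 a2)
  obtain b1 b2 where b: "b = Disj b1 b2" using Disj.prems by (cases b) auto
  then have "enc_fml a1 @ (enc_fml a2 @ y) = enc_fml b1 @ (enc_fml b2 @ z)" using Disj.prems by simp
  note h = Disj.IH(1)[OF this]
  note h' = Disj.IH(2)[OF conjunct2[OF h]]
  show ?case using conjunct1[OF h] h' by (simp add: b)
next
  case (Until a1 a2)
  obtain b1 b2 where b: "b = Until b1 b2" using Until.prems by (cases b) auto
  then have "enc_fml a1 @ (enc_fml a2 @ y) = enc_fml b1 @ (enc_fml b2 @ z)" using Until.prems by simp
  note h = Until.IH(1)[OF this]
  note h' = Until.IH(2)[OF conjunct2[OF h]]
  show ?case using conjunct1[OF h] h' by (simp add: b)
next
  case (Rel a1 a2)
  obtain b1 b2 where b: "b = Rel b1 b2" using Rel.prems by (cases b) auto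
  then have "enc_fml a1 @ (enc_fml a2 @ y) = enc_fml b1 @ (enc_fml b2 @ z)" using Rel.prems by simp
  note h = Rel.IH(1)[OF this]
  note h' = Rel.IH(2)[OF conjunct2[OF h]]
  show ?case using conjunct1[OF h] h' by (simp add: b)
qed

text \<open>The leading symbol forces \<open>\<psi>\<close> to be a disjunction, and by unique
  readability its left member is the printed atom; what remains is the code of its right
  member.\<close>

lemma peel_Disj:
  "concat (map (\<lambda>i. CDisj # enc_fml (Atom (wn i))) ws) @ w = enc_fml \<psi> @ z \<Longrightarrow> \<exists>\<psi>'. w = enc_fml \<psi>' @ z"
proof (induction "ws" arbitrary: \<psi>)
  case (Cons i "ws")
  obtain \<alpha> \<beta> where "\<psi> = Disj \<alpha> \<beta>" using Cons.prems by (cases \<psi>) auto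
  then have "enc_fml (Atom (wn i)) @ (concat (map (\<lambda>i. CDisj # enc_fml (Atom (wn i))) ws) @ w)
     = enc_fml \<alpha> @ (enc_fml \<beta> @ z)" using Cons.prems by simp
  from enc_fml_inj[OF this] Cons.IH[of \<beta>] show ?case by blast
qed auto

lemma peel_Conj:
  "concat (map (\<lambda>c. CConj # enc_fml c) cs) @ w = enc_fml \<psi> @ z \<Longrightarrow> \<exists>\<psi>'. w = enc_fml \<psi>' @ z"
proof (induction cs arbitrary: \<psi>)
  case (Cons c cs)
  obtain \<alpha> \<beta> where "\<psi> = Conj \<alpha> \<beta>" using Cons.prems by (cases \<psi>) auto
  then have "enc_fml c @ (concat (map (\<lambda>c. CConj # enc_fml c) cs) @ w) = enc_fml \<alpha> @ (enc_fml \<beta> @ z)"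
    using Cons.prems by simp
  from enc_fml_inj[OF this] Cons.IH[of \<beta>] show ?case by blast
qed auto

text \<open>The output for \<open>CAtom\<close> starts with \<open>CDisj\<close> or
  \<open>CConj\<close>; a digit or \<open>Hash\<close> in front can only stem from the same symbol
  of the input.\<close>

lemma sub_str_head:
  assumes "sub_str K y = d # w" "d \<in> {D0, D1, Hash}"
  shows "\<exists>y'. y = d # y' \<and> w = (if d = Hash then enc_fml fBot else []) @ sub_str K y'"
proof (cases y)
  case (Cons s y')
  obtain "ws" where ws: "pre K y' = concat (map (\<lambda>i. CDisj # enc_fml (Atom (wn i))) ws)" using pre_eq by blast
  have "s \<noteq> CAtom" using assms Cons ws by (cases "ws") auto
  then show ?thesis using assms Cons by (auto split: if_splits)
qed (use assms in auto)

lemma sub_str_numeral: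
  assumes "set ds \<subseteq> {D0, D1}" "sub_str K y = ds @ Hash # w"
  shows "\<exists>y'. y = ds @ Hash # y' \<and> w = enc_fml fBot @ sub_str K y'"
  using assms
proof (induction ds arbitrary: y)
  case Nil
  then show ?case using sub_str_head[of K y Hash w] by auto
next
  case (Cons d ds)
  have "sub_str K y = d # (ds @ Hash # w)" "d \<in> {D0, D1, Hash}" "d \<noteq> Hash" using Cons.prems by auto
  from sub_str_head[OF this(1,2)] this(3) obtain y' where "y = d # y'" "ds @ Hash # w = sub_str K y'" by auto
  then show ?case using Cons.IH[of y'] Cons.prems(1) by auto
qed

text \<open>The machine does not parse the formula, so an output that codes a formula must reveal a
  formula code in the input. The induction is on the length because the second argument of a binary
  connective starts at a suffix known only after the first has been parsed.\<close>

lemma sub_str_parse: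
  "sub_str K y = enc_fml \<psi> @ z' \<Longrightarrow> \<exists>\<phi> z. y = enc_fml \<phi> @ z \<and> z' = sub_str K z"
proof (induction y arbitrary: \<psi> z' rule: length_induct)
  case (1 y)
  have "sub_str K y \<noteq> []" using 1(2) by (cases \<psi>) auto
  then obtain s y1 where y: "y = s # y1" by (cases y) auto
  have IH: "\<exists>\<phi> z. y2 = enc_fml \<phi> @ z \<and> z' = sub_str K z" if "length y2 \<le> length y1" "sub_str K y2 = enc_fml \<psi> @ z'" for y2 \<psi> z'
    using 1(1) that y by auto
  have IH2: "\<exists>\<phi>1 \<phi>2 z. y1 = enc_fml \<phi>1 @ enc_fml \<phi>2 @ z \<and> z' = sub_str K z"
    if h: "sub_str K y1 = enc_fml \<psi>1 @ enc_fml \<psi>2 @ z'" for \<psi>1 \<psi>2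
  proof -
    obtain \<phi>1 z1 where z1: "y1 = enc_fml \<phi>1 @ z1" "enc_fml \<psi>2 @ z' = sub_str K z1" using IH[OF order_refl h] by blast
    then obtain \<phi>2 z where "z1 = enc_fml \<phi>2 @ z" "z' = sub_str K z" using IH[of z1 \<psi>2 z'] by auto
    then show ?thesis using z1 by auto
  qed
  have IH1: "\<exists>\<phi> z. y1 = enc_fml \<phi> @ z \<and> z' = sub_str K z" if "sub_str K y1 = enc_fml \<psi>1 @ z'" for \<psi>1
    using IH[OF order_refl that] .
  show ?case
  proof (cases "s = CAtom")
    case True
    obtain "ws" where "pre K y1 = concat (map (\<lambda>i. CDisj # enc_fml (Atom (wn i))) ws)" using pre_eq by blast
    then have "concat (map (\<lambda>i. CDisj # enc_fml (Atom (wn i))) ws) @ (CConj # CAtom # sub_str K y1) = enc_fml \<psi> @ z'"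
      using 1(2) y True by simp
    from peel_Disj[OF this] obtain \<psi>1 where p1: "CConj # CAtom # sub_str K y1 = enc_fml \<psi>1 @ z'" by blast
    then obtain \<alpha> \<beta> where "\<psi>1 = Conj \<alpha> \<beta>" by (cases \<psi>1) auto
    with p1 have p2: "CAtom # sub_str K y1 = enc_fml \<alpha> @ enc_fml \<beta> @ z'" by simp
    then obtain p where "\<alpha> = Atom p" by (cases \<alpha>) auto
    with p2 have "sub_str K y1 = bin p @ Hash # (enc_fml \<beta> @ z')" by (simp add: enc_nat_def)
    \<comment> \<open>The numeral of the input atom is recovered from the copy that stands before
      \<open>fBot\<close>.\<close>
    from sub_str_numeral[OF bin_digits this] obtain y' where y': "y1 = bin p @ Hash # y'"
      "enc_fml \<beta> @ z' = enc_fml fBot @ sub_str K y'" by blast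
    then have "z' = sub_str K y'" using enc_fml_inj by blast
    moreover have "y = enc_fml (Atom p) @ y'" using y y' True by (simp add: enc_nat_def)
    ultimately show ?thesis by blast
  next
    case False
    then have eq: "s # (if s = Hash then enc_fml fBot else []) @ sub_str K y1 = enc_fml \<psi> @ z'"
      using 1(2) y by (auto split: if_splits)
    show ?thesis
    proof (cases \<psi>)
      case (Atom p) then show ?thesis using eq False by simp
    next
      case (Neg a)
      then have "s = CNeg" "sub_str K y1 = enc_fml a @ z'" using eq by (auto split: if_splits)
      then show ?thesis using IH1 y by (metis append_Cons enc_fml.simps(2))
    next
      case (Conj a b)
      then have "s = CConj" "sub_str K y1 = enc_fml a @ enc_fml b @ z'" using eq by (auto split: if_splits)
      then show ?thesis using IH2 y by (metis append_Cons append_assoc enc_fml.simps(3))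
    next
      case (Disj a b)
      then have "s = CDisj" "sub_str K y1 = enc_fml a @ enc_fml b @ z'" using eq by (auto split: if_splits)
      then show ?thesis using IH2 y by (metis append_Cons append_assoc enc_fml.simps(4))
    next
      case (Next a)
      then have "s = CX" "sub_str K y1 = enc_fml a @ z'" using eq by (auto split: if_splits)
      then show ?thesis using IH1 y by (metis append_Cons enc_fml.simps(5))
    next
      case (Fut a)
      then have "s = CF" "sub_str K y1 = enc_fml a @ z'" using eq by (auto split: if_splits)
      then show ?thesis using IH1 y by (metis append_Cons enc_fml.simps(6))
    next
      case (Glob a)
      then have "s = CG" "sub_str K y1 = enc_fml a @ z'" using eq by (auto split: if_splits)
      then show ?thesis using IH1 y by (metis append_Cons enc_fml.simps(7))
    next
      case (Until a b)
      then have "s = CU" "sub_str K y1 = enc_fml a @ enc_fml b @ z'" using eq by (auto split: if_splits)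
      then show ?thesis using IH2 y by (metis append_Cons append_assoc enc_fml.simps(8))
    next
      case (Rel a b)
      then have "s = CR" "sub_str K y1 = enc_fml a @ enc_fml b @ z'" using eq by (auto split: if_splits)
      then show ?thesis using IH2 y by (metis append_Cons append_assoc enc_fml.simps(9))
    next
      case (Tilde a)
      then have "s = CTilde" "sub_str K y1 = enc_fml a @ z'" using eq by (auto split: if_splits)
      then show ?thesis using IH1 y by (metis append_Cons enc_fml.simps(10))
    qed
  qed
qed

lemma enc_foldr_Conj: "enc_fml (foldr Conj cs g) = concat (map (\<lambda>c. CConj # enc_fml c) cs) @ enc_fml g"
  by (induction cs) auto

lemma enc_red: "enc_fml (red K \<phi>) = red_prefix K @ enc_fml (subst_f K \<phi>)"
  by (simp add: red_def red_prefix_def enc_foldr_Conj)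

lemma red_prefix_parse:
  assumes "red_prefix K @ sub_str K z = enc_fml \<chi>"
  shows "\<exists>\<phi>. z = enc_fml \<phi> \<and> \<chi> = red K \<phi>"
proof -
  have "concat (map (\<lambda>c. CConj # enc_fml c) (graph_cs (kn K) (kedges K) (kroot K)))
     @ (CDisj # enc_fml (Neg (Atom 0)) @ CConj # enc_fml (Atom 0) @ sub_str K z) = enc_fml \<chi> @ []"
    using assms by (simp add: red_prefix_def)
  from peel_Conj[OF this] obtain \<psi>1 where
    p1: "CDisj # enc_fml (Neg (Atom 0)) @ CConj # enc_fml (Atom 0) @ sub_str K z = enc_fml \<psi>1" by auto
  then obtain \<alpha> \<beta> where "\<psi>1 = Disj \<alpha> \<beta>" by (cases \<psi>1) auto
  with p1 have "enc_fml (Neg (Atom 0)) @ (CConj # enc_fml (Atom 0) @ sub_str K z) = enc_fml \<alpha> @ enc_fml \<beta>" by simp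
  from enc_fml_inj[OF this] have p2: "CConj # enc_fml (Atom 0) @ sub_str K z = enc_fml \<beta>" by simp
  then obtain \<gamma> \<delta> where "\<beta> = Conj \<gamma> \<delta>" by (cases \<beta>) auto
  with p2 have "enc_fml (Atom 0) @ sub_str K z = enc_fml \<gamma> @ enc_fml \<delta>" by simp
  from enc_fml_inj[OF this] have "sub_str K z = enc_fml \<delta> @ []" by simp
  from sub_str_parse[OF this] obtain \<phi> z2 where z: "z = enc_fml \<phi> @ z2" "[] = sub_str K z2" by blast
  then have "z2 = []" by (cases z2) (auto split: if_splits)
  then have z: "z = enc_fml \<phi>" using z by simp
  have "enc_fml \<chi> @ [] = enc_fml (red K \<phi>) @ []"
    using assms sub_str_enc[of K \<phi> "[]"] by (simp add: enc_red z)
  from enc_fml_inj[OF this] show ?thesis using z by blast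
qed

lemma enc_kripke_inj:
  assumes "enc_kripke K @ y = enc_kripke K' @ z"
  shows "K = K' \<and> y = z"
proof -
  have e: "prefix_free (enc_list enc_edge) (\<lambda>xs. True \<and> (\<forall>a\<in>set xs. True))" by (rule pf_list[OF pf_edge])
  have "prefix_free (enc_list enc_nat) (\<lambda>xs. True \<and> (\<forall>a\<in>set xs. True))" by (rule pf_list[OF pf_nat])
  then have "prefix_free (enc_list enc_nat) (\<lambda>_. True)" by simp
  then have l: "prefix_free (enc_list (enc_list enc_nat)) (\<lambda>xs. True \<and> (\<forall>a\<in>set xs. True))" by (rule pf_list)
  from assms have 1: "kn K = kn K'" and 2: "enc_list enc_edge (kedges K) @ enc_list (enc_list enc_nat) (klab K) @ enc_nat (kroot K) @ y
     = enc_list enc_edge (kedges K') @ enc_list (enc_list enc_nat) (klab K') @ enc_nat (kroot K') @ z"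
    by (auto simp: enc_kripke_def)
  from prefix_freeD[OF e 2] have 3: "kedges K = kedges K'" and
    4: "enc_list (enc_list enc_nat) (klab K) @ enc_nat (kroot K) @ y = enc_list (enc_list enc_nat) (klab K') @ enc_nat (kroot K') @ z"
    by auto
  from prefix_freeD[OF l 4] show ?thesis using 1 3 by (auto intro: kripke.equality)
qed

lemma red_str_ok:
  assumes "wf_nonserial K" "x = enc_kripke K @ z"
  shows "red_str x = red_prefix K @ sub_str K z"
proof -
  have "(THE w. \<exists>K z. wf_nonserial K \<and> x = enc_kripke K @ z \<and> w = red_prefix K @ sub_str K z) = red_prefix K @ sub_str K z"
    using assms enc_kripke_inj by (intro the_equality) blast+
  then show ?thesis using assms by (auto simp: red_str_def)
qed

lemma red_str_fail: "\<not> (\<exists>K z. wf_nonserial K \<and> x = enc_kripke K @ z) \<Longrightarrow> red_str x = []"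
  unfolding red_str_def by (rule if_not_P)

theorem red_str_correct:
  assumes "2 \<le> k"
  shows "x \<in> MC_lang k \<longleftrightarrow> red_str x \<in> SAT_lang k"
proof (cases "\<exists>K z. wf_nonserial K \<and> x = enc_kripke K @ z")
  case False
  have "enc_fml \<phi> \<noteq> []" for \<phi> by (cases \<phi>) auto
  then have "red_str x \<notin> SAT_lang k" unfolding red_str_fail[OF False] SAT_lang_def by auto metis
  moreover have "x \<notin> MC_lang k" using False by (auto simp: MC_lang_def wf_kripke_iff)
  ultimately show ?thesis by blast
next
  case True
  then obtain K z where K: "wf_nonserial K" "x = enc_kripke K @ z" by blast
  have r: "red_str x = red_prefix K @ sub_str K z" by (rule red_str_ok[OF K])
  show ?thesis
  proof
    assume "x \<in> MC_lang k"
    then obtain K' \<phi> where "x = enc_kripke K' @ enc_fml \<phi>" and h: "wf_kripke K'" "\<phi> \<in> LTL_F k" "tsat (kteam K') \<phi>"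
      by (auto simp: MC_lang_def)
    then have "K' = K" "z = enc_fml \<phi>" using enc_kripke_inj K(2) by metis+
    then have "red K \<phi> \<in> LTL_F k \<and> (\<exists>T. tsat T (red K \<phi>))" "red_str x = enc_fml (red K \<phi>)"
      using red_correct[OF assms K(1)] h r sub_str_enc[of K \<phi> "[]"] by (simp_all add: enc_red)
    then show "red_str x \<in> SAT_lang k" unfolding SAT_lang_def by blast
  next
    assume "red_str x \<in> SAT_lang k"
    then obtain \<chi> where "red_prefix K @ sub_str K z = enc_fml \<chi>" and h: "\<chi> \<in> LTL_F k" "\<exists>T. tsat T \<chi>"
      unfolding SAT_lang_def r by auto
    from red_prefix_parse[OF this(1)] obtain \<phi> where "z = enc_fml \<phi>" "\<chi> = red K \<phi>" by blast
    then show "x \<in> MC_lang k" using red_correct[OF assms K(1), of \<phi>] h K(2) unfolding MC_lang_def by blast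
  qed
qed

subsection \<open>First pass: parsing the Kripke structure\<close>

abbreviation (input) "check t \<equiv> Cond t Skip Rej"

text \<open>\<open>LMT\<close> follows the head and ends as \<open>Suc (length x)\<close>, which is
  the position of the right end marker and the limit for all numbers read into registers.\<close>

definition init :: "reg com" where
  "init = right ;; inc LMT ;; Loop inside (right ;; inc LMT) ;; rewind ;; right"

definition edge_body :: "reg com" where
  "edge_body = ((readnum U ;; check (TLess U NN)) ;; (readnum V ;; check (TLess V NN))) ;; (zero U ;; zero V)"

definition label_body :: "reg com" where
  "label_body = readnum CT2 ;; count_loop CT2 skipatom"

text \<open>Equality of \<open>CNT\<close> and \<open>NN\<close> is tested by excluding both strict
  inequalities. The count of the edges is read again later, so \<open>EP\<close> is saved before it;
  that of the label lists is known to be \<open>NN\<close>, so \<open>LP\<close> is saved behind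
  it.\<close>

definition pass1 :: "reg com" where
  "pass1 = (readnum NN ;; check (pos_reg NN)) ;;
     ((save EP ;; (readnum CNT ;; count_loop CNT edge_body)) ;;
      (((readnum CNT ;; (Cond (TLess CNT NN) Rej (Cond (TLess NN CNT) Rej (save LP)))) ;; count_loop CNT label_body) ;;
       (readnum RT ;; (Cond (TLess RT NN) (save PP) Rej))))"

context input
begin

lemma wp_init_loop: "\<lbrakk>0 < h; h \<le> Suc (length x)\<rbrakk> \<Longrightarrow>
   wp x B (Loop inside (right ;; inc LMT)) Q (\<sigma>(LMT := h), h, out) \<longleftrightarrow>
   Q True (\<sigma>(LMT := Suc (length x)), Suc (length x), out)"
proof (induction "Suc (length x) - h" arbitrary: h)
  case 0
  then show ?case by (subst wp_Loop) (simp add: read_inside)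
next
  case (Suc d)
  then have "d = Suc (length x) - Suc h" "Suc h \<le> Suc (length x)" by auto
  then have IH: "wp x B (Loop inside (right ;; inc LMT)) Q (\<sigma>(LMT := Suc h), Suc h, out) \<longleftrightarrow>
     Q True (\<sigma>(LMT := Suc (length x)), Suc (length x), out)" by (intro Suc.hyps(1)) simp_all
  have "min (length x) h = h" "\<not> length x < h" "Suc h \<le> B" using Suc.hyps(2) B by simp_all
  then show ?case using Suc.prems by (subst wp_Loop) (simp add: read_inside IH)
qed

lemma wp_init: "wp x B init Q ((\<lambda>_. 0), 0, []) \<longleftrightarrow> Q True ((\<lambda>_. 0)(LMT := Suc (length x)), pos x x, [])"
proof -
  have "wp x B (Loop inside (right ;; inc LMT)) Q ((\<lambda>_. 0)(LMT := 1), 1, []) \<longleftrightarrow>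
    Q True ((\<lambda>_. 0)(LMT := Suc (length x)), Suc (length x), [])" for Q
    by (rule wp_init_loop) simp_all
  moreover have "Suc 0 \<le> B" using B by simp
  ultimately show ?thesis unfolding init_def by (simp add: wp_rewind pos_def)
qed

lemma readyD: "ready \<sigma> \<Longrightarrow> \<sigma> ZERO = 0" "ready \<sigma> \<Longrightarrow> \<sigma> TMP = 0" "ready \<sigma> \<Longrightarrow> \<sigma> LMT = Suc (length x)"
  by (simp_all add: ready_def)

lemma ready_upd [simp]: "r \<notin> {ZERO, TMP, LMT} \<Longrightarrow> ready (\<sigma>(r := a)) \<longleftrightarrow> ready \<sigma>"
  by (auto simp: ready_def)

text \<open>Higher-order unification eta-expands updated states.\<close>

lemma ready_upd_eta [simp]: "r \<notin> {ZERO, TMP, LMT} \<Longrightarrow> ready (\<lambda>s. if s = r then a else \<sigma> s) \<longleftrightarrow> ready \<sigma>"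
  by (auto simp: ready_def)

lemma Tot_checked_num:
  assumes "ready \<sigma>" "r \<notin> {ZERO, LMT, TMP}" "l \<noteq> r" "suffix y x"
  shows "wp x B (readnum r ;; check (TLess r l)) (Tot enc_nat (\<lambda>m. m \<le> Suc (length x) \<and> m < \<sigma> l) (\<lambda>m z. \<sigma>(r := m)) y out)
     (\<sigma>, pos x y, out)"
  by (rule Tot_filter[OF Tot_readnum[OF assms(1,2,4)] pf_nat assms(4), where sf'' = "\<lambda>m z. \<sigma>(r := m)"])
    (use assms in simp)

lemma Tot_edge:
  assumes H: "ready \<sigma>" "\<sigma> U = 0" "\<sigma> V = 0" "\<sigma> NN \<le> Suc (length x)" and y: "suffix y x"
  shows "wp x B edge_body (Tot enc_edge (\<lambda>(u, v). u < \<sigma> NN \<and> v < \<sigma> NN) (\<lambda>a z. \<sigma>) y out) (\<sigma>, pos x y, out)"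
proof -
  have "wp x B (readnum U ;; check (TLess U NN)) (Tot enc_nat (\<lambda>m. m \<le> Suc (length x) \<and> m < \<sigma> NN) (\<lambda>m z. \<sigma>(U := m)) y out)
     (\<sigma>, pos x y, out)" by (rule Tot_checked_num) (use H y in auto)
  then have 1: "wp x B ((readnum U ;; check (TLess U NN)) ;; (readnum V ;; check (TLess V NN)))
    (Tot (\<lambda>(a, b). enc_nat a @ enc_nat b) (\<lambda>(a, b). (a \<le> Suc (length x) \<and> a < \<sigma> NN) \<and> (b \<le> Suc (length x) \<and> b < \<sigma> NN))
     (\<lambda>(a, b) z. \<sigma>(U := a, V := b)) y out) (\<sigma>, pos x y, out)"
  proof (rule Tot_seq[OF _ pf_nat y])
    fix a z assume "suffix z x"
    then have "wp x B (readnum V ;; check (TLess V NN))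
      (Tot enc_nat (\<lambda>m. m \<le> Suc (length x) \<and> m < (\<sigma>(U := a)) NN) (\<lambda>m z. \<sigma>(U := a, V := m)) z out) (\<sigma>(U := a), pos x z, out)"
      by (intro Tot_checked_num) (use H in auto)
    then show "wp x B (readnum V ;; check (TLess V NN))
      (Tot enc_nat (\<lambda>m. m \<le> Suc (length x) \<and> m < \<sigma> NN) (\<lambda>m z. \<sigma>(U := a, V := m)) z out) (\<sigma>(U := a), pos x z, out)"
      by simp
  qed
  have z: "\<sigma>(U := 0, V := 0) = \<sigma>" using H by auto
  have "wp x B edge_body (Tot (\<lambda>(a, b). enc_nat a @ enc_nat b)
     (\<lambda>e. (case e of (a, b) \<Rightarrow> (a \<le> Suc (length x) \<and> a < \<sigma> NN) \<and> (b \<le> Suc (length x) \<and> b < \<sigma> NN)) \<and> True)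
     (\<lambda>a z. \<sigma>) y out) (\<sigma>, pos x y, out)"
    unfolding edge_body_def
  proof (rule Tot_filter[OF 1 pf_edge y])
    fix a :: "nat \<times> nat" and z Q
    have "\<sigma>(U := fst a, V := 0, U := 0) = \<sigma>" "\<sigma>(U := 0, V := 0) = \<sigma>" using H by auto
    then show "wp x B (zero U ;; zero V) Q ((case a of (a, b) \<Rightarrow> \<lambda>z. \<sigma>(U := a, V := b)) z, pos x z, out) \<longleftrightarrow>
       (if True then Q True (\<sigma>, pos x z, out) else Q False (\<sigma>, pos x z, out))"
      using readyD[OF H(1)] by (simp add: case_prod_beta fun_upd_twist)
  qed
  then show ?thesis by (rule Tot_mono) (use H in auto)
qed

text \<open>The registers \<open>\<tau> z\<close> may depend on the rest of the input because
  \<open>c1\<close> can also save the head position once it has read the length.\<close>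

lemma Tot_list:
  assumes c1: "wp x B c1 (Tot enc_nat Pm (\<lambda>m z. (\<tau> z)(c := m)) y out) s" and y: "suffix y x"
    and \<tau>: "\<And>z. \<tau> z ZERO = 0" "c \<noteq> ZERO" and pf: "prefix_free e P"
    and body: "\<And>y k z. suffix y x \<Longrightarrow> wp x B body (Tot e P (\<lambda>a z'. (\<tau> z)(c := k)) y out) ((\<tau> z)(c := k), pos x y, out)"
  shows "wp x B (c1 ;; count_loop c body) (Tot (enc_list e) (\<lambda>xs. Pm (length xs) \<and> (\<forall>a\<in>set xs. P a))
     (\<lambda>xs z. (\<tau> (concat (map e xs) @ z))(c := 0)) y out) s"
proof -
  have "wp x B (c1 ;; count_loop c body) (Tot (\<lambda>(m, xs). enc_nat m @ concat (map e xs))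
     (\<lambda>(m, xs). Pm m \<and> (length xs = m \<and> (\<forall>a\<in>set xs. P a)))
     (\<lambda>(m, xs) z. (\<tau> (concat (map e xs) @ z))(c := 0)) y out) s"
  proof (rule Tot_seq[OF c1 pf_nat y])
    fix m z assume z: "suffix z x"
    show "wp x B (count_loop c body) (Tot (\<lambda>xs. concat (map e xs)) (\<lambda>xs. length xs = m \<and> (\<forall>a\<in>set xs. P a))
       (\<lambda>xs z'. (\<tau> z)(c := 0)) z out) ((\<tau> z)(c := m), pos x z, out)"
      by (rule Tot_count[OF \<tau>(1,2) pf body z])
  qed
  then show ?thesis
    by (rule Tot_mono) (auto simp: enc_list_def)
qed

lemma Tot_labels:
  assumes H: "ready \<sigma>" "\<sigma> CT2 = 0" and y: "suffix y x"
  shows "wp x B label_body (Tot (enc_list enc_nat) (\<lambda>xs. length xs \<le> Suc (length x)) (\<lambda>xs z. \<sigma>) y out) (\<sigma>, pos x y, out)"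
proof -
  have z: "\<sigma>(CT2 := 0) = \<sigma>" using H by auto
  have "wp x B label_body (Tot (enc_list enc_nat) (\<lambda>xs. length xs \<le> Suc (length x) \<and> (\<forall>a\<in>set xs. True))
     (\<lambda>xs z. \<sigma>(CT2 := 0)) y out) (\<sigma>, pos x y, out)"
    unfolding label_body_def
    by (rule Tot_list[where \<tau> = "\<lambda>_. \<sigma>", OF Tot_readnum y _ _ pf_nat Tot_skipatom]) (use H y readyD[OF H(1)] in auto)
  then show ?thesis unfolding z by simp
qed

lemma pf_enc_list_nat: "prefix_free (enc_list enc_nat) P"
proof -
  have "prefix_free (enc_list enc_nat) (\<lambda>xs. P xs \<and> (\<forall>a\<in>set xs. True))" by (rule pf_list[OF pf_nat])
  then show ?thesis by simp
qed

lemma Tot_pass1: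
  fixes out
  defines "\<sigma>0 \<equiv> (\<lambda>_. 0)(LMT := Suc (length x))"
  shows "wp x B pass1 (Tot (\<lambda>(n, es, ls, r). enc_nat n @ enc_list enc_edge es @ enc_list (enc_list enc_nat) ls @ enc_nat r)
     (\<lambda>(n, es, ls, r). (n \<le> Suc (length x) \<and> 0 < n) \<and> (length es \<le> Suc (length x) \<and> (\<forall>(u, v)\<in>set es. u < n \<and> v < n)) \<and>
        ((length ls \<le> Suc (length x) \<and> length ls = n) \<and> (\<forall>l\<in>set ls. length l \<le> Suc (length x))) \<and> (r \<le> Suc (length x) \<and> r < n))
     (\<lambda>(n, es, ls, r) z. \<sigma>0(NN := n, EP := pos x (enc_list enc_edge es @ enc_list (enc_list enc_nat) ls @ enc_nat r @ z),
        LP := pos x (concat (map (enc_list enc_nat) ls) @ enc_nat r @ z), RT := r, PP := pos x z)) x out) (\<sigma>0, pos x x, out)"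
proof -
  have H0: "ready \<sigma>0" by (simp add: ready_def \<sigma>0_def)
  have z0: "\<sigma>0 r = 0" if "r \<noteq> LMT" for r using that by (simp add: \<sigma>0_def)
  have 1: "wp x B (readnum NN ;; check (pos_reg NN)) (Tot enc_nat (\<lambda>m. m \<le> Suc (length x) \<and> 0 < m) (\<lambda>m z. \<sigma>0(NN := m)) x out)
     (\<sigma>0, pos x x, out)"
    by (rule Tot_filter[OF Tot_readnum pf_nat, where sf'' = "\<lambda>m z. \<sigma>0(NN := m)"]) (use H0 z0 in auto)
  have 2: "wp x B (save EP ;; (readnum CNT ;; count_loop CNT edge_body))
     (Tot (enc_list enc_edge) (\<lambda>es. length es \<le> Suc (length x) \<and> (\<forall>(u, v)\<in>set es. u < n \<and> v < n))
       (\<lambda>es z. \<sigma>0(NN := n, EP := pos x y)) y out) (\<sigma>0(NN := n), pos x y, out)"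
    if y: "suffix y x" and n: "n \<le> Suc (length x)" for y n
  proof -
    let ?t = "\<sigma>0(NN := n, EP := pos x y)"
    have t: "?t ZERO = 0" "ready ?t" using H0 z0 by auto
    have "wp x B edge_body (Tot enc_edge (\<lambda>(u, v). u < n \<and> v < n) (\<lambda>a z'. ?t(CNT := k)) w out) (?t(CNT := k), pos x w, out)"
      if "suffix w x" for w k
      using Tot_edge[of "?t(CNT := k)" w out] t n that z0 by simp
    then have "wp x B (readnum CNT ;; count_loop CNT edge_body)
      (Tot (enc_list enc_edge) (\<lambda>es. length es \<le> Suc (length x) \<and> (\<forall>e\<in>set es. (case e of (u, v) \<Rightarrow> u < n \<and> v < n)))
       (\<lambda>es z. ?t(CNT := 0)) y out) (?t, pos x y, out)"
      by (intro Tot_list[where \<tau> = "\<lambda>_. ?t", OF Tot_readnum y _ _ pf_edge]) (use t y in auto)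
    moreover have "?t(CNT := 0) = ?t" using z0 by auto
    ultimately show ?thesis using H0 z0 pos_pos pos_le by simp
  qed
  have 3: "wp x B ((readnum CNT ;; (Cond (TLess CNT NN) Rej (Cond (TLess NN CNT) Rej (save LP)))) ;; count_loop CNT label_body)
     (Tot (enc_list (enc_list enc_nat)) (\<lambda>ls. (length ls \<le> Suc (length x) \<and> length ls = n) \<and> (\<forall>l\<in>set ls. length l \<le> Suc (length x)))
       (\<lambda>ls z. \<sigma>(LP := pos x (concat (map (enc_list enc_nat) ls) @ z))) y out) (\<sigma>, pos x y, out)"
    if y: "suffix y x" and \<sigma>: "ready \<sigma>" "\<sigma> NN = n" "\<sigma> CNT = 0" "\<sigma> CT2 = 0" for \<sigma> y n
  proof -
    have "wp x B (readnum CNT ;; (Cond (TLess CNT NN) Rej (Cond (TLess NN CNT) Rej (save LP))))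
      (Tot enc_nat (\<lambda>m. m \<le> Suc (length x) \<and> m = n) (\<lambda>m z. (\<sigma>(LP := pos x z))(CNT := m)) y out) (\<sigma>, pos x y, out)"
    proof (rule Tot_filter[OF Tot_readnum pf_nat y, where sf'' = "\<lambda>m z. \<sigma>(CNT := m)"])
      fix m z Q
      show "wp x B (Cond (TLess CNT NN) Rej (Cond (TLess NN CNT) Rej (save LP))) Q (\<sigma>(CNT := m), pos x z, out) \<longleftrightarrow>
        (if m = n then Q True (\<sigma>(LP := pos x z, CNT := m), pos x z, out) else Q False (\<sigma>(CNT := m), pos x z, out))"
        using \<sigma> readyD[OF \<sigma>(1)] pos_pos pos_le by (simp add: fun_upd_twist)
    qed (use \<sigma> y in auto)
    then have "wp x B ((readnum CNT ;; (Cond (TLess CNT NN) Rej (Cond (TLess NN CNT) Rej (save LP)))) ;; count_loop CNT label_body)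
     (Tot (enc_list (enc_list enc_nat)) (\<lambda>ls. (length ls \<le> Suc (length x) \<and> length ls = n) \<and> (\<forall>l\<in>set ls. length l \<le> Suc (length x)))
       (\<lambda>ls z. (\<sigma>(LP := pos x (concat (map (enc_list enc_nat) ls) @ z)))(CNT := 0)) y out) (\<sigma>, pos x y, out)"
      by (rule Tot_list[OF _ y _ _ pf_enc_list_nat Tot_labels]) (use \<sigma> readyD[OF \<sigma>(1)] in auto)
    moreover have "(\<sigma>(LP := p))(CNT := 0) = \<sigma>(LP := p)" for p using \<sigma> by auto
    ultimately show ?thesis by simp
  qed
  have 4: "wp x B (readnum RT ;; (Cond (TLess RT NN) (save PP) Rej))
     (Tot enc_nat (\<lambda>m. m \<le> Suc (length x) \<and> m < n) (\<lambda>m z. \<sigma>(RT := m, PP := pos x z)) y out) (\<sigma>, pos x y, out)"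
    if y: "suffix y x" and \<sigma>: "ready \<sigma>" "\<sigma> NN = n" for \<sigma> y n
    by (rule Tot_filter[OF Tot_readnum pf_nat y, where sf'' = "\<lambda>m z. \<sigma>(RT := m)"])
      (use \<sigma> readyD[OF \<sigma>(1)] pos_pos pos_le y in auto)
  let ?c3 = "(readnum CNT ;; (Cond (TLess CNT NN) Rej (Cond (TLess NN CNT) Rej (save LP)))) ;; count_loop CNT label_body"
  let ?c4 = "readnum RT ;; (Cond (TLess RT NN) (save PP) Rej)"
  let ?c2 = "save EP ;; (readnum CNT ;; count_loop CNT edge_body)"
  have 34: "wp x B (?c3 ;; ?c4)
     (Tot (\<lambda>(ls, r). enc_list (enc_list enc_nat) ls @ enc_nat r)
       (\<lambda>(ls, r). ((length ls \<le> Suc (length x) \<and> length ls = n) \<and> (\<forall>l\<in>set ls. length l \<le> Suc (length x))) \<and> (r \<le> Suc (length x) \<and> r < n))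
       (\<lambda>(ls, r) z. \<sigma>(LP := pos x (concat (map (enc_list enc_nat) ls) @ enc_nat r @ z), RT := r, PP := pos x z)) y out) (\<sigma>, pos x y, out)"
    if y: "suffix y x" and \<sigma>: "ready \<sigma>" "\<sigma> NN = n" "\<sigma> CNT = 0" "\<sigma> CT2 = 0" for \<sigma> y n
    by (rule Tot_seq[OF 3[OF y \<sigma>] pf_list[OF pf_enc_list_nat] y]) (rule 4, use \<sigma> in auto)
  have 234: "wp x B (?c2 ;; (?c3 ;; ?c4))
     (Tot (\<lambda>(es, b). enc_list enc_edge es @ (case b of (ls, r) \<Rightarrow> enc_list (enc_list enc_nat) ls @ enc_nat r))
       (\<lambda>(es, b). (length es \<le> Suc (length x) \<and> (\<forall>(u, v)\<in>set es. u < n \<and> v < n)) \<and> (case b of (ls, r) \<Rightarrow>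
         ((length ls \<le> Suc (length x) \<and> length ls = n) \<and> (\<forall>l\<in>set ls. length l \<le> Suc (length x))) \<and> (r \<le> Suc (length x) \<and> r < n)))
       (\<lambda>(es, b) z. (case b of (ls, r) \<Rightarrow> \<lambda>z. \<sigma>0(NN := n, EP := pos x y,
         LP := pos x (concat (map (enc_list enc_nat) ls) @ enc_nat r @ z), RT := r, PP := pos x z)) z) y out) (\<sigma>0(NN := n), pos x y, out)"
    if y: "suffix y x" and n: "n \<le> Suc (length x)" for y n
    by (rule Tot_seq[OF 2[OF y n] pf_list[OF pf_edge] y]) (rule 34, use H0 z0 in auto)
  have "wp x B pass1
     (Tot (\<lambda>(n, c). enc_nat n @ (case c of (es, b) \<Rightarrow> enc_list enc_edge es @ (case b of (ls, r) \<Rightarrow> enc_list (enc_list enc_nat) ls @ enc_nat r)))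
       (\<lambda>(n, c). (n \<le> Suc (length x) \<and> 0 < n) \<and> (case c of (es, b) \<Rightarrow> (length es \<le> Suc (length x) \<and> (\<forall>(u, v)\<in>set es. u < n \<and> v < n)) \<and> (case b of (ls, r) \<Rightarrow>
         ((length ls \<le> Suc (length x) \<and> length ls = n) \<and> (\<forall>l\<in>set ls. length l \<le> Suc (length x))) \<and> (r \<le> Suc (length x) \<and> r < n))))
       (\<lambda>(n, c) z. (\<lambda>n y c z. (case c of (es, b) \<Rightarrow> \<lambda>z. (case b of (ls, r) \<Rightarrow> \<lambda>z. \<sigma>0(NN := n, EP := pos x y,
         LP := pos x (concat (map (enc_list enc_nat) ls) @ enc_nat r @ z), RT := r, PP := pos x z)) z) z) n
          ((case c of (es, b) \<Rightarrow> enc_list enc_edge es @ (case b of (ls, r) \<Rightarrow> enc_list (enc_list enc_nat) ls @ enc_nat r)) @ z) c z)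
       x out) (\<sigma>0, pos x x, out)"
    unfolding pass1_def
    by (rule Tot_seq[OF 1 pf_nat]) (simp, rule 234, auto)
  then show ?thesis by (rule Tot_mono) (fastforce simp: case_prod_beta, fastforce)
qed

end

subsection \<open>Second pass: printing the formula\<close>

definition edge_loop :: "reg com \<Rightarrow> reg com" where
  "edge_loop body = goto EP ;; readnum CNT ;;
     count_loop CNT (readnum U ;; readnum V ;; body ;; zero U ;; zero V)"

definition print_graph :: "reg com" where
  "print_graph =
     outs (concat (map (\<lambda>c. CConj # enc_fml c) fixed_cs)) ;;
     outs [CConj] ;; cpy U RT ;; prt (root_c 1) ;; zero U ;;
     range_loop U NN (outs [CConj] ;; prt (cover_c 1) ;; outs [CConj] ;; prt (persist_c 1)) ;;
     range_loop U NN (range_loop V U (outs [CConj] ;; prt (excl_c 1 3))) ;;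
     outs (CConj # CNeg # CConj # enc_fml fE) ;;
     edge_loop (outs [CConj] ;; prt (Neg (Atom 1))) ;;
     outs (enc_fml fTop) ;;
     outs (CConj # CTilde # CDisj # enc_fml fTop @ CConj # enc_fml (Tilde (Atom 0)) @
       CConj # enc_fml (Fut (Disj (Atom 0) fE)) @ [CTilde]) ;;
     edge_loop (outs [CDisj] ;; prt (step_part 1 3)) ;;
     outs (enc_fml fBot) ;;
     outs (CConj # CTilde # CDisj # enc_fml (Neg (Atom 0)) @ [CConj]) ;;
     cpy U RT ;; prt (Disj (Neg fE) (Atom 1)) ;; zero U ;;
     outs (CConj # enc_fml (Tilde (Fut (Neg fE))) @ CConj # CTilde # CF # CConj # enc_fml (Tilde (Neg fN))) ;;
     edge_loop (outs [CConj] ;; prt (link_part 1 3)) ;;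
     outs (enc_fml fTop @ CTilde # CDisj # enc_fml (Atom 0) @ CConj # enc_fml (Tilde (Neg (Atom 0)))) ;;
     range_loop U NN (outs [CConj] ;; prt (match_part 1)) ;;
     outs (enc_fml fTop) ;;
     outs (CDisj # enc_fml (Neg (Atom 0)) @ CConj # enc_fml (Atom 0))"

text \<open>The only input head commutes between the positions \<open>PA\<close> and
  \<open>PB\<close>, both of which advance on equal digits. \<open>GO\<close> keeps the loop running
  and \<open>EQ\<close> holds the result.\<close>

definition cmp_body :: "reg com" where
  "cmp_body = goto PA ;;
     Cond (at_sym D0) (goto PB ;; Cond (at_sym D0) (inc PA ;; inc PB) (zero GO))
    (Cond (at_sym D1) (goto PB ;; Cond (at_sym D1) (inc PA ;; inc PB) (zero GO))
    (Cond (at_sym Hash) (goto PB ;; Cond (at_sym Hash) (inc EQ ;; zero GO) (zero GO)) (zero GO)))"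

text \<open>\<open>PP\<close> is the position of \<open>CAtom\<close>, so the numeral of the formula
  starts one cell further. After the comparison the head returns to the label atom at
  \<open>QB\<close> and skips it to reach the next one.\<close>

definition atom_test :: "reg com" where
  "atom_test = save QB ;; inc GO ;; cpy PA PP ;; inc PA ;; cpy PB QB ;; Loop (pos_reg GO) cmp_body ;;
     goto QB ;; Cond (pos_reg EQ) (outs [CDisj] ;; prt (Atom 1)) Skip ;;
     zero EQ ;; zero PA ;; zero PB ;; zero QB ;; skipatom"

definition match_loop :: "reg com" where
  "match_loop = goto LP ;; range_loop U NN (readnum CT2 ;; count_loop CT2 atom_test)"

text \<open>\<open>PP\<close> is reused as a bookmark: the head leaves the formula to scan the
  labels and has to return to the current atom symbol.\<close>

definition copy_body :: "reg com" where
  "copy_body = Cond (at_sym CAtom) (save PP ;; match_loop ;; goto PP ;; outs [CConj, CAtom])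
       (Cond (at_sym Hash) (outs (Hash # enc_fml fBot)) (Basic OutCur)) ;; right"

definition pass2 :: "reg com" where
  "pass2 = print_graph ;; goto PP ;; Loop inside copy_body"

definition red_com :: "reg com" where
  "red_com = init ;; pass1 ;; pass2"

lemma amap_parts:
  "amap (inst u v) (root_c 1) = root_c (wn u)"
  "amap (inst u v) (cover_c 1) = cover_c (wn u)"
  "amap (inst u v) (persist_c 1) = persist_c (wn u)"
  "amap (inst u v) (excl_c 1 3) = excl_c (wn u) (wn v)"
  "amap (inst u v) (step_part 1 3) = step_part (wn u) (wn v)"
  "amap (inst u v) (link_part 1 3) = link_part (wn u) (wn v)"
  "amap (inst u v) (match_part 1) = match_part (wn u)"
  "amap (inst u v) fE = fE"
  "amap (inst u v) (Atom 1) = Atom (wn u)"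
  by (simp_all add: root_c_def cover_c_def persist_c_def excl_c_def step_part_def link_part_def match_part_def
      fE_def fN_def inst_def)

lemmas amap_parts_Suc = amap_parts[unfolded One_nat_def]

lemma concat_concat: "concat (concat xss) = concat (map concat xss)"
  by (induction xss) auto

lemma enc_nat_wn: "enc_nat (wn w) = bin w @ [D1, Hash]"
  by (simp add: enc_nat_def bin_wn)

lemma enc_bigC: "enc_fml (bigC fs) = concat (map (\<lambda>f. CConj # enc_fml f) fs) @ enc_fml fTop"
  by (simp add: bigC_def enc_foldr_Conj)

lemma enc_bigD: "enc_fml (bigD fs) = concat (map (\<lambda>f. CDisj # enc_fml f) fs) @ enc_fml fBot"
  unfolding bigD_def by (induction fs) auto

section \<open>Correctness of the printing pass\<close>

context input
begin

text \<open>Invariant of the second pass. The value of \<open>PP\<close> is left open because it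
  changes at every atom of the formula; the working registers are 0 between subroutines.\<close>

definition env :: "kripke \<Rightarrow> sym list \<Rightarrow> (reg \<Rightarrow> nat) \<Rightarrow> bool" where
  "env K z \<sigma> \<longleftrightarrow> wf_nonserial K \<and> enc_kripke K @ z = x \<and> ready \<sigma> \<and> \<sigma> NN = kn K \<and> \<sigma> RT = kroot K
     \<and> \<sigma> EP = pos x (enc_list enc_edge (kedges K) @ enc_list (enc_list enc_nat) (klab K) @ enc_nat (kroot K) @ z)
     \<and> \<sigma> LP = pos x (concat (map (enc_list enc_nat) (klab K)) @ enc_nat (kroot K) @ z)
     \<and> kn K \<le> Suc (length x) \<and> length (kedges K) \<le> Suc (length x) \<and> (\<forall>l\<in>set (klab K). length l \<le> Suc (length x))
     \<and> (\<forall>r\<in>{CNT, CT2, U, V, PA, PB, QB, EQ, GO}. \<sigma> r = 0)"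

lemma env_zero:
  "env K z \<sigma> \<Longrightarrow> \<sigma> CNT = 0" "env K z \<sigma> \<Longrightarrow> \<sigma> CT2 = 0" "env K z \<sigma> \<Longrightarrow> \<sigma> U = 0" "env K z \<sigma> \<Longrightarrow> \<sigma> V = 0"
  "env K z \<sigma> \<Longrightarrow> \<sigma> PA = 0" "env K z \<sigma> \<Longrightarrow> \<sigma> PB = 0" "env K z \<sigma> \<Longrightarrow> \<sigma> QB = 0" "env K z \<sigma> \<Longrightarrow> \<sigma> EQ = 0" "env K z \<sigma> \<Longrightarrow> \<sigma> GO = 0"
  by (simp_all add: env_def)

lemma env_ready: "env K z \<sigma> \<Longrightarrow> ready \<sigma>" by (simp add: env_def)

lemma env_suffix:
  assumes "env K z \<sigma>"
  shows "suffix (enc_list enc_edge (kedges K) @ enc_list (enc_list enc_nat) (klab K) @ enc_nat (kroot K) @ z) x"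
    "suffix (concat (map (enc_list enc_nat) (klab K)) @ enc_nat (kroot K) @ z) x" "suffix z x"
proof -
  have "x = enc_nat (kn K) @ enc_list enc_edge (kedges K) @ enc_list (enc_list enc_nat) (klab K) @ enc_nat (kroot K) @ z"
    using assms by (simp add: env_def enc_kripke_def eq_commute[of _ x])
  then show 1: "suffix (enc_list enc_edge (kedges K) @ enc_list (enc_list enc_nat) (klab K) @ enc_nat (kroot K) @ z) x"
    by (metis suffixI)
  then have "suffix (enc_list (enc_list enc_nat) (klab K) @ enc_nat (kroot K) @ z) x" by (rule suffix_app)
  then have "suffix (enc_nat (length (klab K)) @ concat (map (enc_list enc_nat) (klab K)) @ enc_nat (kroot K) @ z) x"
    by (simp add: enc_list_def)
  then show 2: "suffix (concat (map (enc_list enc_nat) (klab K)) @ enc_nat (kroot K) @ z) x" by (rule suffix_app)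
  from suffix_app[OF suffix_app[OF 2]] show "suffix z x" .
qed

lemma wp_edge_loop:
  assumes env: "env K z \<sigma>" and h: "h \<le> Suc (length x)"
    and body: "\<And>\<tau> h out Q. wp x B body Q (\<tau>, h, out) \<longleftrightarrow> Q True (\<tau>, h, out @ g (\<tau> U) (\<tau> V))"
  defines "y \<equiv> enc_list (enc_list enc_nat) (klab K) @ enc_nat (kroot K) @ z"
  shows "wp x B (edge_loop body) Q (\<sigma>, h, out) \<longleftrightarrow> Q True (\<sigma>, pos x y, out @ concat (map (\<lambda>(u, v). g u v) (kedges K)))"
proof -
  note H = env_ready[OF env] readyD[OF env_ready[OF env]]
  have m: "length (kedges K) \<le> Suc (length x)" and EP: "\<sigma> EP = pos x (enc_list enc_edge (kedges K) @ y)"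
    using env by (auto simp: env_def y_def)
  have sf: "suffix (enc_nat (length (kedges K)) @ concat (map enc_edge (kedges K)) @ y) x"
    using env_suffix(1)[OF env] by (simp add: enc_list_def y_def)
  let ?b = "readnum U ;; readnum V ;; body ;; zero U ;; zero V"
  have b: "wp x B ?b Q (\<sigma>(CNT := k), pos x (enc_edge a @ w), out) \<longleftrightarrow>
      Q True (\<sigma>(CNT := k), pos x w, out @ (case a of (u, v) \<Rightarrow> g u v))"
    if "a \<in> set (kedges K)" "suffix (enc_edge a @ w) x" for a w k out Q
  proof -
    obtain u v where a: "a = (u, v)" by fastforce
    have "u < kn K" "v < kn K" "kn K \<le> Suc (length x)" using env that(1) by (auto simp: env_def wf_nonserial_def a)
    then have uv: "u \<le> Suc (length x)" "v \<le> Suc (length x)" by auto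
    have s1: "suffix (enc_nat u @ enc_nat v @ w) x" using that(2) by (simp add: a)
    have s2: "suffix (enc_nat v @ w) x" using s1 by (rule suffix_app)
    have e: "\<sigma>(CNT := k, U := u, V := v, U := 0, V := 0) = \<sigma>(CNT := k)" using env_zero[OF env] by auto
    show ?thesis using H uv s1 s2 e by (simp add: a body)
  qed
  have e: "\<sigma>(CNT := 0) = \<sigma>" using env_zero[OF env] by auto
  have loop: "wp x B (count_loop CNT ?b) Q (\<sigma>(CNT := length (kedges K)), pos x (concat (map enc_edge (kedges K)) @ y), out) \<longleftrightarrow>
     Q True (\<sigma>(CNT := 0), pos x y, out @ concat (map (\<lambda>(u, v). g u v) (kedges K)))" for Q out
    by (rule wp_count_loop) (use H b suffix_app[OF sf] in auto)
  have rd: "wp x B (readnum CNT) Q (\<sigma>, \<sigma> EP, out) \<longleftrightarrow>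
     Q True (\<sigma>(CNT := length (kedges K)), pos x (concat (map enc_edge (kedges K)) @ y), out)" for Q out
    using wp_readnum[OF H(1) _ m sf, of CNT] EP by (simp add: enc_list_def)
  have le: "\<sigma> EP \<le> Suc (length x)" using EP pos_le by simp
  show ?thesis unfolding edge_loop_def wp_Seq using H h le
    by (simp add: rd loop e del: wp_Seq)
qed

lemma wp_world_loop:
  assumes env: "env K z \<sigma>"
    and body: "\<And>i out Q. i < kn K \<Longrightarrow> wp x B body Q (\<sigma>(U := i), h, out) \<longleftrightarrow> Q True (\<sigma>(U := i), h, out @ g i)"
  shows "wp x B (range_loop U NN body) Q (\<sigma>, h, out) \<longleftrightarrow> Q True (\<sigma>, h, out @ concat (map g [0..<kn K]))"
proof -
  have e: "\<sigma>(U := 0) = \<sigma>" using env_zero[OF env] by auto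
  have n: "kn K \<le> B" "\<sigma> NN = kn K" "\<sigma> ZERO = 0" using env B readyD[OF env_ready[OF env]] by (auto simp: env_def)
  from wp_range_loop[where h = "\<lambda>_. h" and f = g and u = U and l = NN and \<sigma> = \<sigma> and body = body, OF n(3) _ _ n(2,1)] body
  show ?thesis by (simp add: e)
qed

lemma wp_pair_loop:
  assumes env: "env K z \<sigma>"
    and body: "\<And>\<tau> h out Q. wp x B body Q (\<tau>, h, out) \<longleftrightarrow> Q True (\<tau>, h, out @ g (\<tau> U) (\<tau> V))"
  shows "wp x B (range_loop U NN (range_loop V U body)) Q (\<sigma>, h, out) \<longleftrightarrow>
    Q True (\<sigma>, h, out @ concat (map (\<lambda>i. concat (map (g i) [0..<i])) [0..<kn K]))"
proof (rule wp_world_loop[OF env])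
  fix i out Q assume i: "i < kn K"
  then have iB: "i \<le> B" using env B unfolding env_def by linarith
  have e: "\<sigma>(U := i, V := 0) = \<sigma>(U := i)" using env_zero[OF env] by auto
  have b: "wp x B body Q (\<sigma>(U := i, V := j), h, out) \<longleftrightarrow> Q True (\<sigma>(U := i, V := j), h, out @ g i j)" for j Q out
    by (simp add: body)
  have "wp x B (range_loop V U body) Q (\<sigma>(U := i), h, out) \<longleftrightarrow> Q True (\<sigma>(U := i, V := 0), h, out @ concat (map (g i) [0..<i]))"
    by (rule wp_range_loop[where h = "\<lambda>_. h"]) (use b iB readyD[OF env_ready[OF env]] in auto)
  then show "wp x B (range_loop V U body) Q (\<sigma>(U := i), h, out) \<longleftrightarrow> Q True (\<sigma>(U := i), h, out @ concat (map (g i) [0..<i]))"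
    by (simp only: e)
qed

text \<open>The code is cut at the points where the program changes between fixed words, single
  templates and loops, so that each piece is the output of one command.\<close>

lemma red_prefix_eq:
  "red_prefix K = concat (map (\<lambda>c. CConj # enc_fml c) fixed_cs)
     @ (CConj # enc_fml (root_c (wn (kroot K))))
     @ concat (map (\<lambda>i. (CConj # enc_fml (cover_c (wn i))) @ (CConj # enc_fml (persist_c (wn i)))) [0..<kn K])
     @ concat (map (\<lambda>i. concat (map (\<lambda>j. CConj # enc_fml (excl_c (wn i) (wn j))) [0..<i])) [0..<kn K])
     @ (CConj # CNeg # CConj # enc_fml fE)
     @ concat (map (\<lambda>(u, v). CConj # enc_fml (Neg (Atom (wn u)))) (kedges K))
     @ enc_fml fTop
     @ (CConj # CTilde # CDisj # enc_fml fTop @ CConj # enc_fml (Tilde (Atom 0)) @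
       CConj # enc_fml (Fut (Disj (Atom 0) fE)) @ [CTilde])
     @ concat (map (\<lambda>(u, v). CDisj # enc_fml (step_part (wn u) (wn v))) (kedges K))
     @ enc_fml fBot
     @ (CConj # CTilde # CDisj # enc_fml (Neg (Atom 0)) @ [CConj])
     @ enc_fml (Disj (Neg fE) (Atom (wn (kroot K))))
     @ (CConj # enc_fml (Tilde (Fut (Neg fE))) @ CConj # CTilde # CF # CConj # enc_fml (Tilde (Neg fN)))
     @ concat (map (\<lambda>(u, v). CConj # enc_fml (link_part (wn u) (wn v))) (kedges K))
     @ (enc_fml fTop @ CTilde # CDisj # enc_fml (Atom 0) @ CConj # enc_fml (Tilde (Neg (Atom 0))))
     @ concat (map (\<lambda>i. CConj # enc_fml (match_part (wn i))) [0..<kn K])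
     @ enc_fml fTop
     @ (CDisj # enc_fml (Neg (Atom 0)) @ CConj # enc_fml (Atom 0))"
proof -
  have 1: "map (\<lambda>c. CConj # enc_fml c) (map (\<lambda>(u, v). f u v) es) = map (\<lambda>(u, v). CConj # enc_fml (f u v)) es" for f and es :: "(nat \<times> nat) list"
    by auto
  have 2: "map (\<lambda>c. CDisj # enc_fml c) (map (\<lambda>(u, v). f u v) es) = map (\<lambda>(u, v). CDisj # enc_fml (f u v)) es" for f and es :: "(nat \<times> nat) list"
    by auto
  have 3: "enc_fml (source_c (map (\<lambda>(u, v). Neg (Atom (wn u))) (kedges K))) =
     CNeg # CConj # enc_fml fE @ concat (map (\<lambda>(u, v). CConj # enc_fml (Neg (Atom (wn u)))) (kedges K)) @ enc_fml fTop"
    unfolding source_c_def enc_fml.simps(2,3) enc_bigC 1 by simp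
  have 4: "enc_fml (step_c (map (\<lambda>(u, v). step_part (wn u) (wn v)) (kedges K))) =
     CTilde # CDisj # enc_fml fTop @ CConj # enc_fml (Tilde (Atom 0)) @ CConj # enc_fml (Fut (Disj (Atom 0) fE)) @
     CTilde # concat (map (\<lambda>(u, v). CDisj # enc_fml (step_part (wn u) (wn v))) (kedges K)) @ enc_fml fBot"
    unfolding step_c_def enc_fml.simps(3,4,10) enc_bigD 2 by simp
  have 5: "enc_fml (complete_c (wn (kroot K)) (map (\<lambda>(u, v). link_part (wn u) (wn v)) (kedges K)) (map (\<lambda>w. match_part (wn w)) [0..<kn K])) =
     CTilde # CDisj # enc_fml (Neg (Atom 0)) @ CConj # enc_fml (Disj (Neg fE) (Atom (wn (kroot K)))) @
     CConj # enc_fml (Tilde (Fut (Neg fE))) @ CConj # CTilde # CF # CConj # enc_fml (Tilde (Neg fN)) @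
     concat (map (\<lambda>(u, v). CConj # enc_fml (link_part (wn u) (wn v))) (kedges K)) @ enc_fml fTop @
     CTilde # CDisj # enc_fml (Atom 0) @ CConj # enc_fml (Tilde (Neg (Atom 0))) @
     concat (map (\<lambda>i. CConj # enc_fml (match_part (wn i))) [0..<kn K]) @ enc_fml fTop"
    unfolding complete_c_def by (simp add: enc_bigC 1 comp_def case_prod_unfold)
  show ?thesis
    unfolding red_prefix_def graph_cs_def map_append concat_append list.map(2) list.map(1) concat.simps 3 4 5
    by (simp add: concat_concat map_concat comp_def)
qed

lemma wp_print_graph:
  assumes env: "env K z \<sigma>" and h: "h \<le> Suc (length x)"
  shows "\<exists>h'\<le>Suc (length x). \<forall>Q. wp x B print_graph Q (\<sigma>, h, out) \<longleftrightarrow> Q True (\<sigma>, h', out @ red_prefix K)"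
proof -
  let ?h = "pos x (enc_list (enc_list enc_nat) (klab K) @ enc_nat (kroot K) @ z)"
  have hl: "?h \<le> Suc (length x)" by (rule pos_le)
  have RT: "\<sigma> RT = kroot K" "\<sigma> ZERO = 0" and e: "\<sigma>(U := kroot K, U := 0) = \<sigma>" "\<sigma>(U := 0) = \<sigma>"
    using env env_zero[OF env] readyD[OF env_ready[OF env]] by (auto simp: env_def)
  have w1: "wp x B (range_loop U NN (outs [CConj] ;; prt (cover_c 1) ;; outs [CConj] ;; prt (persist_c 1))) Q (\<sigma>, h, out) \<longleftrightarrow>
     Q True (\<sigma>, h, out @ concat (map (\<lambda>i. (CConj # enc_fml (cover_c (wn i))) @ (CConj # enc_fml (persist_c (wn i)))) [0..<kn K]))" for Q h out
    by (rule wp_world_loop[OF env]) (simp add: amap_parts_Suc)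
  have w2: "wp x B (range_loop U NN (outs [CConj] ;; prt (match_part 1))) Q (\<sigma>, h, out) \<longleftrightarrow>
     Q True (\<sigma>, h, out @ concat (map (\<lambda>i. CConj # enc_fml (match_part (wn i))) [0..<kn K]))" for Q h out
    by (rule wp_world_loop[OF env]) (simp add: amap_parts_Suc)
  have w3: "wp x B (range_loop U NN (range_loop V U (outs [CConj] ;; prt (excl_c 1 3)))) Q (\<sigma>, h, out) \<longleftrightarrow>
     Q True (\<sigma>, h, out @ concat (map (\<lambda>i. concat (map (\<lambda>j. CConj # enc_fml (excl_c (wn i) (wn j))) [0..<i])) [0..<kn K]))" for Q h out
    by (rule wp_pair_loop[OF env]) (simp add: amap_parts_Suc)
  have e1: "wp x B (edge_loop (outs [CConj] ;; prt (Neg (Atom 1)))) Q (\<sigma>, h, out) \<longleftrightarrow>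
     Q True (\<sigma>, ?h, out @ concat (map (\<lambda>(u, v). CConj # enc_fml (Neg (Atom (wn u)))) (kedges K)))" if "h \<le> Suc (length x)" for Q h out
    by (rule wp_edge_loop[OF env that, where g = "\<lambda>u v. CConj # enc_fml (Neg (Atom (wn u)))"]) (simp add: inst_def enc_nat_wn)
  have e2: "wp x B (edge_loop (outs [CDisj] ;; prt (step_part 1 3))) Q (\<sigma>, h, out) \<longleftrightarrow>
     Q True (\<sigma>, ?h, out @ concat (map (\<lambda>(u, v). CDisj # enc_fml (step_part (wn u) (wn v))) (kedges K)))" if "h \<le> Suc (length x)" for Q h out
    by (rule wp_edge_loop[OF env that, where g = "\<lambda>u v. CDisj # enc_fml (step_part (wn u) (wn v))"]) (simp add: amap_parts_Suc)
  have e3: "wp x B (edge_loop (outs [CConj] ;; prt (link_part 1 3))) Q (\<sigma>, h, out) \<longleftrightarrow>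
     Q True (\<sigma>, ?h, out @ concat (map (\<lambda>(u, v). CConj # enc_fml (link_part (wn u) (wn v))) (kedges K)))" if "h \<le> Suc (length x)" for Q h out
    by (rule wp_edge_loop[OF env that, where g = "\<lambda>u v. CConj # enc_fml (link_part (wn u) (wn v))"]) (simp add: amap_parts_Suc)
  have p: "wp x B (cpy U RT) Q (\<sigma>, h, out) \<longleftrightarrow> Q True (\<sigma>(U := kroot K), h, out)"
    "wp x B (zero U) Q (\<sigma>(U := kroot K), h, out) \<longleftrightarrow> Q True (\<sigma>, h, out)" 
    "wp x B (prt (root_c 1)) Q (\<sigma>(U := kroot K), h, out) \<longleftrightarrow> Q True (\<sigma>(U := kroot K), h, out @ enc_fml (root_c (wn (kroot K))))"
    "wp x B (prt (Disj (Neg fE) (Atom 1))) Q (\<sigma>(U := kroot K), h, out) \<longleftrightarrow> 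
       Q True (\<sigma>(U := kroot K), h, out @ enc_fml (Disj (Neg fE) (Atom (wn (kroot K)))))" for Q h out
    by (simp_all add: RT e amap_parts_Suc inst_def enc_nat_wn)
  have "wp x B print_graph Q (\<sigma>, h, out) \<longleftrightarrow> Q True (\<sigma>, ?h, out @ red_prefix K)" for Q
    unfolding print_graph_def red_prefix_eq
    by (simp only: wp_Seq wp_outs w1 w2 w3 e1[OF h] e2[OF hl] e3[OF hl] p if_True append_assoc append_Cons append_Nil)
  then show ?thesis using hl by blast
qed

text \<open>The final head position and the values of \<open>PA\<close> and \<open>PB\<close> depend
  on where the comparison stops, so they are left open; the result in \<open>EQ\<close> and the
  other registers are all that the caller relies on.\<close>

lemma wp_cmp_loop:
  "\<lbrakk>ready \<tau>; \<tau> PA = pos x y1; \<tau> PB = pos x y2; \<tau> GO = 1; \<tau> EQ = 0; suffix y1 x; suffix y2 x; h \<le> Suc (length x)\<rbrakk> \<Longrightarrow>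
   wp x B (Loop (pos_reg GO) cmp_body) (\<lambda>ok (\<tau>', h', out'). ok \<and> out' = out \<and> h' \<le> Suc (length x) \<and> \<tau>' GO = 0 \<and>
     \<tau>' EQ = of_bool (cmp y1 y2) \<and> (\<forall>r. r \<notin> {PA, PB, GO, EQ} \<longrightarrow> \<tau>' r = \<tau> r)) (\<tau>, h, out)"
proof (induction y1 arbitrary: y2 \<tau> h)
  case Nil
  let ?P = "\<lambda>ok (\<tau>', h', out'). ok \<and> out' = out \<and> h' \<le> Suc (length x) \<and> \<tau>' GO = 0 \<and>
     \<tau>' EQ = of_bool (cmp [] y2) \<and> (\<forall>r. r \<notin> {PA, PB, GO, EQ} \<longrightarrow> \<tau>' r = \<tau> r)"
  have "wp x B (Loop (pos_reg GO) cmp_body) ?P (\<tau>(GO := 0), h', out)" if "h' \<le> Suc (length x)" for h'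
    by (subst wp_Loop) (use Nil.prems that readyD[OF Nil.prems(1)] in simp)
  then show ?case using Nil.prems readyD[OF Nil.prems(1)] pos_le
    by (subst wp_Loop) (simp add: cmp_body_def read_pos)
next
  case (Cons s y1)
  let ?P = "\<lambda>ok (\<tau>', h', out'). ok \<and> out' = out \<and> h' \<le> Suc (length x) \<and> \<tau>' GO = 0 \<and>
     \<tau>' EQ = of_bool (cmp (s # y1) y2) \<and> (\<forall>r. r \<notin> {PA, PB, GO, EQ} \<longrightarrow> \<tau>' r = \<tau> r)"
  note H = Cons.prems(1) readyD[OF Cons.prems(1)]
  have stop: "wp x B (Loop (pos_reg GO) cmp_body) ?P (\<tau>(GO := 0), h', out)" if "h' \<le> Suc (length x)" "\<not> cmp (s # y1) y2" for h'
    by (subst wp_Loop) (use Cons.prems that H in simp)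
  have eq: "wp x B (Loop (pos_reg GO) cmp_body) ?P (\<tau>(EQ := Suc 0, GO := 0), h', out)" if "h' \<le> Suc (length x)" "cmp (s # y1) y2" for h'
    by (subst wp_Loop) (use Cons.prems that H in simp)
  have one: "Suc 0 \<le> B" "Suc (pos x w) \<le> B" for w using B pos_le[of x w] by auto
  have step: "wp x B (Loop (pos_reg GO) cmp_body) ?P (\<tau>(PA := Suc (pos x (s # y1)), PB := Suc (pos x (s # w))), h', out)"
    if "h' \<le> Suc (length x)" "s \<in> {D0, D1}" "y2 = s # w" for h' w
  proof -
    have sf: "suffix y1 x" "suffix w x" using Cons.prems(6,7) that(3) suffix_tl by auto
    have p: "Suc (pos x (s # y1)) = pos x y1" "Suc (pos x (s # w)) = pos x w"
      using Cons.prems(6,7) that(3) by (simp_all add: pos_Cons)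
    have c: "cmp (s # y1) y2 = cmp y1 w" using that by auto
    show ?thesis unfolding p
      by (rule wp_mono[OF Cons.IH[of "\<tau>(PA := pos x y1, PB := pos x w)" w h']])
        (use Cons.prems H sf that c in \<open>auto simp del: cmp.simps\<close>)
  qed
  have nil: "\<not> cmp (s # y1) []" by simp
  consider "s = D0" | "s = D1" | "s = Hash" | "s \<notin> {D0, D1, Hash}" by blast
  then show ?case
  proof cases
    case 1
    show ?thesis
    proof (cases "\<exists>w. y2 = s # w")
      case True
      then obtain w where "y2 = s # w" by blast
      then show ?thesis using 1 Cons.prems H pos_le one step[OF _ _ \<open>y2 = s # w\<close>]
        by (subst wp_Loop) (simp add: cmp_body_def read_pos)
    next
      case False
      then have "\<not> cmp (s # y1) y2" "read_in x (pos x y2) \<noteq> Some s" using read_sfx[OF Cons.prems(7)] by (cases y2; auto)+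
      then show ?thesis using 1 Cons.prems(1-6,8) H pos_le stop
        by (subst wp_Loop) (simp add: cmp_body_def read_pos)
    qed
  next
    case 2
    show ?thesis
    proof (cases "\<exists>w. y2 = s # w")
      case True
      then obtain w where "y2 = s # w" by blast
      then show ?thesis using 2 Cons.prems H pos_le one step[OF _ _ \<open>y2 = s # w\<close>]
        by (subst wp_Loop) (simp add: cmp_body_def read_pos)
    next
      case False
      then have "\<not> cmp (s # y1) y2" "read_in x (pos x y2) \<noteq> Some s" using read_sfx[OF Cons.prems(7)] by (cases y2; auto)+
      then show ?thesis using 2 Cons.prems(1-6,8) H pos_le stop
        by (subst wp_Loop) (simp add: cmp_body_def read_pos)
    qed
  next
    case 3
    show ?thesis
    proof (cases "\<exists>w. y2 = s # w")
      case True
      then obtain w where "y2 = s # w" by blast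
      then show ?thesis using 3 Cons.prems H pos_le one eq
        by (subst wp_Loop) (simp add: cmp_body_def read_pos)
    next
      case False
      then have "\<not> cmp (s # y1) y2" "read_in x (pos x y2) \<noteq> Some s" using read_sfx[OF Cons.prems(7)] by (cases y2; auto)+
      then show ?thesis using 3 Cons.prems(1-6,8) H pos_le stop
        by (subst wp_Loop) (simp add: cmp_body_def read_pos)
    qed
  next
    case 4
    then have "\<not> cmp (s # y1) y2" by (cases y2) auto
    then show ?thesis using 4 Cons.prems H pos_le stop
      by (subst wp_Loop) (simp add: cmp_body_def read_pos)
  qed
qed

lemma wp_atom_test:
  assumes env: "env K z \<sigma>" and PP: "\<sigma> PP = pos x (CAtom # y)" "suffix (CAtom # y) x" and sf: "suffix (enc_nat q @ w) x"
  shows "wp x B atom_test Q (\<sigma>(U := i, CT2 := k), pos x (enc_nat q @ w), out) \<longleftrightarrow>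
     Q True (\<sigma>(U := i, CT2 := k), pos x w, out @ (if cmp y (enc_nat q) then CDisj # enc_fml (Atom (wn i)) else []))"
proof (rule wp_eqI)
  define \<rho> where "\<rho> = \<sigma>(U := i, CT2 := k)"
  define S where "S = (\<lambda>ok t. ok = True \<and> t = (\<rho>, pos x w, out @ (if cmp y (enc_nat q) then CDisj # enc_fml (Atom (wn i)) else [])))"
  define R where "R = (goto QB ;; Cond (pos_reg EQ) (outs [CDisj] ;; prt (Atom 1)) Skip ;;
     zero EQ ;; zero PA ;; zero PB ;; zero QB ;; skipatom)"
  define \<tau> where "\<tau> = \<rho>(QB := pos x (enc_nat q @ w), GO := 1, PA := pos x y, PB := pos x (enc_nat q @ w))"
  note H = env_ready[OF env] readyD[OF env_ready[OF env]] and Z = env_zero[OF env]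
  have P: "ready \<rho>" "\<rho> ZERO = 0" "\<rho> TMP = 0" "\<rho> PA = 0" "\<rho> PB = 0" "\<rho> QB = 0" "\<rho> EQ = 0" "\<rho> GO = 0" "\<rho> PP = pos x (CAtom # y)" "\<rho> U = i"
    using H Z PP by (auto simp: \<rho>_def)
  have sy: "suffix y x" using PP(2) by (rule suffix_tl)
  have py: "Suc (pos x (CAtom # y)) = pos x y" using PP(2) by (simp add: pos_Cons)
  have B1: "Suc 0 \<le> B" "pos x y \<le> B" using B pos_le[of x y] by auto
  have loop: "wp x B (Loop (pos_reg GO) cmp_body) (\<lambda>ok (\<tau>', h', out'). ok \<and> out' = out \<and> h' \<le> Suc (length x) \<and> \<tau>' GO = 0 \<and>
     \<tau>' EQ = of_bool (cmp y (enc_nat q @ w)) \<and> (\<forall>r. r \<notin> {PA, PB, GO, EQ} \<longrightarrow> \<tau>' r = \<tau> r)) (\<tau>, pos x (enc_nat q @ w), out)"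
    by (rule wp_cmp_loop) (use P sy sf pos_le in \<open>auto simp: \<tau>_def\<close>)
  have rest: "wp x B R S (\<tau>', h', out)"
    if h: "h' \<le> Suc (length x)" and t: "\<tau>' GO = 0" "\<tau>' EQ = of_bool (cmp y (enc_nat q))" "\<forall>r. r \<notin> {PA, PB, GO, EQ} \<longrightarrow> \<tau>' r = \<tau> r" for \<tau>' h'
  proof -
    have t': "\<tau>' ZERO = 0" "\<tau>' TMP = 0" "\<tau>' QB = pos x (enc_nat q @ w)" "\<tau>' U = i" using t(3) P by (auto simp: \<tau>_def)
    have fin: "\<tau>'(EQ := 0, PA := 0, PB := 0, QB := 0) = \<rho>"
    proof
      fix r show "(\<tau>'(EQ := 0, PA := 0, PB := 0, QB := 0)) r = \<rho> r"
        using t P by (cases "r \<in> {PA, PB, GO, EQ}") (auto simp: \<tau>_def)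
    qed
    show ?thesis using h t(2) t' pos_le sf fin by (simp add: R_def S_def enc_nat_wn)
  qed
  have "wp x B (Loop (pos_reg GO) cmp_body) (\<lambda>ok t. if ok then wp x B R S t else S False t) (\<tau>, pos x (enc_nat q @ w), out)"
  proof (rule wp_mono[OF loop], goal_cases)
    case (1 ok s')
    obtain \<tau>' h' out' where s': "s' = (\<tau>', h', out')" by (metis prod_cases3)
    show ?case using 1 rest[of h' \<tau>'] unfolding s' cmp_enc_cut by (simp add: S_def)
  qed
  moreover have "\<rho>(QB := pos x (enc_nat q @ w), GO := Suc 0, PA := pos x y, PB := pos x (enc_nat q @ w)) = \<tau>"
    by (simp add: \<tau>_def)
  ultimately have "wp x B atom_test S (\<rho>, pos x (enc_nat q @ w), out)"
    unfolding atom_test_def R_def[symmetric] using P pos_pos pos_le py B1 by simp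
  then show "wp x B atom_test (\<lambda>ok t. ok = True \<and> t = (\<sigma>(U := i, CT2 := k), pos x w,
     out @ (if cmp y (enc_nat q) then CDisj # enc_fml (Atom (wn i)) else []))) (\<sigma>(U := i, CT2 := k), pos x (enc_nat q @ w), out)"
    by (simp only: S_def \<rho>_def)
qed

lemma wp_match_loop:
  assumes env: "env K z \<sigma>" and PP: "\<sigma> PP = pos x (CAtom # y)" "suffix (CAtom # y) x" and h: "h \<le> Suc (length x)"
  shows "wp x B match_loop Q (\<sigma>, h, out) \<longleftrightarrow> Q True (\<sigma>, pos x (enc_nat (kroot K) @ z), out @ pre K y)"
proof -
  note H = env_ready[OF env] readyD[OF env_ready[OF env]] and Z = env_zero[OF env]
  let ?y = "\<lambda>i. concat (map (enc_list enc_nat) (drop i (klab K))) @ enc_nat (kroot K) @ z"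
  let ?f = "\<lambda>i. concat (map (\<lambda>q. if cmp y (enc_nat q) then CDisj # enc_fml (Atom (wn i)) else []) (klab K ! i))"
  have len: "length (klab K) = kn K" and LP: "\<sigma> LP = pos x (?y 0)" and n: "kn K \<le> B" "\<sigma> NN = kn K"
    using env B by (auto simp: env_def wf_nonserial_def)
  have "suffix (?y 0) x" using env_suffix(2)[OF env] by simp
  have sfi: "suffix (?y i) x" for i
  proof -
    have "?y 0 = concat (map (enc_list enc_nat) (take i (klab K))) @ ?y i"
      by (simp flip: concat_append map_append append_assoc)
    then show ?thesis using suffix_app \<open>suffix (?y 0) x\<close> by metis
  qed
  have body: "wp x B (readnum CT2 ;; count_loop CT2 atom_test) Q (\<sigma>(U := i), pos x (?y i), out) \<longleftrightarrow>
     Q True (\<sigma>(U := i), pos x (?y (Suc i)), out @ ?f i)" if i: "i < kn K" for i out Q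
  proof -
    have y: "?y i = enc_nat (length (klab K ! i)) @ concat (map enc_nat (klab K ! i)) @ ?y (Suc i)"
      using i len by (simp add: Cons_nth_drop_Suc[symmetric] enc_list_def)
    have l: "length (klab K ! i) \<le> Suc (length x)" using env i len by (auto simp: env_def)
    have Hi: "ready (\<sigma>(U := i))" using H by simp
    note sf1 = sfi[of i, unfolded y]
    have e: "\<sigma>(U := i, CT2 := 0) = \<sigma>(U := i)" using Z by auto
    have "wp x B (count_loop CT2 atom_test) Q (\<sigma>(U := i, CT2 := length (klab K ! i)), pos x (concat (map enc_nat (klab K ! i)) @ ?y (Suc i)), out) \<longleftrightarrow>
       Q True (\<sigma>(U := i, CT2 := 0), pos x (?y (Suc i)), out @ ?f i)" for Q out
      by (rule wp_count_loop) (use H suffix_app[OF sf1] wp_atom_test[OF env PP] in auto)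
    then show ?thesis unfolding y using wp_readnum[OF Hi _ l sf1, of CT2] by (simp add: e)
  qed
  have loop: "wp x B (range_loop U NN (readnum CT2 ;; count_loop CT2 atom_test)) Q (\<sigma>, pos x (?y 0), out) \<longleftrightarrow>
     Q True (\<sigma>(U := 0), pos x (?y (kn K)), out @ concat (map ?f [0..<kn K]))" for Q
    by (rule wp_range_loop[where h = "\<lambda>i. pos x (?y i)"]) (use body n H in auto)
  have e: "\<sigma>(U := 0) = \<sigma>" using Z by auto
  have le: "\<sigma> LP \<le> Suc (length x)" using LP pos_le by simp
  show ?thesis using H h le loop len unfolding match_loop_def pre_def by (simp add: LP e)
qed

lemma env_PP: "env K z \<sigma> \<Longrightarrow> env K z (\<sigma>(PP := p))"
  by (simp add: env_def)

lemma wp_copy_loop: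
  "env K z \<sigma> \<Longrightarrow> suffix y x \<Longrightarrow>
    wp x B (Loop inside copy_body) (\<lambda>ok (\<sigma>', h', out'). ok \<and> out' = out @ sub_str K y) (\<sigma>, pos x y, out)"
proof (induction y arbitrary: \<sigma> out)
  case Nil
  then show ?case by (subst wp_Loop) (simp add: read_pos)
next
  case (Cons s y)
  note H = env_ready[OF Cons.prems(1)] readyD[OF env_ready[OF Cons.prems(1)]]
  have IH: "wp x B (Loop inside copy_body) (\<lambda>ok (\<sigma>', h', out'). ok \<and> out' = out @ sub_str K y) (\<sigma>, pos x y, out)"
    if "env K z \<sigma>" for \<sigma> out by (rule Cons.IH[OF that suffix_tl[OF Cons.prems(2)]])
  show ?case
  proof (cases "s = CAtom")
    case True
    let ?\<sigma> = "\<sigma>(PP := pos x (CAtom # y))"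
    have env: "env K z ?\<sigma>" by (rule env_PP[OF Cons.prems(1)])
    have m: "wp x B match_loop Q (?\<sigma>, h, out) \<longleftrightarrow> Q True (?\<sigma>, pos x (enc_nat (kroot K) @ z), out @ pre K y)"
      if "h \<le> Suc (length x)" for Q h out
      by (rule wp_match_loop[OF env _ _ that]) (use Cons.prems True in auto)
    show ?thesis
      using Cons.prems H True pos_le pos_pos IH[OF env, of "out @ pre K y @ [CConj, CAtom]"]
      by (subst wp_Loop) (simp add: copy_body_def read_pos m)
  next
    case ne: False
    show ?thesis
    proof (cases "s = Hash")
      case True
      then show ?thesis using Cons.prems IH[OF Cons.prems(1), of "out @ Hash # enc_fml fBot"]
        by (subst wp_Loop) (simp add: copy_body_def read_pos)
    next
      case False
      then show ?thesis using ne Cons.prems IH[OF Cons.prems(1), of "out @ [s]"]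
        by (subst wp_Loop) (simp add: copy_body_def read_pos)
    qed
  qed
qed

lemma wp_pass2:
  assumes env: "env K z \<sigma>" and PP: "\<sigma> PP = pos x z" and h: "h \<le> Suc (length x)"
  shows "wp x B pass2 (\<lambda>ok (\<sigma>', h', out'). ok \<and> out' = out @ red_prefix K @ sub_str K z) (\<sigma>, h, out)"
proof -
  note H = env_ready[OF env] readyD[OF env_ready[OF env]]
  obtain h' where h': "h' \<le> Suc (length x)"
    "\<And>Q. wp x B print_graph Q (\<sigma>, h, out) \<longleftrightarrow> Q True (\<sigma>, h', out @ red_prefix K)"
    using wp_print_graph[OF env h] by blast
  show ?thesis using wp_copy_loop[OF env env_suffix(3)[OF env], of "out @ red_prefix K"] H h' PP pos_le
    unfolding pass2_def by simp
qed

lemma Tot_notI: "Tot e P sf y out False s' \<Longrightarrow> y = e a @ z \<Longrightarrow> P a \<Longrightarrow> False"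
  by (auto simp: Tot_def)

lemma length_enc: "0 < length (enc_nat m)" by (simp add: enc_nat_def)

lemma length_concat_le: "(\<And>a. 0 < length (e a)) \<Longrightarrow> length xs \<le> length (concat (map e xs))"
proof (induction xs)
  case (Cons a xs)
  then have "length xs \<le> length (concat (map e xs))" "0 < length (e a)" by blast+
  then show ?case by (simp del: length_greater_0_conv)
qed simp

lemma length_in_concat: "a \<in> set xs \<Longrightarrow> length (e a) \<le> length (concat (map e xs))"
  by (induction xs) auto

lemma red_com_correct: "\<exists>ok \<sigma> h. big x B red_com ((\<lambda>_. 0), 0, []) ok (\<sigma>, h, red_str x)"
proof -
  define \<sigma>0 where "\<sigma>0 = (\<lambda>_::reg. 0::nat)(LMT := Suc (length x))"
  let ?post = "\<lambda>ok (\<sigma>' :: reg \<Rightarrow> nat, h' :: nat, out'). out' = red_str x"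
  have "wp x B pass1 (\<lambda>ok s'. if ok then wp x B pass2 ?post s' else ?post False s') (\<sigma>0, pos x x, [])"
  proof (rule wp_mono[OF Tot_pass1[folded \<sigma>0_def]], goal_cases)
    case (1 ok s')
    show ?case
    proof (cases ok)
      case True
      then obtain n es ls r z where xs: "x = enc_nat n @ enc_list enc_edge es @ enc_list (enc_list enc_nat) ls @ enc_nat r @ z"
        and v: "n \<le> Suc (length x)" "0 < n" "length es \<le> Suc (length x)" "\<forall>(u, v)\<in>set es. u < n \<and> v < n"
          "length ls = n" "\<forall>l\<in>set ls. length l \<le> Suc (length x)" "r < n"
        and s': "s' = (\<sigma>0(NN := n, EP := pos x (enc_list enc_edge es @ enc_list (enc_list enc_nat) ls @ enc_nat r @ z),
          LP := pos x (concat (map (enc_list enc_nat) ls) @ enc_nat r @ z), RT := r, PP := pos x z), pos x z, [])"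
        using 1 unfolding Tot_def by (auto simp del: fun_upd_apply)
      define K where "K = \<lparr>kn = n, kedges = es, klab = ls, kroot = r\<rparr>"
      have wf: "wf_nonserial K" and xK: "x = enc_kripke K @ z"
        using v xs by (auto simp: wf_nonserial_def K_def enc_kripke_def)
      have "ready (fst s')" unfolding s' fst_conv by (simp add: \<sigma>0_def ready_def)
      moreover have "kn K = n" "kedges K = es" "klab K = ls" "kroot K = r" by (simp_all add: K_def)
      ultimately have env: "env K z (fst s')"
        unfolding env_def using wf xK[symmetric] v by (simp add: s' \<sigma>0_def)
      have "wp x B pass2 (\<lambda>ok (\<sigma>', h', out'). ok \<and> out' = [] @ red_prefix K @ sub_str K z) (fst s', pos x z, [])"
        by (rule wp_pass2[OF env _ pos_le]) (simp add: s')
      then have "wp x B pass2 ?post (fst s', pos x z, [])"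
        by (rule wp_mono) (auto simp: red_str_ok[OF wf xK])
      moreover have "(fst s', pos x z, []) = s'" using s' by simp
      ultimately have "wp x B pass2 ?post s'" by (simp only:)
      then show ?thesis using True by simp
    next
      case False
      have "\<not> (\<exists>K z. wf_nonserial K \<and> x = enc_kripke K @ z)"
      proof
        assume "\<exists>K z. wf_nonserial K \<and> x = enc_kripke K @ z"
        then obtain K z where K: "wf_nonserial K" "x = enc_kripke K @ z" by blast
        have xs: "x = enc_nat (kn K) @ enc_list enc_edge (kedges K) @ enc_list (enc_list enc_nat) (klab K) @ enc_nat (kroot K) @ z"
          using K(2) by (simp add: enc_kripke_def)
        \<comment> \<open>Entries have nonempty codes, so the lists of a genuine structure are no
          longer than \<open>x\<close>, and the limits imposed by \<open>readnum\<close> reject no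
          valid input.\<close>
        have l1: "length (kedges K) \<le> length (concat (map enc_edge (kedges K)))"
          by (rule length_concat_le) (auto simp: enc_nat_def)
        have l2: "length (klab K) \<le> length (concat (map (enc_list enc_nat) (klab K)))"
          by (rule length_concat_le) (simp add: enc_list_def enc_nat_def)
        have l3: "length l \<le> length (concat (map (enc_list enc_nat) (klab K)))" if "l \<in> set (klab K)" for l
        proof -
          have "length l \<le> length (concat (map enc_nat l))" by (rule length_concat_le) (rule length_enc)
          also have "\<dots> \<le> length (enc_list enc_nat l)" by (simp add: enc_list_def)
          also have "\<dots> \<le> length (concat (map (enc_list enc_nat) (klab K)))" by (rule length_in_concat[OF that])
          finally show ?thesis .
        qed
        have "length (concat (map enc_edge (kedges K))) + length (concat (map (enc_list enc_nat) (klab K))) \<le> length x"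
          unfolding xs length_append enc_list_def by linarith
        then have "length (kedges K) \<le> Suc (length x)" "length (klab K) \<le> Suc (length x)" "\<forall>l\<in>set (klab K). length l \<le> Suc (length x)"
          using l1 l2 l3 by fastforce+
        moreover have "kn K = length (klab K)" "0 < kn K" "kroot K < kn K" "\<forall>(u, v)\<in>set (kedges K). u < kn K \<and> v < kn K"
          using K(1) by (auto simp: wf_nonserial_def)
        ultimately have len: "kn K \<le> Suc (length x)" "length (kedges K) \<le> Suc (length x)" "length (klab K) = kn K"
          "\<forall>l\<in>set (klab K). length l \<le> Suc (length x)" "0 < kn K" "kroot K < kn K"
          "\<forall>(u, v)\<in>set (kedges K). u < kn K \<and> v < kn K" by simp_all
        have okF: "ok = False" using False by simp
        show False
        proof (rule Tot_notI[OF 1[unfolded okF], of "(kn K, kedges K, klab K, kroot K)" z], unfold prod.case append_assoc)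
          show "x = enc_nat (kn K) @ enc_list enc_edge (kedges K) @ enc_list (enc_list enc_nat) (klab K) @ enc_nat (kroot K) @ z"
            by (rule xs)
          have "kroot K \<le> Suc (length x)" "length (klab K) \<le> Suc (length x)" using len by linarith+
          then show "(kn K \<le> Suc (length x) \<and> 0 < kn K) \<and>
            (length (kedges K) \<le> Suc (length x) \<and> (\<forall>(u, v)\<in>set (kedges K). u < kn K \<and> v < kn K)) \<and>
            ((length (klab K) \<le> Suc (length x) \<and> length (klab K) = kn K) \<and> (\<forall>l\<in>set (klab K). length l \<le> Suc (length x))) \<and>
            kroot K \<le> Suc (length x) \<and> kroot K < kn K"
            using len by blast
        qed
      qed
      then show ?thesis using 1 False by (auto simp: Tot_def red_str_fail)
    qed
  qed
  then have "wp x B red_com ?post ((\<lambda>_. 0), 0, [])"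
    unfolding red_com_def by (simp add: wp_init \<sigma>0_def)
  then show ?thesis unfolding wp_def by auto
qed

end

theorem red_str_logspace: "logspace_computable red_str"
proof (rule logspace_computable_com)
  fix x
  interpret input x "2 * length x + 4" by unfold_locales simp
  show "\<exists>ok \<sigma> h. big x (2 * length x + 4) red_com ((\<lambda>_. 0), 0, []) ok (\<sigma>, h, red_str x)"
    by (rule red_com_correct)
qed

theorem mainTheorem18:
  fixes k :: nat
  assumes "2 \<le> k"
  shows "logspace_reducible (MC_lang k) (SAT_lang k)"
  using red_str_logspace red_str_correct[OF assms] unfolding logspace_reducible_def by blast

end
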